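(* Let $(X,d_X,m_X)$ be a metric measure space with $\operatorname{supp}m_X=X$ that satisfies $CD(k,N)$ for an admissible function $k:X\to\mathbb R$ and $N\in[1,\infty)$. Then $(X,d_X)$ is a proper metric space, each bounded set has finite measure and satisfies a doubling property, and either $m_X$ is supported by one point or all points and all spheres have mass $0$. In particular, if $N>1$, then for each $x_0\in X$, for all $0<r<R$ and $\underline k\in\mathbb R$ such that $k|_{B_R(x_0)}\ge\underline k$ and $R\le\pi\sqrt{(N-1)/(\underline k\vee0)}$ (with the right-hand side $=\infty$ if $\underline k\le0$), $$\frac{s(r)}{s(R)}\ge\frac{\sin_{\underline k/(N-1)}(r)^{N-1}}{\sin_{\underline k/(N-1)}(R)^{N-1}}\quad\text{and}\quad\frac{v(r)}{v(R)}\ge\frac{\int_0^r\sin_{\underline k/(N-1)}(t)^{N-1}dt}{\int_0^R\sin_{\underline k/(N-1)}(t)^{N-1}dt}.$$ If $N=1$ and $k\le0$, then for each $x_0\in X$ and all $0<r<R$: $\frac{s(r)}{s(R)}\ge1$ and $\frac{v(r)}{v(R)}\ge\frac rR$.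
   Context: For $x_0\in X$, $v(r)=m_X(\bar B_r(x_0))$ and $s(r)=\limsup_{\delta\downarrow0}\frac1\delta m_X(\bar B_{r+\delta}(x_0)\setminus B_r(x_0))$. For $K\in\mathbb R$, $\sin_K$ is the solution of $u''+Ku=0$, $u(0)=0$, $u'(0)=1$. A bounded set $X'\subset X$ satisfies a doubling property if there is $C<\infty$ with $m_X(B_{2r}(x))\le C\,m_X(B_r(x))$ for all $x\in X'$ and $r>0$ with $B_{2r}(x)\subset X'$. A function $k:X\to\mathbb R$ is admissible if it is lower semicontinuous and locally bounded from below. A metric measure space $(X,d_X,m_X)$ is a complete separable metric space $(X,d_X)$ with a Borel measure $m_X$ such that for every $x\in X$ there is $r>0$ with $m_X(B_r(x))\in(0,\infty)$; also $m_X(X)\ne 0$. A geodesic is a distance-minimizing curve $\gamma:[0,1]\to X$ of constant speed; $|\dot\gamma|$ denotes its speed, i.e. its length. $\mathcal G(X)$ is the set of geodesics with the sup-distance, and $e_t(\gamma)=\gamma(t)$. $\mathcal P_2(X)$ is the set of Borel probability measures with finite second moment, with the $L^2$-Wasserstein distance, and $\mathcal P_2(X,m_X)$ is the subset of $m_X$-absolutely continuous ones. A dynamical optimal coupling of $\mu_0,\mu_1$ is a probability measure $\Pi$ on $\mathcal G(X)$ such that $(e_0,e_1)_*\Pi$ is an optimal coupling (for the cost $d_X^2$) of $\mu_0,\mu_1$. Distortion coefficients. For $\theta>0$ and continuous $\kappa:[0,\theta]\to\mathbb R$ let $\mathfrak s_\kappa$ be the solution of $u''+\kappa u=0$, $u(0)=0$,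 $u'(0)=1$. For $t\in[0,1]$ put $\sigma^{(t)}_\kappa(\theta)=\mathfrak s_\kappa(t\theta)/\mathfrak s_\kappa(\theta)$ if $\mathfrak s_\kappa>0$ on $(0,\theta]$, and $\sigma^{(t)}_\kappa(\theta)=\infty$ otherwise. For lower semicontinuous $\kappa:[0,\theta]\to\mathbb R$ put $\kappa_n(s)=\inf_{r\in[0,\theta]}\{\kappa(r)+n|s-r|\}$ and $\sigma^{(t)}_\kappa(\theta)=\lim_{n\to\infty}\sigma^{(t)}_{\kappa_n}(\theta)\in[0,\infty]$ (consistent for continuous $\kappa$). Put $\sigma_\kappa^{(t)}(0)=t$. For lower semicontinuous $k:X\to\mathbb R$ and a geodesic $\gamma$ with $\theta=|\dot\gamma|$ let $\bar\gamma:[0,\theta]\to X$ be its unit speed reparametrization, $k^+_\gamma=k_\gamma=k\circ\bar\gamma$ and $k^-_\gamma(s)=k_\gamma(\theta-s)$. For $N>0$ set $\sigma^{(t)}_{k^\pm_\gamma,N}(\theta)=\sigma^{(t)}_{k^\pm_\gamma/N}(\theta)$. For $N>1$ set $\tau^{(t)}_{k^\pm_\gamma,N}(\theta)=t^{1/N}\big[\sigma^{(t)}_{k^\pm_\gamma,N-1}(\theta)\big]^{(N-1)/N}$; for $N=1$ set $\tau^{(t)}_{k_\gamma^\pm,1}(\theta)=\theta\cdot\infty$ if $k_\gamma>0$ and $=t$ otherwise. Conventions: $r\cdot\infty=\infty$ for $r>0$, $0\cdot\infty=0$, $\infty^\alpha=\infty$ for $\alpha>0$. Condition $CD(k,N)$,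 $N\ge1$. For $\nu=\varrho m_X+\nu^s$ (Lebesgue decomposition) let $S_N(\nu)=-\int_X\varrho^{1-1/N}\,dm_X$. $(X,d_X,m_X)$ satisfies $CD(k,N)$ if for each pair $\nu_0=\varrho_0m_X,\nu_1=\varrho_1m_X\in\mathcal P_2(X,m_X)$ with bounded support there exist a dynamical optimal coupling $\Pi$ of $\nu_0,\nu_1$ and a geodesic $(\nu_t)_{t\in[0,1]}\subset\mathcal P_2(X,m_X)$ from $\nu_0$ to $\nu_1$ such that $$S_{N'}(\nu_t)\le-\int\Big[\tau^{(1-t)}_{k^-_\gamma,N'}(|\dot\gamma|)\varrho_0(\gamma(0))^{-1/N'}+\tau^{(t)}_{k^+_\gamma,N'}(|\dot\gamma|)\varrho_1(\gamma(1))^{-1/N'}\Big]d\Pi(\gamma)$$ for all $t\in[0,1]$ and all $N'\ge N$. *)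

theory Defs
  imports "HOL-Probability.Probability"
begin

text \<open>A complete separable metric space is a type of class \<open>polish_space\<close>.\<close>

definition metric_measure_space :: "'a::polish_space measure \<Rightarrow> bool" where
  "metric_measure_space M \<longleftrightarrow>
     sets M = sets borel \<and>
     (\<forall>x. \<exists>r>0. 0 < emeasure M (ball x r) \<and> emeasure M (ball x r) < \<infinity>) \<and>
     emeasure M UNIV \<noteq> 0"

definition msupport :: "'a::topological_space measure \<Rightarrow> 'a set" where
  "msupport M = {x. \<forall>U. open U \<and> x \<in> U \<longrightarrow> 0 < emeasure M U}"

definition lower_semicontinuous :: "('a::topological_space \<Rightarrow> real) \<Rightarrow> bool" where
  "lower_semicontinuous k \<longleftrightarrow> (\<forall>x. \<forall>a<k x. \<forall>\<^sub>F y in nhds x. a < k y)"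

definition admissible_curv :: "('a::metric_space \<Rightarrow> real) \<Rightarrow> bool" where
  "admissible_curv k \<longleftrightarrow>
     lower_semicontinuous k \<and> (\<forall>x. \<exists>r>0. \<exists>c. \<forall>y\<in>ball x r. c \<le> k y)"

definition doubling_on :: "'a::metric_space measure \<Rightarrow> 'a set \<Rightarrow> bool" where
  "doubling_on M X' \<longleftrightarrow>
     (\<exists>C::real. \<forall>x\<in>X'. \<forall>r>0. ball x (2 * r) \<subseteq> X' \<longrightarrow>
        emeasure M (ball x (2 * r)) \<le> ennreal C * emeasure M (ball x r))"

definition vol :: "'a::metric_space measure \<Rightarrow> 'a \<Rightarrow> real \<Rightarrow> ennreal" where
  "vol M x\<^sub>0 r = emeasure M (cball x\<^sub>0 r)"

definition sph :: "'a::metric_space measure \<Rightarrow> 'a \<Rightarrow> real \<Rightarrow> ennreal" where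
  "sph M x\<^sub>0 r =
     Limsup (at_right 0) (\<lambda>\<delta>. ennreal (1 / \<delta>) * emeasure M (cball x\<^sub>0 (r + \<delta>) - ball x\<^sub>0 r))"

text \<open>A curve on \<open>[0,1]\<close> is represented by its extension to the real line that is constant on
  \<open>(-\<infinity>,0]\<close> and on \<open>[1,\<infinity>)\<close>. On such extensions the metric of the type of bounded
  continuous functions is the supremum distance over \<open>[0,1]\<close>, so the Borel \<open>\<sigma>\<close>-algebra of the
  space of geodesics is the restriction of \<open>borel\<close>.\<close>

definition geodesics :: "(real \<Rightarrow>\<^sub>C 'a::metric_space) set" where
  "geodesics = {\<gamma>.
     (\<forall>s\<in>{0..1}. \<forall>t\<in>{0..1}. dist (apply_bcontfun \<gamma> s) (apply_bcontfun \<gamma> t) =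
        \<bar>s - t\<bar> * dist (apply_bcontfun \<gamma> 0) (apply_bcontfun \<gamma> 1)) \<and>
     (\<forall>t<0. apply_bcontfun \<gamma> t = apply_bcontfun \<gamma> 0) \<and>
     (\<forall>t>1. apply_bcontfun \<gamma> t = apply_bcontfun \<gamma> 1)}"

definition speed :: "(real \<Rightarrow>\<^sub>C 'a::metric_space) \<Rightarrow> real" where
  "speed \<gamma> = dist (apply_bcontfun \<gamma> 0) (apply_bcontfun \<gamma> 1)"

text \<open>For a constant geodesic, \<open>s / 0 = 0\<close> gives the correct value at the only parameter
  \<open>s = 0\<close>.\<close>

definition unit_speed :: "(real \<Rightarrow>\<^sub>C 'a::metric_space) \<Rightarrow> real \<Rightarrow> 'a" where
  "unit_speed \<gamma> s = apply_bcontfun \<gamma> (s / speed \<gamma>)"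

definition k_plus :: "('a::metric_space \<Rightarrow> real) \<Rightarrow> (real \<Rightarrow>\<^sub>C 'a) \<Rightarrow> real \<Rightarrow> real" where
  "k_plus k \<gamma> s = k (unit_speed \<gamma> s)"

definition k_minus :: "('a::metric_space \<Rightarrow> real) \<Rightarrow> (real \<Rightarrow>\<^sub>C 'a) \<Rightarrow> real \<Rightarrow> real" where
  "k_minus k \<gamma> s = k_plus k \<gamma> (speed \<gamma> - s)"

definition couplings ::
  "'a::polish_space measure \<Rightarrow> 'a measure \<Rightarrow> ('a \<times> 'a) measure set" where
  "couplings \<mu> \<nu> = {q. sets q = sets borel \<and> distr q borel fst = \<mu> \<and> distr q borel snd = \<nu>}"

definition transport_cost :: "('a::polish_space \<times> 'a) measure \<Rightarrow> ennreal" where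
  "transport_cost q = (\<integral>\<^sup>+ z. ennreal ((dist (fst z) (snd z))\<^sup>2) \<partial>q)"

definition optimal_coupling ::
  "'a::polish_space measure \<Rightarrow> 'a measure \<Rightarrow> ('a \<times> 'a) measure \<Rightarrow> bool" where
  "optimal_coupling \<mu> \<nu> q \<longleftrightarrow>
     q \<in> couplings \<mu> \<nu> \<and> (\<forall>q'\<in>couplings \<mu> \<nu>. transport_cost q \<le> transport_cost q')"

definition P2 :: "'a::polish_space measure set" where
  "P2 = {\<mu>. sets \<mu> = sets borel \<and> prob_space \<mu> \<and>
            (\<exists>x\<^sub>0. (\<integral>\<^sup>+ x. ennreal ((dist x\<^sub>0 x)\<^sup>2) \<partial>\<mu>) < \<infinity>)}"

definition P2_ac :: "'a::polish_space measure \<Rightarrow> 'a measure set" where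
  "P2_ac M = {\<mu> \<in> P2. absolutely_continuous M \<mu>}"

text \<open>The infimum is finite for measures in \<open>P2\<close>; \<open>W2\<close> is only meant to be used there.\<close>

definition W2 :: "'a::polish_space measure \<Rightarrow> 'a measure \<Rightarrow> real" where
  "W2 \<mu> \<nu> = sqrt (enn2real (INF q\<in>couplings \<mu> \<nu>. transport_cost q))"

definition W2_geodesic_ac ::
  "'a::polish_space measure \<Rightarrow> 'a measure \<Rightarrow> 'a measure \<Rightarrow> (real \<Rightarrow> 'a measure) \<Rightarrow> bool" where
  "W2_geodesic_ac M \<nu>\<^sub>0 \<nu>\<^sub>1 \<nu> \<longleftrightarrow>
     \<nu> 0 = \<nu>\<^sub>0 \<and> \<nu> 1 = \<nu>\<^sub>1 \<and> (\<forall>t\<in>{0..1}. \<nu> t \<in> P2_ac M) \<and>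
     (\<forall>s\<in>{0..1}. \<forall>t\<in>{0..1}. W2 (\<nu> s) (\<nu> t) = \<bar>s - t\<bar> * W2 \<nu>\<^sub>0 \<nu>\<^sub>1)"

definition dyn_optimal_coupling ::
  "'a::polish_space measure \<Rightarrow> 'a measure \<Rightarrow> (real \<Rightarrow>\<^sub>C 'a) measure \<Rightarrow> bool" where
  "dyn_optimal_coupling \<mu> \<nu> P \<longleftrightarrow>
     prob_space P \<and> sets P = sets (restrict_space borel geodesics) \<and>
     optimal_coupling \<mu> \<nu> (distr P borel (\<lambda>\<gamma>. (apply_bcontfun \<gamma> 0, apply_bcontfun \<gamma> 1)))"

text \<open>\<open>u'' + \<kappa> u = 0\<close> on the interval \<open>I\<close> (one-sided derivatives at end points) with
  \<open>u(0) = 0\<close> and \<open>u'(0) = 1\<close>; \<open>v\<close> is the derivative of \<open>u\<close>.\<close>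

definition jacobi_solution :: "(real \<Rightarrow> real) \<Rightarrow> real set \<Rightarrow> (real \<Rightarrow> real) \<Rightarrow> bool" where
  "jacobi_solution \<kappa> I u \<longleftrightarrow>
     u 0 = 0 \<and>
     (\<exists>v. v 0 = 1 \<and>
        (\<forall>s\<in>I. (u has_real_derivative v s) (at s within I) \<and>
               (v has_real_derivative - (\<kappa> s * u s)) (at s within I)))"

definition sin_curv :: "real \<Rightarrow> real \<Rightarrow> real" where
  "sin_curv K = (THE u. jacobi_solution (\<lambda>_. K) UNIV u)"

text \<open>The solution on \<open>[0,\<theta>]\<close> is unique; the values outside \<open>[0,\<theta>]\<close> are irrelevant and unspecified.\<close>

definition s_gen :: "(real \<Rightarrow> real) \<Rightarrow> real \<Rightarrow> real \<Rightarrow> real" where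
  "s_gen \<kappa> \<theta> = (SOME u. jacobi_solution \<kappa> {0..\<theta>} u)"

definition sigma_cont :: "(real \<Rightarrow> real) \<Rightarrow> real \<Rightarrow> real \<Rightarrow> ennreal" where
  "sigma_cont \<kappa> t \<theta> =
     (if \<forall>s\<in>{0<..\<theta>}. 0 < s_gen \<kappa> \<theta> s
      then ennreal (s_gen \<kappa> \<theta> (t * \<theta>) / s_gen \<kappa> \<theta> \<theta>) else \<infinity>)"

definition lip_approx :: "(real \<Rightarrow> real) \<Rightarrow> real \<Rightarrow> nat \<Rightarrow> real \<Rightarrow> real" where
  "lip_approx \<kappa> \<theta> n s = (INF r\<in>{0..\<theta>}. \<kappa> r + real n * \<bar>s - r\<bar>)"

definition sigma :: "(real \<Rightarrow> real) \<Rightarrow> real \<Rightarrow> real \<Rightarrow> ennreal" where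
  "sigma \<kappa> t \<theta> =
     (if \<theta> = 0 then ennreal t else lim (\<lambda>n. sigma_cont (lip_approx \<kappa> \<theta> n) t \<theta>))"

text \<open>Since \<open>0 powr 0 = 0\<close>, this uses the convention that zero to the power zero is zero. Hence
  the entropy below for \<open>N = 1\<close> is minus the \<open>M\<close>-measure of the set where the density is
  positive, i.e. it is the integral of \<open>- \<rho> powr (- 1 / N)\<close> against \<open>\<rho> M\<close> as for \<open>N > 1\<close>.\<close>

definition ennpowr :: "ennreal \<Rightarrow> real \<Rightarrow> ennreal" where
  "ennpowr x a =
     (if x = \<infinity> then (if a > 0 then \<infinity> else if a = 0 then 1 else 0)
      else if x = 0 \<and> a < 0 then \<infinity>
      else ennreal (enn2real x powr a))"

text \<open>Multiplication on \<open>ennreal\<close> satisfies \<open>0 * \<infinity> = 0\<close> and \<open>r * \<infinity> = \<infinity>\<close> for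
  \<open>r > 0\<close>.\<close>

definition tau :: "real \<Rightarrow> (real \<Rightarrow> real) \<Rightarrow> real \<Rightarrow> real \<Rightarrow> ennreal" where
  "tau N \<kappa> t \<theta> =
     (if N = 1 then (if \<forall>s\<in>{0..\<theta>}. 0 < \<kappa> s then ennreal \<theta> * \<infinity> else ennreal t)
      else ennpowr (ennreal t) (1 / N) *
           ennpowr (sigma (\<lambda>s. \<kappa> s / (N - 1)) t \<theta>) ((N - 1) / N))"

definition lebesgue_decomposition ::
  "'a measure \<Rightarrow> 'a measure \<Rightarrow> ('a \<Rightarrow> ennreal) \<Rightarrow> 'a measure \<Rightarrow> bool" where
  "lebesgue_decomposition M \<nu> \<rho> \<nu>s \<longleftrightarrow>
     \<rho> \<in> borel_measurable M \<and> sets \<nu>s = sets M \<and>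
     (\<exists>A\<in>sets M. emeasure M A = 0 \<and> emeasure \<nu>s (space M - A) = 0) \<and>
     (\<forall>B\<in>sets M. emeasure \<nu> B = emeasure (density M \<rho>) B + emeasure \<nu>s B)"

definition ac_density :: "'a measure \<Rightarrow> 'a measure \<Rightarrow> 'a \<Rightarrow> ennreal" where
  "ac_density M \<nu> = (SOME \<rho>. \<exists>\<nu>s. lebesgue_decomposition M \<nu> \<rho> \<nu>s)"

definition renyi_entropy :: "real \<Rightarrow> 'a measure \<Rightarrow> 'a measure \<Rightarrow> ereal" where
  "renyi_entropy N M \<nu> = - enn2ereal (\<integral>\<^sup>+ x. ennpowr (ac_density M \<nu> x) (1 - 1 / N) \<partial>M)"

definition CD :: "'a::polish_space measure \<Rightarrow> ('a \<Rightarrow> real) \<Rightarrow> real \<Rightarrow> bool" where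
  "CD M k N \<longleftrightarrow>
     (\<forall>\<nu>\<^sub>0\<in>P2_ac M. \<forall>\<nu>\<^sub>1\<in>P2_ac M. bounded (msupport \<nu>\<^sub>0) \<longrightarrow> bounded (msupport \<nu>\<^sub>1) \<longrightarrow>
       (\<exists>P \<nu>. dyn_optimal_coupling \<nu>\<^sub>0 \<nu>\<^sub>1 P \<and> W2_geodesic_ac M \<nu>\<^sub>0 \<nu>\<^sub>1 \<nu> \<and>
         (\<forall>t\<in>{0..1}. \<forall>N'\<ge>N.
            renyi_entropy N' M (\<nu> t) \<le>
              - enn2ereal (\<integral>\<^sup>+ \<gamma>.
                  (tau N' (k_minus k \<gamma>) (1 - t) (speed \<gamma>)
                     * ennpowr (ac_density M \<nu>\<^sub>0 (apply_bcontfun \<gamma> 0)) (- 1 / N')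
                 + tau N' (k_plus k \<gamma>) t (speed \<gamma>)
                     * ennpowr (ac_density M \<nu>\<^sub>1 (apply_bcontfun \<gamma> 1)) (- 1 / N')) \<partial>P))))"

end

theory Submission
  imports Defs
begin

text \<open>
  Curvature enters only through transports towards a small ball. Let \<open>A\<close> be a set in the annulus
  \<open>{a \<le> d(x,\<cdot>) \<le> b}\<close>, transport the uniform measure of a ball of radius \<open>\<epsilon>\<close> about \<open>x\<close> to the
  uniform measure of \<open>A\<close>, and drop the first of the two terms in the entropy inequality. On its
  left-hand side, concavity of \<open>r \<mapsto> r powr (1 - 1/N)\<close> bounds the entropy by the measure of any
  set that carries the intermediate measure \<open>\<nu>\<^sub>t\<close>. If \<open>\<tau> \<ge> c\<close> along the geodesics involved, the
  outcome is \<open>c powr N * m(A) \<le> m(annulus from ta to tb)\<close> as \<open>\<epsilon> \<rightarrow> 0\<close> (lemmas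
  \<open>CD_contraction\<close> and \<open>CD_annulus\<close>). This inequality carries the whole proof.

  Two points need care. The geodesic \<open>\<nu>\<close> in Wasserstein space and the measure on geodesics are
  separate data, so the location of \<open>\<nu>\<^sub>t\<close> has to be found from the distances of \<open>\<nu>\<^sub>t\<close> to the end
  points alone. Almost optimal couplings of \<open>\<nu>\<^sub>0,\<nu>\<^sub>t\<close> and of \<open>\<nu>\<^sub>t,\<nu>\<^sub>1\<close> are glued along a countable
  partition into small cells, and the equality case of the triangle inequality in \<open>W\<^sub>2\<close> does the rest
  (\<open>W2_intermediate_concentration\<close>). The coefficient \<open>\<tau>\<close> of a lower semicontinuous function is a
  limit over Lipschitz approximations; Sturm comparison shows that the limit exists and bounds it
  below by the coefficient of a constant (\<open>sigma_ge\<close>, \<open>tau_ge\<close>). As nonnegative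
  integrals are suprema over simple functions below the integrand, such bounds can be used without
  measurability of \<open>\<tau>\<close> in the geodesic.

  Near each point \<open>k\<close> is bounded below, so balls shrink by controlled factors. This makes small closed
  balls totally bounded, hence compact. There are geodesics between points arbitrarily near to any
  two given ones, so the Hopf-Rinow argument makes \<open>X\<close> proper, and then \<open>k\<close> is bounded below and
  \<open>m\<close> is finite on all bounded sets. Doubling is the same ball estimate with uniform constants.

  For the sharp inequalities, apply the annulus inequality to thin annuli. With the comparison
  function \<open>g = sin_K powr (N - 1)\<close> it says that \<open>s / g\<close> is nonincreasing; packing disjoint scaled
  copies of a thin annulus into a ball shows that spheres are null and \<open>s\<close> is finite. Since \<open>s\<close> is
  the upper right derivative of the volume, a Dini derivative argument turns the monotonicity of
  \<open>s / g\<close> into that of \<open>v / \<integral> g\<close>. The hypothesis \<open>k \<ge> klow\<close> holds only on the open ball of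
  radius \<open>R\<close>, and \<open>g\<close> may vanish at \<open>R\<close>; both are overcome by comparing \<open>s(r)\<close> with \<open>s(R')\<close> for
  \<open>R' < R\<close> through \<open>g\<close>, comparing \<open>s(R')\<close> with \<open>s(R)\<close> through a crude lower bound of \<open>k\<close>
  on a larger ball, and letting \<open>R'\<close> tend to \<open>R\<close> (\<open>radial_comparison_endpoint\<close>).
\<close>

section \<open>Jacobi equation and distortion coefficients\<close>

lemma indefinite_integral_exp_bound:
  fixes f :: "real \<Rightarrow> real"
  assumes f: "continuous_on {0..\<theta>} f" and L: "L > 0" and B: "0 \<le> B"
    and bd: "\<And>r. r \<in> {0..\<theta>} \<Longrightarrow> \<bar>f r\<bar> \<le> B * exp (L * r)"
    and s: "s \<in> {0..\<theta>}"
  shows "\<bar>integral {0..s} f\<bar> \<le> B / L * exp (L * s)"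
proof -
  have s0: "0 \<le> s" "s \<le> \<theta>" using s by auto
  have e: "((\<lambda>r. B * exp (L * r)) has_integral (B / L * exp (L * s) - B / L * exp (L * 0))) {0..s}"
    by (rule fundamental_theorem_of_calculus)
       (use s0 L in \<open>auto intro!: derivative_eq_intros simp: has_real_derivative_iff_has_vector_derivative[symmetric]\<close>)
  have "norm (integral {0..s} f) \<le> integral {0..s} (\<lambda>r. B * exp (L * r))"
    using s0 bd e
    by (intro integral_norm_bound_integral integrable_continuous_real continuous_on_subset[OF f])
       (auto intro!: integrable_continuous_real continuous_intros)
  also have "\<dots> = B / L * exp (L * s) - B / L * exp (L * 0)"
    using e by (rule integral_unique)
  also have "\<dots> \<le> B / L * exp (L * s)" using L B by simp
  finally show ?thesis by simp
qed

text \<open>The Jacobi equation is solved as the fixed point equation \<open>u = s - \<integral>\<integral> \<kappa> u\<close> for \<open>u = exp(Ls) w\<close>;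
  the exponential weight makes the operator a contraction on the whole interval at once.\<close>

lemma jacobi_solution_exists:
  assumes \<kappa>: "continuous_on {0..\<theta>} \<kappa>" and \<theta>: "0 < \<theta>"
  shows "\<exists>u. jacobi_solution \<kappa> {0..\<theta>} u"
proof -
  have "compact (\<kappa> ` {0..\<theta>})" by (intro compact_continuous_image \<kappa> compact_Icc)
  then obtain C where C: "C > 0" "\<And>r. r \<in> {0..\<theta>} \<Longrightarrow> \<bar>\<kappa> r\<bar> \<le> C"
    using compact_imp_bounded[of "\<kappa> ` {0..\<theta>}"] unfolding bounded_pos by (auto simp: image_iff)
  \<comment> \<open>Each integration against \<open>exp(Lr)\<close> gains a factor \<open>1 / L\<close>, so two of them give the
    contraction constant \<open>C / L^2 = 1 / 2\<close>.\<close>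
  define L where "L = sqrt (2 * C)"
  have L: "L > 0" "L * L = 2 * C" using C by (auto simp: L_def)
  \<comment> \<open>Clamping turns functions on the interval into bounded continuous functions on the line, which
    form a complete space.\<close>
  define c where "c s = max 0 (min \<theta> s)" for s :: real
  have c: "c s \<in> {0..\<theta>}" "s \<in> {0..\<theta>} \<Longrightarrow> c s = s" for s using \<theta> by (auto simp: c_def)
  define G where "G w = (\<lambda>r. \<kappa> r * (exp (L * r) * apply_bcontfun w r))" for w :: "real \<Rightarrow>\<^sub>C real"
  have G: "continuous_on {0..\<theta>} (G w)" for w
    unfolding G_def by (intro continuous_intros \<kappa>) auto
  define G1 where "G1 w = (\<lambda>s. integral {0..s} (G w))" for w
  have G1: "continuous_on {0..\<theta>} (G1 w)" for w
    unfolding G1_def by (intro indefinite_integral_continuous_1 integrable_continuous_real G)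
  define G2 where "G2 w = (\<lambda>s. integral {0..s} (G1 w))" for w
  have G2: "continuous_on {0..\<theta>} (G2 w)" for w
    unfolding G2_def by (intro indefinite_integral_continuous_1 integrable_continuous_real G1)
  define F where "F w s = exp (- L * c s) * (c s - G2 w (c s))" for w s
  have "F w \<in> bcontfun" for w
  proof -
    have *: "continuous_on {0..\<theta>} (\<lambda>s. exp (- L * s) * (s - G2 w s))"
      by (intro continuous_intros G2)
    have cc: "continuous_on UNIV c" unfolding c_def by (intro continuous_intros)
    have "continuous_on UNIV (F w)"
      unfolding F_def using c by (intro continuous_on_compose2[OF * cc]) auto
    moreover have "bounded (range (F w))"
    proof (rule bounded_subset)
      show "bounded ((\<lambda>s. exp (- L * s) * (s - G2 w s)) ` {0..\<theta>})"
        by (intro compact_imp_bounded compact_continuous_image * compact_Icc)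
      show "range (F w) \<subseteq> (\<lambda>s. exp (- L * s) * (s - G2 w s)) ` {0..\<theta>}"
        using c unfolding F_def by blast
    qed
    ultimately show ?thesis by (simp add: bcontfun_def)
  qed
  then have ap: "apply_bcontfun (Bcontfun (F w)) = F w" for w by (rule Bcontfun_inverse)
  have contr: "dist (Bcontfun (F w)) (Bcontfun (F w')) \<le> 1/2 * dist w w'" for w w'
  proof (rule dist_bound, unfold ap)
    fix s
    let ?d = "dist w w'" and ?s = "c s"
    have dG: "\<bar>G w r - G w' r\<bar> \<le> C * ?d * exp (L * r)" if "r \<in> {0..\<theta>}" for r
    proof -
      have "\<bar>G w r - G w' r\<bar> = \<bar>\<kappa> r\<bar> * (exp (L * r) * \<bar>apply_bcontfun w r - apply_bcontfun w' r\<bar>)"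
        unfolding G_def by (simp add: abs_mult right_diff_distrib[symmetric])
      also have "\<dots> \<le> C * (exp (L * r) * ?d)"
        using C that dist_bounded[of w r w'] by (intro mult_mono) (auto simp: dist_real_def)
      finally show ?thesis by (simp add: algebra_simps)
    qed
    have dG1: "\<bar>G1 w r - G1 w' r\<bar> \<le> C * ?d / L * exp (L * r)" if "r \<in> {0..\<theta>}" for r
    proof -
      have "\<bar>integral {0..r} (\<lambda>s. G w s - G w' s)\<bar> \<le> C * ?d / L * exp (L * r)"
        by (rule indefinite_integral_exp_bound[where \<theta>=\<theta>])
           (use C L dG that in \<open>auto intro!: continuous_intros G\<close>)
      then show ?thesis unfolding G1_def
        using that by (subst integral_diff[symmetric])
          (auto intro!: integrable_continuous_real continuous_on_subset[OF G])
    qed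
    have dG2: "\<bar>G2 w r - G2 w' r\<bar> \<le> C * ?d / L / L * exp (L * r)" if "r \<in> {0..\<theta>}" for r
    proof -
      have "\<bar>integral {0..r} (\<lambda>s. G1 w s - G1 w' s)\<bar> \<le> C * ?d / L / L * exp (L * r)"
        by (rule indefinite_integral_exp_bound[where \<theta>=\<theta>])
           (use C L dG1 that in \<open>auto intro!: continuous_intros G1\<close>)
      then show ?thesis unfolding G2_def
        using that by (subst integral_diff[symmetric])
          (auto intro!: integrable_continuous_real continuous_on_subset[OF G1])
    qed
    have "dist (F w s) (F w' s) = exp (- L * ?s) * \<bar>G2 w ?s - G2 w' ?s\<bar>"
      unfolding F_def dist_real_def by (simp add: abs_mult right_diff_distrib[symmetric])
    also have "\<dots> \<le> exp (- L * ?s) * (C * ?d / L / L * exp (L * ?s))"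
      by (intro mult_left_mono dG2 c) auto
    also have "\<dots> = C * ?d / (L * L)" by (simp add: exp_minus)
    also have "\<dots> = 1/2 * ?d" using C by (simp add: L)
    finally show "dist (F w s) (F w' s) \<le> 1/2 * ?d" .
  qed
  obtain w where w: "Bcontfun (F w) = w"
    using banach_fix_type[of "1/2" "\<lambda>w. Bcontfun (F w)"] contr by auto
  define u where "u s = s - G2 w s" for s
  define v where "v s = 1 - G1 w s" for s
  have "F w s = apply_bcontfun w s" for s using ap[of w] w by simp
  then have Gu: "G w s = \<kappa> s * u s" if "s \<in> {0..\<theta>}" for s
    unfolding G_def u_def using that c[of s] unfolding F_def
    by (metis (no_types, lifting) exp_minus_inverse mult.assoc mult.left_neutral mult_minus_left)
  have "jacobi_solution \<kappa> {0..\<theta>} u"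
    unfolding jacobi_solution_def
  proof (intro conjI exI[of _ v] ballI)
    show "u 0 = 0" "v 0 = 1" by (auto simp: u_def v_def G1_def G2_def)
    fix s assume s: "s \<in> {0..\<theta>}"
    show "(u has_real_derivative v s) (at s within {0..\<theta>})"
      unfolding u_def v_def G2_def
      by (rule derivative_eq_intros integral_has_real_derivative G1 s refl)+
    have "(v has_real_derivative - G w s) (at s within {0..\<theta>})"
      unfolding v_def G1_def
      by (rule derivative_eq_intros integral_has_real_derivative G s refl)+ simp
    then show "(v has_real_derivative - (\<kappa> s * u s)) (at s within {0..\<theta>})"
      using Gu[OF s] by simp
  qed
  then show ?thesis by blast
qed

text \<open>Sturm comparison. The Wronskian \<open>W = u' u1 - u u1'\<close> vanishes at \<open>0\<close> and has derivative
  \<open>(\<kappa>1 - \<kappa>) u u1\<close>, so it is nonnegative as long as \<open>u > 0\<close>, and then \<open>u / u1\<close>, whose derivative is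
  \<open>W / u1^2\<close>, increases. In particular \<open>u\<close> cannot reach zero before \<open>u1\<close> does.\<close>

lemma jacobi_sturm_comparison:
  assumes u: "jacobi_solution \<kappa> {0..\<theta>} u" and u1: "jacobi_solution \<kappa>1 {0..\<theta>} u1"
    and le: "\<And>s. s \<in> {0..\<theta>} \<Longrightarrow> \<kappa> s \<le> \<kappa>1 s"
    and pos1: "\<And>s. s \<in> {0<..\<theta>} \<Longrightarrow> 0 < u1 s" and \<theta>: "0 < \<theta>"
  shows "\<And>s. s \<in> {0<..\<theta>} \<Longrightarrow> 0 < u s"
    and "\<And>a b. 0 < a \<Longrightarrow> a \<le> b \<Longrightarrow> b \<le> \<theta> \<Longrightarrow> u a / u1 a \<le> u b / u1 b"
proof -
  obtain v where v: "u 0 = 0" "v 0 = 1"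
    "\<And>s. s \<in> {0..\<theta>} \<Longrightarrow> (u has_real_derivative v s) (at s within {0..\<theta>})"
    "\<And>s. s \<in> {0..\<theta>} \<Longrightarrow> (v has_real_derivative - (\<kappa> s * u s)) (at s within {0..\<theta>})"
    using u unfolding jacobi_solution_def by blast
  obtain v1 where v1: "u1 0 = 0" "v1 0 = 1"
    "\<And>s. s \<in> {0..\<theta>} \<Longrightarrow> (u1 has_real_derivative v1 s) (at s within {0..\<theta>})"
    "\<And>s. s \<in> {0..\<theta>} \<Longrightarrow> (v1 has_real_derivative - (\<kappa>1 s * u1 s)) (at s within {0..\<theta>})"
    using u1 unfolding jacobi_solution_def by blast
  have cont: "continuous_on {0..\<theta>} u" "continuous_on {0..\<theta>} v"
     "continuous_on {0..\<theta>} u1" "continuous_on {0..\<theta>} v1"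
    by (rule DERIV_continuous_on[OF v(3)] DERIV_continuous_on[OF v(4)]
        DERIV_continuous_on[OF v1(3)] DERIV_continuous_on[OF v1(4)], assumption)+
  have at: "at s within {0..\<theta>} = at s" if "0 < s" "s < \<theta>" for s
    using that by (intro at_within_Icc_at)
  define W where "W s = v s * u1 s - u s * v1 s" for s
  have dW: "(W has_real_derivative (\<kappa>1 s - \<kappa> s) * u s * u1 s) (at s)" if "0 < s" "s < \<theta>" for s
    unfolding W_def using v(3,4)[of s] v1(3,4)[of s] at[OF that] that
    by (auto intro!: derivative_eq_intros simp: algebra_simps)
  have W0: "W 0 = 0" by (simp add: W_def v v1)
  have mono: "u a / u1 a \<le> u b / u1 b"
    if ab: "0 < a" "a \<le> b" "b \<le> \<theta>" and p: "\<And>s. 0 < s \<Longrightarrow> s < b \<Longrightarrow> 0 < u s" for a b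
  proof -
    have W: "0 \<le> W s" if "0 \<le> s" "s \<le> b" for s
    proof -
      have "W 0 \<le> W s"
      proof (rule DERIV_nonneg_imp_increasing_open[OF \<open>0 \<le> s\<close>])
        fix x assume x: "0 < x" "x < s"
        have "0 \<le> (\<kappa>1 x - \<kappa> x) * u x * u1 x"
          using x that ab le[of x] p[of x] pos1[of x] by (intro mult_nonneg_nonneg) auto
        then show "\<exists>y. (W has_real_derivative y) (at x) \<and> 0 \<le> y"
          using dW[of x] x that ab by auto
      next
        show "continuous_on {0..s} W" unfolding W_def
          using that ab by (intro continuous_intros) (auto intro!: continuous_on_subset[OF cont(1)] continuous_on_subset[OF cont(2)]
              continuous_on_subset[OF cont(3)] continuous_on_subset[OF cont(4)])
      qed
      then show ?thesis using W0 by simp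
    qed
    show ?thesis
    proof (rule DERIV_nonneg_imp_increasing_open[OF \<open>a \<le> b\<close>])
      fix x assume x: "a < x" "x < b"
      then have x': "0 < x" "x < \<theta>" using ab by auto
      have "((\<lambda>x. u x / u1 x) has_real_derivative W x / (u1 x * u1 x)) (at x)"
        unfolding W_def using v(3)[of x] v1(3)[of x] at[OF x'] x' pos1[of x]
        by (auto intro!: derivative_eq_intros)
      moreover have "0 \<le> W x / (u1 x * u1 x)" using W[of x] x x' by simp
      ultimately show "\<exists>y. ((\<lambda>x. u x / u1 x) has_real_derivative y) (at x) \<and> 0 \<le> y" by blast
    next
      have "u1 x \<noteq> 0" if "x \<in> {a..b}" for x using pos1[of x] ab that by force
      then show "continuous_on {a..b} (\<lambda>x. u x / u1 x)"
        using ab by (intro continuous_intros) (auto intro!: continuous_on_subset[OF cont(1)] continuous_on_subset[OF cont(3)])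
    qed
  qed
  obtain d where d: "d > 0" "\<And>h. h > 0 \<Longrightarrow> h \<in> {0..\<theta>} \<Longrightarrow> h < d \<Longrightarrow> 0 < u h"
    using has_real_derivative_pos_inc_right[OF v(3)[of 0]] v \<theta> by auto
  show pos: "0 < u s" if s: "s \<in> {0<..\<theta>}" for s
  proof (rule ccontr)
    assume neg: "\<not> 0 < u s"
    \<comment> \<open>The first zero of \<open>u\<close>; cutting at \<open>d/2\<close> removes the zero at \<open>0\<close>.\<close>
    define Z where "Z = {d/2..\<theta>} \<inter> u -` {..0}"
    have sd: "d \<le> s" using d(2)[of s] s neg by force
    have "continuous_on {d/2..\<theta>} u" using d(1) by (intro continuous_on_subset[OF cont(1)]) auto
    then have "closed Z" unfolding Z_def by (rule continuous_closed_preimage) auto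
    then have "compact Z" unfolding Z_def
      by (metis Int_absorb1 Int_lower1 compact_Icc compact_Int_closed)
    moreover have "s \<in> Z" using s neg sd d(1) unfolding Z_def by auto
    then have "Z \<noteq> {}" by blast
    ultimately obtain z where z: "z \<in> Z" "\<And>y. y \<in> Z \<Longrightarrow> z \<le> y"
      using compact_attains_inf by metis
    have p: "0 < u x" if "0 < x" "x < z" for x
    proof (cases "x < d")
      case True then show ?thesis using d(2)[of x] that z(1) by (auto simp: Z_def)
    next
      case False
      then show ?thesis using z(2)[of x] that z(1) d(1) unfolding Z_def by force
    qed
    have z': "0 < z" "z \<le> \<theta>" "u z \<le> 0" using z(1) d(1) by (auto simp: Z_def)
    have "0 < u (z/2) / u1 (z/2)" using p[of "z/2"] pos1[of "z/2"] z' by auto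
    also have "\<dots> \<le> u z / u1 z" using z' p by (intro mono) auto
    also have "\<dots> \<le> 0" using z' pos1[of z] by (simp add: divide_nonpos_pos)
    finally show False by simp
  qed
  show "u a / u1 a \<le> u b / u1 b" if "0 < a" "a \<le> b" "b \<le> \<theta>" for a b
    using that pos by (intro mono) auto
qed

lemma sigma_cont_ge:
  assumes \<kappa>: "continuous_on {0..\<theta>} \<kappa>1" and \<theta>: "0 < \<theta>"
    and u: "jacobi_solution \<kappa> {0..\<theta>} u"
    and le: "\<And>s. s \<in> {0..\<theta>} \<Longrightarrow> \<kappa> s \<le> \<kappa>1 s" and t: "0 < t" "t \<le> 1"
  shows "ennreal (u (t * \<theta>) / u \<theta>) \<le> sigma_cont \<kappa>1 t \<theta>"
proof (cases "\<forall>s\<in>{0<..\<theta>}. 0 < s_gen \<kappa>1 \<theta> s")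
  case True
  let ?u1 = "s_gen \<kappa>1 \<theta>"
  have u1: "jacobi_solution \<kappa>1 {0..\<theta>} ?u1"
    unfolding s_gen_def using someI_ex[OF jacobi_solution_exists[OF \<kappa> \<theta>]] .
  have t\<theta>: "0 < t * \<theta>" "t * \<theta> \<le> \<theta>" using t \<theta> by (auto simp: mult_le_cancel_right1)
  have p: "0 < ?u1 s" if "s \<in> {0<..\<theta>}" for s using True that by blast
  have "u (t * \<theta>) / ?u1 (t * \<theta>) \<le> u \<theta> / ?u1 \<theta>"
    using jacobi_sturm_comparison(2)[OF u u1 le p \<theta>] t\<theta> by auto
  moreover have "0 < u \<theta>" "0 < ?u1 \<theta>" "0 < ?u1 (t * \<theta>)"
    using jacobi_sturm_comparison(1)[OF u u1 le p \<theta>] p t\<theta> \<theta> by auto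
  ultimately have "u (t * \<theta>) / u \<theta> \<le> ?u1 (t * \<theta>) / ?u1 \<theta>"
    by (simp add: field_simps)
  then show ?thesis using True by (simp add: sigma_cont_def ennreal_leI)
next
  case False
  then show ?thesis unfolding sigma_cont_def if_not_P[OF False] by simp
qed

lemma lip_approx_props:
  assumes K: "\<And>s. s \<in> {0..\<theta>} \<Longrightarrow> K \<le> \<kappa> s" and \<theta>: "0 \<le> \<theta>"
  shows "K \<le> lip_approx \<kappa> \<theta> n s"
    and "lip_approx \<kappa> \<theta> n s \<le> lip_approx \<kappa> \<theta> (Suc n) s"
    and "continuous_on A (lip_approx \<kappa> \<theta> n)"
proof -
  have ne: "{0..\<theta>} \<noteq> {}" using \<theta> by auto
  have K': "K \<le> \<kappa> r + real n * \<bar>s - r\<bar>" if "r \<in> {0..\<theta>}" for n s r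
    using K[OF that] by (simp add: add_increasing2)
  have bdd: "bdd_below ((\<lambda>r. \<kappa> r + real n * \<bar>s - r\<bar>) ` {0..\<theta>})" for n s
    using K' by (intro bdd_belowI2[where m=K]) blast
  show "K \<le> lip_approx \<kappa> \<theta> n s"
    unfolding lip_approx_def using K' by (intro cINF_greatest ne) blast
  show "lip_approx \<kappa> \<theta> n s \<le> lip_approx \<kappa> \<theta> (Suc n) s"
    unfolding lip_approx_def
    by (intro cINF_mono ne bdd bexI[of _ x for x]) (auto simp: algebra_simps)
  have lip: "lip_approx \<kappa> \<theta> n s \<le> lip_approx \<kappa> \<theta> n s' + real n * \<bar>s - s'\<bar>" for s s'
  proof -
    have "lip_approx \<kappa> \<theta> n s - real n * \<bar>s - s'\<bar> \<le> \<kappa> r + real n * \<bar>s' - r\<bar>" if r: "r \<in> {0..\<theta>}" for r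
    proof -
      have "lip_approx \<kappa> \<theta> n s \<le> \<kappa> r + real n * \<bar>s - r\<bar>"
        unfolding lip_approx_def by (intro cINF_lower bdd r)
      also have "\<dots> \<le> \<kappa> r + real n * (\<bar>s' - r\<bar> + \<bar>s - s'\<bar>)"
        by (intro add_left_mono mult_left_mono) auto
      finally show ?thesis by (simp add: algebra_simps)
    qed
    then have "lip_approx \<kappa> \<theta> n s - real n * \<bar>s - s'\<bar> \<le> lip_approx \<kappa> \<theta> n s'"
      unfolding lip_approx_def[of _ _ _ s'] by (intro cINF_greatest ne)
    then show ?thesis by simp
  qed
  have "(real n)-lipschitz_on A (lip_approx \<kappa> \<theta> n)"
  proof (rule lipschitz_onI)
    fix x y show "dist (lip_approx \<kappa> \<theta> n x) (lip_approx \<kappa> \<theta> n y) \<le> real n * dist x y"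
      using lip[of x y] lip[of y x] by (auto simp: dist_real_def abs_minus_commute abs_le_iff)
  qed simp
  then show "continuous_on A (lip_approx \<kappa> \<theta> n)" by (rule lipschitz_on_continuous_on)
qed

text \<open>The approximations increase with \<open>n\<close>, hence so do their coefficients by Sturm comparison. This is
  why the limit in the definition of \<open>sigma\<close> exists, and why any member of the sequence is a lower
  bound for it.\<close>

lemma sigma_ge:
  assumes \<theta>: "0 < \<theta>" and K: "\<And>s. s \<in> {0..\<theta>} \<Longrightarrow> K \<le> \<kappa> s"
    and u: "jacobi_solution (\<lambda>_. K) {0..\<theta>} u" and t: "0 < t" "t \<le> 1"
  shows "ennreal (u (t * \<theta>) / u \<theta>) \<le> sigma \<kappa> t \<theta>"
proof -
  let ?X = "\<lambda>n. sigma_cont (lip_approx \<kappa> \<theta> n) t \<theta>"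
  have \<theta>': "0 \<le> \<theta>" using \<theta> by simp
  note lp = lip_approx_props[OF K \<theta>']
  have sol: "jacobi_solution (lip_approx \<kappa> \<theta> n) {0..\<theta>} (s_gen (lip_approx \<kappa> \<theta> n) \<theta>)" for n
    unfolding s_gen_def using someI_ex[OF jacobi_solution_exists[OF lp(3) \<theta>]] .
  have "?X n \<le> ?X (Suc n)" for n
  proof (cases "\<forall>s\<in>{0<..\<theta>}. 0 < s_gen (lip_approx \<kappa> \<theta> (Suc n)) \<theta> s")
    case True
    then have p: "0 < s_gen (lip_approx \<kappa> \<theta> (Suc n)) \<theta> s" if "s \<in> {0<..\<theta>}" for s using that by blast
    have "\<forall>s\<in>{0<..\<theta>}. 0 < s_gen (lip_approx \<kappa> \<theta> n) \<theta> s"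
      using jacobi_sturm_comparison(1)[OF sol[of n] sol[of "Suc n"] lp(2) p \<theta>] by blast
    then have "?X n = ennreal (s_gen (lip_approx \<kappa> \<theta> n) \<theta> (t * \<theta>) / s_gen (lip_approx \<kappa> \<theta> n) \<theta> \<theta>)"
      by (simp add: sigma_cont_def)
    also have "\<dots> \<le> ?X (Suc n)"
      by (rule sigma_cont_ge[OF lp(3) \<theta> sol lp(2) t])
    finally show ?thesis .
  qed (auto simp: sigma_cont_def)
  then have "?X \<longlonglongrightarrow> (SUP n. ?X n)" by (intro LIMSEQ_SUP incseq_SucI)
  then have "sigma \<kappa> t \<theta> = (SUP n. ?X n)"
    using \<theta> by (simp add: sigma_def limI)
  moreover have "ennreal (u (t * \<theta>) / u \<theta>) \<le> ?X 0"
    by (rule sigma_cont_ge[OF lp(3) \<theta> u lp(1) t])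
  ultimately show ?thesis by (metis SUP_upper2 UNIV_I)
qed

text \<open>The closed forms of \<open>sin_K\<close> and of its derivative.\<close>

definition sn :: "real \<Rightarrow> real \<Rightarrow> real" where
  "sn K s = (if K > 0 then sin (sqrt K * s) / sqrt K
             else if K < 0 then sinh (sqrt (- K) * s) / sqrt (- K) else s)"

definition cs :: "real \<Rightarrow> real \<Rightarrow> real" where
  "cs K s = (if K > 0 then cos (sqrt K * s) else if K < 0 then cosh (sqrt (- K) * s) else 1)"

lemma sn_0 [simp]: "sn K 0 = 0" and cs_0 [simp]: "cs K 0 = 1"
  by (auto simp: sn_def cs_def)

lemma DERIV_sn: "(sn K has_real_derivative cs K s) (at s within A)"
proof -
  have *: "x * sqrt a * sqrt a = x * a" if "a > 0" for a x :: real
    using that by (simp add: mult.assoc)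
  show ?thesis
    unfolding sn_def[abs_def] cs_def
    by (cases K "0::real" rule: linorder_cases) (auto intro!: derivative_eq_intros simp: *)
qed

lemma DERIV_cs: "(cs K has_real_derivative - (K * sn K s)) (at s within A)"
proof -
  have *: "a * (b / sqrt a) = sqrt a * b" if "a > 0" for a b :: real
    using that by (metis mult.commute real_div_sqrt less_imp_le times_divide_eq_left times_divide_eq_right)
  show ?thesis
    unfolding sn_def cs_def[abs_def]
    using *[of K] *[of "- K"]
    by (cases K "0::real" rule: linorder_cases) (auto intro!: derivative_eq_intros)
qed

lemma cs_sn_sq: "(cs K s)\<^sup>2 + K * (sn K s)\<^sup>2 = 1"
  unfolding sn_def cs_def
  by (cases K "0::real" rule: linorder_cases)
     (auto simp: power_divide cosh_square_eq)

lemma jacobi_solution_sn: "jacobi_solution (\<lambda>_. K) A (sn K)"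
  unfolding jacobi_solution_def by (intro conjI exI[of _ "cs K"] ballI DERIV_sn DERIV_cs) auto

text \<open>Uniqueness: for a solution \<open>u\<close> with derivative \<open>v\<close>, the expressions \<open>v cs + K u sn\<close> and
  \<open>u cs - v sn\<close> are constant, and \<open>cs^2 + K sn^2 = 1\<close> allows to solve for \<open>u\<close>.\<close>

lemma sin_curv_eq_sn: "sin_curv K = sn K"
  unfolding sin_curv_def
proof (rule the_equality)
  show "jacobi_solution (\<lambda>_. K) UNIV (sn K)" by (rule jacobi_solution_sn)
  fix u assume "jacobi_solution (\<lambda>_. K) UNIV u"
  then obtain v where v: "u 0 = 0" "v 0 = 1"
    "\<And>s. (u has_real_derivative v s) (at s)" "\<And>s. (v has_real_derivative - (K * u s)) (at s)"
    unfolding jacobi_solution_def by auto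
  have "v s * cs K s + K * u s * sn K s = v 0 * cs K 0 + K * u 0 * sn K 0" for s
    by (rule DERIV_isconst_all[of "\<lambda>s. v s * cs K s + K * u s * sn K s"], rule allI)
       (auto intro!: derivative_eq_intros v(3,4) DERIV_sn DERIV_cs simp: algebra_simps)
  then have 1: "v s * cs K s + K * u s * sn K s = 1" for s using v by simp
  have "u s * cs K s - v s * sn K s = u 0 * cs K 0 - v 0 * sn K 0" for s
    by (rule DERIV_isconst_all[of "\<lambda>s. u s * cs K s - v s * sn K s"], rule allI)
       (auto intro!: derivative_eq_intros v(3,4) DERIV_sn DERIV_cs simp: algebra_simps)
  then have 2: "u s * cs K s - v s * sn K s = 0" for s using v by simp
  have "u s = sn K s" for s
  proof -
    have "u s = u s * ((cs K s)\<^sup>2 + K * (sn K s)\<^sup>2)" by (simp add: cs_sn_sq)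
    also have "\<dots> = cs K s * (u s * cs K s - v s * sn K s) + sn K s * (v s * cs K s + K * u s * sn K s)"
      by (simp add: algebra_simps power2_eq_square)
    finally show ?thesis by (simp add: 1 2)
  qed
  then show "u = sn K" by blast
qed

lemma continuous_on_sn: "continuous_on A (sn K)"
  by (rule DERIV_continuous_on[OF DERIV_sn])

lemma sn_pos:
  assumes "0 < s" "K > 0 \<Longrightarrow> s < pi / sqrt K"
  shows "0 < sn K s"
  using assms unfolding sn_def
  by (auto intro!: sin_gt_zero divide_pos_pos mult_pos_pos simp: field_simps)

lemma ennpowr_mono: "x \<le> y \<Longrightarrow> 0 < a \<Longrightarrow> ennpowr x a \<le> ennpowr y a"
  unfolding ennpowr_def
  by (auto simp: top_unique less_top intro!: ennreal_leI powr_mono2 enn2real_mono)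

lemma ennpowr_ennreal: "0 < x \<Longrightarrow> ennpowr (ennreal x) a = ennreal (x powr a)"
  unfolding ennpowr_def by (auto simp: ennreal_eq_0_iff)

text \<open>The quantity inside the power \<open>1 / N\<close> is \<open>t\<close> times a quotient of values of the comparison function
  \<open>sin_K powr (N - 1)\<close>; this is the form in which \<open>\<tau>\<close> enters the annulus inequality.\<close>

lemma tau_ge:
  assumes N: "1 < N" and t: "0 < t" "t \<le> 1" and \<theta>: "0 < \<theta>"
    and K: "\<And>s. s \<in> {0..\<theta>} \<Longrightarrow> K * (N - 1) \<le> \<kappa> s"
    and p: "0 < sn K (t * \<theta>)" "0 < sn K \<theta>"
  shows "ennreal ((t * (sn K (t * \<theta>) powr (N - 1) / sn K \<theta> powr (N - 1))) powr (1 / N)) \<le> tau N \<kappa> t \<theta>"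
proof -
  have K': "K \<le> \<kappa> s / (N - 1)" if "s \<in> {0..\<theta>}" for s using K[OF that] N by (simp add: field_simps)
  let ?q = "sn K (t * \<theta>) / sn K \<theta>"
  have q: "0 < ?q" using p by simp
  have "ennreal ?q \<le> sigma (\<lambda>s. \<kappa> s / (N - 1)) t \<theta>"
    by (rule sigma_ge[OF \<theta> K' jacobi_solution_sn t])
  then have "ennpowr (ennreal ?q) ((N - 1) / N) \<le> ennpowr (sigma (\<lambda>s. \<kappa> s / (N - 1)) t \<theta>) ((N - 1) / N)"
    using N by (intro ennpowr_mono) auto
  then have "ennreal (t powr (1/N)) * ennreal (?q powr ((N - 1) / N)) \<le> tau N \<kappa> t \<theta>"
    using N t q by (auto simp: tau_def ennpowr_ennreal intro!: mult_left_mono)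
  also have "ennreal (t powr (1/N)) * ennreal (?q powr ((N - 1) / N)) = ennreal ((t * ?q powr (N - 1)) powr (1 / N))"
    using t q N p by (simp add: ennreal_mult[symmetric] powr_mult powr_powr)
  finally show ?thesis using p by (simp add: powr_divide)
qed

section \<open>Couplings and intermediate measures\<close>

text \<open>A countable Borel partition into cells of diameter less than \<open>\<delta>\<close>, given by the index of the cell of
  each point.\<close>

lemma countable_partition_small:
  fixes \<delta> :: real
  assumes "0 < \<delta>"
  obtains i :: "'a::polish_space \<Rightarrow> nat"
  where "i \<in> borel \<rightarrow>\<^sub>M count_space UNIV" "\<And>x y. i x = i y \<Longrightarrow> dist x y < \<delta>"
proof -
  obtain D :: "'a set" where D: "countable D" "\<And>X. open X \<Longrightarrow> X \<noteq> {} \<Longrightarrow> \<exists>d\<in>D. d \<in> X"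
    using countable_dense_setE by blast
  define d where "d = from_nat_into D"
  have "D \<noteq> {}" using D(2)[of UNIV] by auto
  then have d: "\<exists>n. dist x (d n) < \<delta>/2" for x
    using D(2)[of "ball x (\<delta>/2)"] assms D(1) from_nat_into_surj[of D] by (force simp: d_def)
  define i where "i x = (LEAST n. dist x (d n) < \<delta>/2)" for x
  have "i \<in> borel \<rightarrow>\<^sub>M count_space UNIV"
    unfolding i_def by measurable
  moreover have "dist x y < \<delta>" if "i x = i y" for x y
  proof -
    have "dist x (d (i x)) < \<delta>/2" "dist y (d (i x)) < \<delta>/2"
      unfolding that unfolding that[symmetric] using LeastI_ex[OF d[of x]] LeastI_ex[OF d[of y]] that
      by (auto simp: i_def)
    then show ?thesis using dist_triangle_half_l by blast
  qed
  ultimately show ?thesis using that by blast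
qed

lemma coupling_prob:
  assumes "q \<in> couplings \<mu> \<nu>" "prob_space \<mu>" "sets \<mu> = sets borel"
  shows "prob_space q"
proof -
  have q: "sets q = sets borel" "distr q borel fst = \<mu>" using assms by (auto simp: couplings_def)
  have m: "fst \<in> q \<rightarrow>\<^sub>M (borel :: 'a measure)"
    using q(1) by (simp add: measurable_cong_sets[of q borel] borel_measurable_continuous_onI continuous_on_fst)
  show ?thesis
    using prob_space_distrD[OF m] assms(2) q(2) by simp
qed

lemma measurable_coupling:
  assumes "sets q = sets borel" "f \<in> borel \<rightarrow>\<^sub>M N"
  shows "f \<in> q \<rightarrow>\<^sub>M N"
  using assms by (simp add: measurable_cong_sets[of q borel])

text \<open>Approximate gluing. Both couplings keep their joint laws exactly, but the two copies of the middle
  point agree only up to \<open>\<delta>\<close>. Conditioning on the countably many cells of a fine partition instead of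
  on the middle point itself replaces the disintegration of measures by an explicit density with
  respect to the product.\<close>

lemma glue_couplings:
  fixes \<mu> \<nu> \<rho> :: "'a::polish_space measure"
  assumes q1: "q1 \<in> couplings \<mu> \<nu>" and q2: "q2 \<in> couplings \<nu> \<rho>"
    and p: "prob_space \<mu>" "sets \<mu> = sets borel" "prob_space \<nu>" "sets \<nu> = sets borel" and \<delta>: "0 < \<delta>"
  obtains Q :: "(('a \<times> 'a) \<times> ('a \<times> 'a)) measure"
  where "sets Q = sets borel" "distr Q borel fst = q1" "distr Q borel snd = q2"
    "AE z in Q. dist (snd (fst z)) (fst (snd z)) < \<delta>"
proof -
  obtain i :: "'a \<Rightarrow> nat" where i[measurable]: "i \<in> borel \<rightarrow>\<^sub>M count_space UNIV"
    and idist: "\<And>x y. i x = i y \<Longrightarrow> dist x y < \<delta>"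
    using countable_partition_small[OF \<delta>] by metis
  interpret q1: prob_space q1 using coupling_prob[OF q1 p(1,2)] .
  interpret q2: prob_space q2 using coupling_prob[OF q2 p(3,4)] .
  interpret pair_prob_space q1 q2 ..
  interpret \<nu>: prob_space \<nu> by fact
  have s[measurable_cong]: "sets q1 = sets (borel \<Otimes>\<^sub>M borel)" "sets q2 = sets (borel \<Otimes>\<^sub>M borel)" "sets \<nu> = sets borel"
    and d: "distr q1 borel snd = \<nu>" "distr q2 borel fst = \<nu>"
    using q1 q2 p unfolding couplings_def borel_prod by auto
  define m where "m n = emeasure \<nu> {y. i y = n}" for n
  \<comment> \<open>Given the cell of the middle point, the two outer points are independent.\<close>
  define w where "w z = (if i (snd (fst z)) = i (fst (snd z)) then 1 / m (i (snd (fst z))) else 0)"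
    for z :: "('a \<times> 'a) \<times> ('a \<times> 'a)"
  have m_meas[measurable]: "{y. i y = n} \<in> sets borel" for n
    by measurable
  have [measurable]: "m \<in> count_space UNIV \<rightarrow>\<^sub>M borel" by simp
  have w[measurable]: "w \<in> borel_measurable (q1 \<Otimes>\<^sub>M q2)"
  proof -
    have "w = (\<lambda>z. if \<exists>n. i (snd (fst z)) = n \<and> i (fst (snd z)) = n then 1 / m (i (snd (fst z))) else 0)"
      unfolding w_def by auto
    also have "\<dots> \<in> borel_measurable (q1 \<Otimes>\<^sub>M q2)" by measurable
    finally show ?thesis .
  qed
  have m1: "emeasure q1 {x \<in> space q1. i (snd x) = n} = m n" for n
    unfolding m_def d(1)[symmetric] by (subst emeasure_distr) (auto intro!: arg_cong2[where f=emeasure])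
  have m2: "emeasure q2 {x \<in> space q2. i (fst x) = n} = m n" for n
    unfolding m_def d(2)[symmetric] by (subst emeasure_distr) (auto intro!: arg_cong2[where f=emeasure])
  have mfin: "m n < \<infinity>" for n
    unfolding m_def by (simp add: \<nu>.emeasure_finite less_top[symmetric])
  have mpos: "AE y in \<nu>. m (i y) \<noteq> 0"
  proof -
    have "AE y in \<nu>. \<forall>n. m n = 0 \<longrightarrow> i y \<noteq> n"
    proof (intro AE_all_countable[THEN iffD2] allI)
      fix n show "AE y in \<nu>. m n = 0 \<longrightarrow> i y \<noteq> n"
      proof (cases "m n = 0")
        case True
        then have "{y. i y = n} \<in> null_sets \<nu>" using m_meas[of n] s(3) by (auto simp: m_def)
        then show ?thesis using AE_not_in by fastforce
      qed simp
    qed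
    then show ?thesis by eventually_elim auto
  qed
  have ae1: "AE x in q1. m (i (snd x)) \<noteq> 0"
    using mpos unfolding d(1)[symmetric] by (subst (asm) AE_distr_iff) auto
  have ae2: "AE x in q2. m (i (fst x)) \<noteq> 0"
    using mpos unfolding d(2)[symmetric] by (subst (asm) AE_distr_iff) auto
  have mm: "1 / m n * m n = 1" if "m n \<noteq> 0" for n
    using that mfin[of n] by (simp add: ennreal_divide_times ennreal_divide_self)
  have cell: "(\<integral>\<^sup>+ y. (if i (p y) = n then 1 / m n else 0) * a \<partial>q) = a"
    if "m n \<noteq> 0" "emeasure q {y \<in> space q. i (p y) = n} = m n" "{y \<in> space q. i (p y) = n} \<in> sets q"
    for q :: "('a \<times> 'a) measure" and p n a
  proof -
    have "(\<integral>\<^sup>+ y. (if i (p y) = n then 1 / m n else 0) * a \<partial>q)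
        = (\<integral>\<^sup>+ y. (1 / m n * a) * indicator {y \<in> space q. i (p y) = n} y \<partial>q)"
      by (intro nn_integral_cong) (auto split: split_indicator)
    also have "\<dots> = (1 / m n * m n) * a"
      using that by (subst nn_integral_cmult_indicator) (auto simp: mult_ac)
    finally show ?thesis using mm[OF that(1)] by simp
  qed
  define Q where "Q = density (q1 \<Otimes>\<^sub>M q2) w"
  have sQ: "sets Q = sets borel"
    unfolding Q_def by (simp add: borel_prod[symmetric] sets_pair_measure_cong[OF s(1,2)])
  have sQ': "sets Q = sets (q1 \<Otimes>\<^sub>M q2)" by (simp add: Q_def)
  have f: "fst \<in> Q \<rightarrow>\<^sub>M borel" "snd \<in> Q \<rightarrow>\<^sub>M borel"
    by (auto intro!: measurable_coupling[OF sQ] borel_measurable_continuous_onI continuous_intros)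
  have 1: "distr Q borel fst = q1"
  proof (rule measure_eqI)
    show "sets (distr Q borel fst) = sets q1" using s unfolding borel_prod by simp
    fix A assume "A \<in> sets (distr Q borel fst)"
    then have A: "A \<in> sets borel" and A'[measurable]: "A \<in> sets q1" using s unfolding borel_prod by auto
    have "emeasure (distr Q borel fst) A = emeasure Q (fst -` A \<inter> space Q)"
      by (rule emeasure_distr[OF f(1) A])
    also have "\<dots> = (\<integral>\<^sup>+ z. w z * indicator (fst -` A \<inter> space Q) z \<partial>(q1 \<Otimes>\<^sub>M q2))"
      unfolding Q_def using measurable_sets[OF f(1) A]
      by (intro emeasure_density) (simp_all add: Q_def)
    also have "\<dots> = (\<integral>\<^sup>+ z. w z * indicator A (fst z) \<partial>(q1 \<Otimes>\<^sub>M q2))"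
      by (intro nn_integral_cong) (auto simp: Q_def split: split_indicator)
    also have "\<dots> = (\<integral>\<^sup>+ x. \<integral>\<^sup>+ y. w (x, y) * indicator A (fst (x, y)) \<partial>q2 \<partial>q1)"
      by (rule q2.nn_integral_fst[symmetric]) measurable
    also have "\<dots> = (\<integral>\<^sup>+ x. indicator A x \<partial>q1)"
    proof (rule nn_integral_cong_AE, use ae1 in eventually_elim)
      fix x :: "'a \<times> 'a" assume x: "m (i (snd x)) \<noteq> 0"
      show "(\<integral>\<^sup>+ y. w (x, y) * indicator A (fst (x, y)) \<partial>q2) = indicator A x"
        using cell[OF x m2, of "indicator A x"] by (simp add: w_def eq_commute[of "i (snd x)"] cong: if_cong)
    qed
    finally show "emeasure (distr Q borel fst) A = emeasure q1 A" by simp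
  qed
  have 2: "distr Q borel snd = q2"
  proof (rule measure_eqI)
    show "sets (distr Q borel snd) = sets q2" using s unfolding borel_prod by simp
    fix A assume "A \<in> sets (distr Q borel snd)"
    then have A: "A \<in> sets borel" and A'[measurable]: "A \<in> sets q2" using s unfolding borel_prod by auto
    have "emeasure (distr Q borel snd) A = emeasure Q (snd -` A \<inter> space Q)"
      by (rule emeasure_distr[OF f(2) A])
    also have "\<dots> = (\<integral>\<^sup>+ z. w z * indicator (snd -` A \<inter> space Q) z \<partial>(q1 \<Otimes>\<^sub>M q2))"
      unfolding Q_def using measurable_sets[OF f(2) A]
      by (intro emeasure_density) (simp_all add: Q_def)
    also have "\<dots> = (\<integral>\<^sup>+ z. w z * indicator A (snd z) \<partial>(q1 \<Otimes>\<^sub>M q2))"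
      by (intro nn_integral_cong) (auto simp: Q_def split: split_indicator)
    also have "\<dots> = (\<integral>\<^sup>+ y. \<integral>\<^sup>+ x. w (x, y) * indicator A (snd (x, y)) \<partial>q1 \<partial>q2)"
      by (rule nn_integral_snd[symmetric, unfolded case_prod_beta']) measurable
    also have "\<dots> = (\<integral>\<^sup>+ y. indicator A y \<partial>q2)"
    proof (rule nn_integral_cong_AE, use ae2 in eventually_elim)
      fix y :: "'a \<times> 'a" assume y: "m (i (fst y)) \<noteq> 0"
      show "(\<integral>\<^sup>+ x. w (x, y) * indicator A (snd (x, y)) \<partial>q1) = indicator A y"
        using cell[OF y m1, of "indicator A y"] by (simp add: w_def cong: if_cong)
    qed
    finally show "emeasure (distr Q borel snd) A = emeasure q2 A" by simp
  qed
  have 3: "AE z in Q. dist (snd (fst z)) (fst (snd z)) < \<delta>"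
    unfolding Q_def by (subst AE_density) (auto simp: w_def idist)
  show ?thesis by (rule that[OF sQ 1 2 3])
qed

lemma measurable_dist_sq:
  "(\<lambda>x. ennreal ((dist x\<^sub>0 x)\<^sup>2)) \<in> borel_measurable (borel :: 'a::polish_space measure)"
  "(\<lambda>z. ennreal ((dist (fst z) (snd z))\<^sup>2)) \<in> borel_measurable (borel :: ('a \<times> 'a) measure)"
  by (rule measurable_compose[OF borel_measurable_continuous_onI measurable_ennreal], intro continuous_intros)+

text \<open>The infimum of the costs is finite because the product coupling has finite cost, so nothing is lost
  in the conversion to a real number.\<close>

lemma W2_sq:
  fixes \<mu> \<nu> :: "'a::polish_space measure"
  assumes \<mu>: "\<mu> \<in> P2" and \<nu>: "\<nu> \<in> P2"
  shows "ennreal ((W2 \<mu> \<nu>)\<^sup>2) = (INF q\<in>couplings \<mu> \<nu>. transport_cost q)"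
proof -
  interpret \<mu>: prob_space \<mu> using \<mu> by (auto simp: P2_def)
  interpret \<nu>: prob_space \<nu> using \<nu> by (auto simp: P2_def)
  interpret pair_prob_space \<mu> \<nu> ..
  have s[measurable_cong]: "sets \<mu> = sets borel" "sets \<nu> = sets borel" using \<mu> \<nu> by (auto simp: P2_def)
  obtain a b where a: "(\<integral>\<^sup>+ x. ennreal ((dist a x)\<^sup>2) \<partial>\<mu>) < \<infinity>" and b: "(\<integral>\<^sup>+ x. ennreal ((dist b x)\<^sup>2) \<partial>\<nu>) < \<infinity>"
    using \<mu> \<nu> by (auto simp: P2_def)
  let ?q = "\<mu> \<Otimes>\<^sub>M \<nu>"
  have sq: "sets ?q = sets borel" by (simp add: borel_prod[symmetric] sets_pair_measure_cong[OF s])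
  have q1: "distr ?q borel fst = \<mu>"
    using \<nu>.distr_pair_fst[of \<mu>] s(1) by (simp cong: distr_cong)
  have q2: "distr ?q borel snd = \<nu>"
  proof (rule measure_eqI)
    show "sets (distr ?q borel snd) = sets \<nu>" by (simp add: s)
    fix A assume "A \<in> sets (distr ?q borel snd)"
    then have A[measurable]: "A \<in> sets borel" "A \<in> sets \<nu>" by (auto simp: s)
    have "emeasure (distr ?q borel snd) A = emeasure ?q (space \<mu> \<times> A)"
      by (subst emeasure_distr) (auto simp: space_pair_measure sets_eq_imp_space_eq[OF s(2)] intro!: arg_cong2[where f=emeasure])
    then show "emeasure (distr ?q borel snd) A = emeasure \<nu> A"
      by (simp add: \<nu>.emeasure_pair_measure_Times \<mu>.emeasure_space_1)
  qed
  have "?q \<in> couplings \<mu> \<nu>" using sq q1 q2 by (auto simp: couplings_def)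
  have pt: "ennreal ((dist x y)\<^sup>2) \<le> ennreal 3 * ennreal ((dist a x)\<^sup>2) + ennreal 3 * ennreal ((dist a b)\<^sup>2) + ennreal 3 * ennreal ((dist b y)\<^sup>2)" for x y
  proof -
    have "dist x y \<le> dist a x + dist a b + dist b y"
      by (metis (no_types, opaque_lifting) add.commute add_le_cancel_right dist_commute dist_triangle order_trans)
    then have "(dist x y)\<^sup>2 \<le> (dist a x + dist a b + dist b y)\<^sup>2"
      by (intro power_mono) auto
    also have "\<dots> \<le> 3 * (dist a x)\<^sup>2 + 3 * (dist a b)\<^sup>2 + 3 * (dist b y)\<^sup>2"
      using zero_le_power2[of "dist a x - dist a b"] zero_le_power2[of "dist a x - dist b y"] zero_le_power2[of "dist a b - dist b y"]
      by (simp add: power2_eq_square algebra_simps)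
    finally have "ennreal ((dist x y)\<^sup>2) \<le> ennreal (3 * (dist a x)\<^sup>2 + 3 * (dist a b)\<^sup>2 + 3 * (dist b y)\<^sup>2)"
      by (rule ennreal_leI)
    also have "\<dots> = ennreal 3 * ennreal ((dist a x)\<^sup>2) + ennreal 3 * ennreal ((dist a b)\<^sup>2) + ennreal 3 * ennreal ((dist b y)\<^sup>2)"
      by (simp add: ennreal_mult)
    finally show ?thesis .
  qed
  have "transport_cost ?q = (\<integral>\<^sup>+ x. \<integral>\<^sup>+ y. ennreal ((dist (fst (x, y)) (snd (x, y)))\<^sup>2) \<partial>\<nu> \<partial>\<mu>)"
    unfolding transport_cost_def
    by (rule \<nu>.nn_integral_fst[symmetric], rule measurable_coupling[OF sq measurable_dist_sq(2)])
  also have "\<dots> \<le> (\<integral>\<^sup>+ x. \<integral>\<^sup>+ y. ennreal 3 * ennreal ((dist a x)\<^sup>2) + ennreal 3 * ennreal ((dist a b)\<^sup>2) + ennreal 3 * ennreal ((dist b y)\<^sup>2) \<partial>\<nu> \<partial>\<mu>)"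
    using pt by (intro nn_integral_mono) auto
  also have "\<dots> = ennreal 3 * (\<integral>\<^sup>+ x. ennreal ((dist a x)\<^sup>2) \<partial>\<mu>) + ennreal 3 * ennreal ((dist a b)\<^sup>2) + ennreal 3 * (\<integral>\<^sup>+ y. ennreal ((dist b y)\<^sup>2) \<partial>\<nu>)"
    using measurable_coupling[OF s(1) measurable_dist_sq(1)] measurable_coupling[OF s(2) measurable_dist_sq(1)]
    by (simp add: nn_integral_add nn_integral_cmult \<mu>.emeasure_space_1 \<nu>.emeasure_space_1)
  also have "\<dots> < \<infinity>" using a b by (simp add: ennreal_mult_less_top)
  finally have "(INF q\<in>couplings \<mu> \<nu>. transport_cost q) < \<infinity>"
    using \<open>?q \<in> couplings \<mu> \<nu>\<close> by (meson INF_lower le_less_trans)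
  then show ?thesis by (simp add: W2_def)
qed

lemma W2_le_cost:
  fixes \<mu> \<nu> :: "'a::polish_space measure"
  assumes "\<mu> \<in> P2" "\<nu> \<in> P2" "q \<in> couplings \<mu> \<nu>"
  shows "ennreal ((W2 \<mu> \<nu>)\<^sup>2) \<le> transport_cost q"
  using W2_sq[OF assms(1,2)] assms(3) by (simp add: INF_lower)

lemma almost_optimal_coupling:
  fixes \<mu> \<nu> :: "'a::polish_space measure"
  assumes "\<mu> \<in> P2" "\<nu> \<in> P2" "0 < \<eta>"
  obtains q where "q \<in> couplings \<mu> \<nu>" "transport_cost q \<le> ennreal ((W2 \<mu> \<nu>)\<^sup>2 + \<eta>)"
proof -
  have "(INF q\<in>couplings \<mu> \<nu>. transport_cost q) < ennreal ((W2 \<mu> \<nu>)\<^sup>2 + \<eta>)"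
    unfolding W2_sq[OF assms(1,2), symmetric] using assms(3) by (simp add: ennreal_lessI)
  then show ?thesis using that by (auto simp: INF_less_iff less_imp_le)
qed

text \<open>For \<open>\<delta> = 0\<close> this is a quantitative form of \<open>D^2 \<le> al^2 / t + be^2 / (1 - t)\<close>, which holds when
  \<open>D \<le> al + be\<close>, with equality only for \<open>al = t D\<close>.\<close>

lemma intermediate_point_defect:
  fixes D al be t \<delta> :: real
  assumes "0 < t" "t < 1" "0 \<le> D" "D \<le> al + \<delta> + be"
  shows "D\<^sup>2 + (al - t * D)\<^sup>2 / t \<le> al\<^sup>2 / t + be\<^sup>2 / (1 - t) + 2 * \<delta> * D"
proof -
  have 1: "al\<^sup>2 / t = t * D\<^sup>2 + 2 * D * (al - t * D) + (al - t * D)\<^sup>2 / t"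
    using assms by (simp add: field_simps power2_eq_square)
  have "0 \<le> (be - (1 - t) * D)\<^sup>2 / (1 - t)" using assms by simp
  also have "\<dots> = be\<^sup>2 / (1 - t) - 2 * be * D + (1 - t) * D\<^sup>2"
    using assms by (simp add: field_simps power2_eq_square)
  finally have 2: "2 * be * D - (1 - t) * D\<^sup>2 \<le> be\<^sup>2 / (1 - t)" by simp
  have 3: "2 * D * (D - al - \<delta>) \<le> 2 * D * be" using assms by (intro mult_left_mono) auto
  show ?thesis using 1 2 3 by (simp add: algebra_simps power2_eq_square)
qed

text \<open>Glue almost optimal couplings and let \<open>D\<close>, \<open>al\<close> and \<open>be\<close> be the distances of the outer points and of
  the middle point to them. The integral of \<open>D^2\<close> is at least \<open>W^2\<close>, that of \<open>al^2 / t + be^2 / (1 - t)\<close>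
  is at most \<open>W^2\<close> up to a small error, so the defect \<open>(al - t D)^2\<close> is small on average. At a
  point \<open>y\<close> outside the stated annulus it is at least \<open>\<epsilon>^2\<close>; hence such points have measure zero.\<close>

lemma W2_intermediate_concentration:
  fixes \<mu> \<nu> \<rho> :: "'a::polish_space measure"
  assumes P: "\<mu> \<in> P2" "\<nu> \<in> P2" "\<rho> \<in> P2" and t: "0 < t" "t < 1"
    and W: "W2 \<mu> \<nu> = t * W2 \<mu> \<rho>" "W2 \<nu> \<rho> = (1 - t) * W2 \<mu> \<rho>"
    and \<epsilon>: "0 < \<epsilon>" and b: "0 \<le> b"
    and A0: "AE x in \<mu>. dist x\<^sub>0 x < \<epsilon>" and A1: "AE z in \<rho>. a \<le> dist x\<^sub>0 z \<and> dist x\<^sub>0 z \<le> b"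
  shows "AE y in \<nu>. t * a - 3 * \<epsilon> \<le> dist x\<^sub>0 y \<and> dist x\<^sub>0 y \<le> t * b + 3 * \<epsilon>"
proof -
  let ?W = "W2 \<mu> \<rho>"
  interpret \<nu>: prob_space \<nu> using P by (auto simp: P2_def)
  have s[measurable_cong]: "sets \<mu> = sets borel" "sets \<nu> = sets borel" "sets \<rho> = sets borel" using P by (auto simp: P2_def)
  have pr: "prob_space \<mu>" "prob_space \<nu>" using P by (auto simp: P2_def)
  define B where "B = {y. \<not> (t * a - 3 * \<epsilon> \<le> dist x\<^sub>0 y \<and> dist x\<^sub>0 y \<le> t * b + 3 * \<epsilon>)}"
  have B[measurable]: "B \<in> sets borel" unfolding B_def by measurable
  define c where "c = 1 / t + 1 / (1 - t) + 2 * (b + \<epsilon>)"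
  have bound: "\<epsilon>\<^sup>2 * measure \<nu> B \<le> \<delta> * c" if \<delta>: "0 < \<delta>" for \<delta>
  proof -
    obtain q1 where q1: "q1 \<in> couplings \<mu> \<nu>" "transport_cost q1 \<le> ennreal ((t * ?W)\<^sup>2 + \<delta>)"
      using almost_optimal_coupling[OF P(1,2) \<delta>] W by metis
    obtain q2 where q2: "q2 \<in> couplings \<nu> \<rho>" "transport_cost q2 \<le> ennreal (((1 - t) * ?W)\<^sup>2 + \<delta>)"
      using almost_optimal_coupling[OF P(2,3) \<delta>] W by metis
    obtain Q where Q: "sets Q = sets borel" "distr Q borel fst = q1" "distr Q borel snd = q2"
      "AE z in Q. dist (snd (fst z)) (fst (snd z)) < \<delta>"
      by (rule glue_couplings[OF q1(1) q2(1) pr(1) s(1) pr(2) s(2) \<delta>])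
    have c1: "distr q1 borel fst = \<mu>" "distr q1 borel snd = \<nu>" "sets q1 = sets borel"
     and c2: "distr q2 borel snd = \<rho>" "sets q2 = sets borel"
      using q1 q2 by (auto simp: couplings_def)
    have mf: "f \<in> Q \<rightarrow>\<^sub>M borel" if "continuous_on UNIV f" for f :: "('a \<times> 'a) \<times> ('a \<times> 'a) \<Rightarrow> 'x::topological_space"
      by (intro measurable_coupling[OF Q(1)] borel_measurable_continuous_onI that)
    have mf2: "f \<in> borel \<rightarrow>\<^sub>M borel" if "continuous_on UNIV f" for f :: "('a \<times> 'a) \<Rightarrow> 'x::topological_space"
      by (intro borel_measurable_continuous_onI that)
    have dx: "distr Q borel (\<lambda>z. fst (fst z)) = \<mu>"
      unfolding c1(1)[symmetric] Q(2)[symmetric]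
      by (subst distr_distr) (auto intro!: mf mf2 continuous_intros simp: comp_def)
    have dy: "distr Q borel (\<lambda>z. snd (fst z)) = \<nu>"
      unfolding c1(2)[symmetric] Q(2)[symmetric]
      by (subst distr_distr) (auto intro!: mf mf2 continuous_intros simp: comp_def)
    have dz: "distr Q borel (\<lambda>z. snd (snd z)) = \<rho>"
      unfolding c2(1)[symmetric] Q(3)[symmetric]
      by (subst distr_distr) (auto intro!: mf mf2 continuous_intros simp: comp_def)
    let ?r = "distr Q borel (\<lambda>z. (fst (fst z), snd (snd z)))"
    let ?xz = "\<lambda>z. ennreal ((dist (fst (fst z)) (snd (snd z)))\<^sup>2)"
      and ?xy = "\<lambda>z. ennreal ((dist (fst (fst z)) (snd (fst z)))\<^sup>2)"
      and ?yz = "\<lambda>z. ennreal ((dist (fst (snd z)) (snd (snd z)))\<^sup>2)"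
    have "?r \<in> couplings \<mu> \<rho>"
    proof -
      have "distr ?r borel fst = \<mu>" unfolding dx[symmetric]
        by (subst distr_distr) (auto intro!: mf mf2 continuous_intros simp: comp_def)
      moreover have "distr ?r borel snd = \<rho>" unfolding dz[symmetric]
        by (subst distr_distr) (auto intro!: mf mf2 continuous_intros simp: comp_def)
      ultimately show ?thesis by (simp add: couplings_def)
    qed
    then have "ennreal (?W\<^sup>2) \<le> transport_cost ?r" by (rule W2_le_cost[OF P(1,3)])
    also have "\<dots> = (\<integral>\<^sup>+ z. ?xz z \<partial>Q)"
      unfolding transport_cost_def
      by (subst nn_integral_distr) (simp_all add: mf mf2 measurable_dist_sq continuous_intros)
    finally have low: "ennreal (?W\<^sup>2) \<le> (\<integral>\<^sup>+ z. ?xz z \<partial>Q)" .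
    have mB[measurable]: "(\<lambda>z. indicator B (snd (fst z)) :: ennreal) \<in> borel_measurable Q"
      by (rule measurable_compose[OF mf[of "\<lambda>z. snd (fst z)"]]) (auto intro!: continuous_intros)
    have "emeasure \<nu> B = (\<integral>\<^sup>+ z. indicator B (snd (fst z)) \<partial>Q)"
      unfolding dy[symmetric] nn_integral_indicator[OF B[folded sets_distr[of Q borel "\<lambda>z. snd (fst z)"]], symmetric]
      by (subst nn_integral_distr) (auto intro!: mf continuous_intros)
    moreover have md: "?xz \<in> borel_measurable Q"
      "?xy \<in> borel_measurable Q"
      "?yz \<in> borel_measurable Q"
      by (rule measurable_compose[OF mf measurable_ennreal], intro continuous_intros)+
    ultimately have "ennreal (?W\<^sup>2) + ennreal (\<epsilon>\<^sup>2) * emeasure \<nu> B \<le>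
       (\<integral>\<^sup>+ z. ?xz z + ennreal (\<epsilon>\<^sup>2) * indicator B (snd (fst z)) \<partial>Q)"
      using low by (simp add: nn_integral_add nn_integral_cmult add_right_mono)
    also have "\<dots> \<le> (\<integral>\<^sup>+ z. ennreal (1 / t) * ?xy z
          + ennreal (1 / (1 - t)) * ?yz z + ennreal (2 * \<delta> * (b + \<epsilon>)) \<partial>Q)"
    proof (rule nn_integral_mono_AE)
      have ax: "AE z in Q. dist x\<^sub>0 (fst (fst z)) < \<epsilon>"
        using A0 unfolding dx[symmetric] by (subst (asm) AE_distr_iff) (auto intro!: mf continuous_intros)
      have az: "AE z in Q. a \<le> dist x\<^sub>0 (snd (snd z)) \<and> dist x\<^sub>0 (snd (snd z)) \<le> b"
        using A1 unfolding dz[symmetric] by (subst (asm) AE_distr_iff) (auto intro!: mf continuous_intros)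
      show "AE z in Q. ?xz z + ennreal (\<epsilon>\<^sup>2) * indicator B (snd (fst z))
         \<le> ennreal (1 / t) * ?xy z
          + ennreal (1 / (1 - t)) * ?yz z + ennreal (2 * \<delta> * (b + \<epsilon>))"
        using ax az Q(4)
      proof eventually_elim
        fix Z :: "('a \<times> 'a) \<times> ('a \<times> 'a)"
        obtain x y y' z where Z: "Z = ((x, y), (y', z))" by (metis prod.collapse)
        assume "dist x\<^sub>0 (fst (fst Z)) < \<epsilon>" "a \<le> dist x\<^sub>0 (snd (snd Z)) \<and> dist x\<^sub>0 (snd (snd Z)) \<le> b"
          "dist (snd (fst Z)) (fst (snd Z)) < \<delta>"
        then have h: "dist x\<^sub>0 x < \<epsilon>" "a \<le> dist x\<^sub>0 z" "dist x\<^sub>0 z \<le> b" "dist y y' < \<delta>" by (auto simp: Z)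
        let ?D = "dist x z" and ?al = "dist x y" and ?be = "dist y' z"
        have tri: "dist x z \<le> dist x y + dist y y' + dist y' z"
          using dist_triangle[of x z y] dist_triangle[of y z y'] by linarith
        have Dle: "?D \<le> b + \<epsilon>" using dist_triangle3[of x z x\<^sub>0] h by linarith
        have Dge: "a - \<epsilon> \<le> ?D" using dist_triangle[of x\<^sub>0 z x] h by linarith
        have def: "?D\<^sup>2 + (?al - t * ?D)\<^sup>2 / t \<le> ?al\<^sup>2 / t + ?be\<^sup>2 / (1 - t) + 2 * \<delta> * ?D"
          using tri h by (intro intermediate_point_defect t) auto
        have "2 * \<delta> * ?D \<le> 2 * \<delta> * (b + \<epsilon>)" using Dle \<delta> by simp
        moreover have "\<epsilon>\<^sup>2 * indicator B y \<le> (?al - t * ?D)\<^sup>2 / t"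
        proof (cases "y \<in> B")
          case True
          have D1: "t * ?D \<le> t * b + \<epsilon>" "t * a - \<epsilon> \<le> t * ?D"
          proof -
            have "t * ?D \<le> t * (b + \<epsilon>)" using Dle t by simp
            also have "\<dots> \<le> t * b + \<epsilon>" using t \<epsilon> by (simp add: algebra_simps)
            finally show "t * ?D \<le> t * b + \<epsilon>" .
            have "t * a - \<epsilon> \<le> t * (a - \<epsilon>)" using t \<epsilon> by (simp add: algebra_simps)
            also have "\<dots> \<le> t * ?D" using Dge t by simp
            finally show "t * a - \<epsilon> \<le> t * ?D" .
          qed
          have "dist x\<^sub>0 y \<le> dist x\<^sub>0 x + dist x y" "dist x y \<le> dist x\<^sub>0 x + dist x\<^sub>0 y"
            using dist_triangle[of x\<^sub>0 y x] dist_triangle3[of x y x\<^sub>0] by auto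
          then have "\<epsilon> \<le> \<bar>?al - t * ?D\<bar>" using True D1 h \<epsilon> unfolding B_def by auto
          then have "\<epsilon>\<^sup>2 \<le> (?al - t * ?D)\<^sup>2" using \<epsilon> by (simp add: abs_le_square_iff[symmetric])
          also have "\<dots> \<le> (?al - t * ?D)\<^sup>2 / t" using t by (simp add: le_divide_eq mult_left_le)
          finally show ?thesis using True by simp
        qed (use t in simp)
        ultimately have "?D\<^sup>2 + \<epsilon>\<^sup>2 * indicator B y \<le> 1 / t * ?al\<^sup>2 + 1 / (1 - t) * ?be\<^sup>2 + 2 * \<delta> * (b + \<epsilon>)"
          using def by simp
        then have "ennreal (?D\<^sup>2 + \<epsilon>\<^sup>2 * indicator B y) \<le> ennreal (1 / t * ?al\<^sup>2 + 1 / (1 - t) * ?be\<^sup>2 + 2 * \<delta> * (b + \<epsilon>))"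
          by (rule ennreal_leI)
        moreover have "ennreal (?D\<^sup>2 + \<epsilon>\<^sup>2 * indicator B y) = ennreal (?D\<^sup>2) + ennreal (\<epsilon>\<^sup>2) * indicator B y"
          by (auto split: split_indicator)
        moreover have "ennreal (1 / t * ?al\<^sup>2 + 1 / (1 - t) * ?be\<^sup>2 + 2 * \<delta> * (b + \<epsilon>))
            = ennreal (1 / t) * ennreal (?al\<^sup>2) + ennreal (1 / (1 - t)) * ennreal (?be\<^sup>2) + ennreal (2 * \<delta> * (b + \<epsilon>))"
          using t \<delta> b \<epsilon> by (subst ennreal_plus | subst ennreal_mult | simp)+
        ultimately show "ennreal ((dist (fst (fst Z)) (snd (snd Z)))\<^sup>2) + ennreal (\<epsilon>\<^sup>2) * indicator B (snd (fst Z))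
         \<le> ennreal (1 / t) * ennreal ((dist (fst (fst Z)) (snd (fst Z)))\<^sup>2)
          + ennreal (1 / (1 - t)) * ennreal ((dist (fst (snd Z)) (snd (snd Z)))\<^sup>2) + ennreal (2 * \<delta> * (b + \<epsilon>))"
          by (simp add: Z)
      qed
    qed
    also have "\<dots> = ennreal (1 / t) * transport_cost q1 + ennreal (1 / (1 - t)) * transport_cost q2 + ennreal (2 * \<delta> * (b + \<epsilon>))"
    proof -
      have "transport_cost q1 = (\<integral>\<^sup>+ z. ?xy z \<partial>Q)"
        unfolding transport_cost_def Q(2)[symmetric]
        by (subst nn_integral_distr) (simp_all add: mf mf2 measurable_dist_sq continuous_intros)
      moreover have "transport_cost q2 = (\<integral>\<^sup>+ z. ?yz z \<partial>Q)"
        unfolding transport_cost_def Q(3)[symmetric]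
        by (subst nn_integral_distr) (simp_all add: mf mf2 measurable_dist_sq continuous_intros)
      moreover have "prob_space Q"
      proof (rule prob_space_distrD)
        show "(\<lambda>z. fst (fst z)) \<in> Q \<rightarrow>\<^sub>M borel" by (auto intro!: mf continuous_intros)
        show "prob_space (distr Q borel (\<lambda>z. fst (fst z)))" unfolding dx by fact
      qed
      ultimately show ?thesis using md
        by (simp add: nn_integral_add nn_integral_cmult prob_space.emeasure_space_1)
    qed
    also have "\<dots> \<le> ennreal (1 / t) * ennreal ((t * ?W)\<^sup>2 + \<delta>) + ennreal (1 / (1 - t)) * ennreal (((1 - t) * ?W)\<^sup>2 + \<delta>) + ennreal (2 * \<delta> * (b + \<epsilon>))"
      by (intro add_mono mult_left_mono q1 q2) auto
    also have "\<dots> = ennreal (1 / t * ((t * ?W)\<^sup>2 + \<delta>) + 1 / (1 - t) * (((1 - t) * ?W)\<^sup>2 + \<delta>) + 2 * \<delta> * (b + \<epsilon>))"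
      using t \<delta> b \<epsilon> by (simp add: ennreal_mult[symmetric] ennreal_plus[symmetric] del: ennreal_plus)
    also have "1 / t * ((t * ?W)\<^sup>2 + \<delta>) + 1 / (1 - t) * (((1 - t) * ?W)\<^sup>2 + \<delta>) + 2 * \<delta> * (b + \<epsilon>) = ?W\<^sup>2 + \<delta> * c"
    proof -
      have "1 / t * ((t * ?W)\<^sup>2 + \<delta>) = t * ?W\<^sup>2 + \<delta> / t"
        using t by (simp add: field_simps power2_eq_square)
      moreover have "1 / s * ((s * ?W)\<^sup>2 + \<delta>) = s * ?W\<^sup>2 + \<delta> / s" if "s > 0" for s
        using that by (simp add: field_simps power2_eq_square)
      from this[of "1 - t"] have "1 / (1 - t) * (((1 - t) * ?W)\<^sup>2 + \<delta>) = (1 - t) * ?W\<^sup>2 + \<delta> / (1 - t)"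
        using t by simp
      ultimately show ?thesis unfolding c_def by (simp add: algebra_simps)
    qed
    finally have "ennreal (?W\<^sup>2 + \<epsilon>\<^sup>2 * measure \<nu> B) \<le> ennreal (?W\<^sup>2 + \<delta> * c)"
      by (simp add: \<nu>.emeasure_eq_measure ennreal_mult)
    moreover have "0 \<le> ?W\<^sup>2 + \<delta> * c" using t \<delta> b \<epsilon> by (simp add: c_def)
    ultimately show ?thesis by (metis add_le_cancel_left ennreal_le_iff)
  qed
  have "\<epsilon>\<^sup>2 * measure \<nu> B \<le> 0"
  proof (rule field_le_epsilon)
    fix e :: real assume "0 < e"
    have "0 < c" using t b \<epsilon> by (simp add: c_def add_pos_nonneg)
    then show "\<epsilon>\<^sup>2 * measure \<nu> B \<le> 0 + e" using bound[of "e / c"] \<open>0 < e\<close> by simp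
  qed
  then have "emeasure \<nu> B = 0" using \<epsilon> by (simp add: \<nu>.emeasure_eq_measure mult_le_0_iff measure_le_0_iff)
  then have "B \<in> null_sets \<nu>" using s(2) B by auto
  then show ?thesis using AE_not_in[of B \<nu>] by (simp add: B_def)
qed

section \<open>The entropy inequality as a measure inequality\<close>

lemma mms_sets: "metric_measure_space M \<Longrightarrow> sets M = sets borel"
  by (simp add: metric_measure_space_def)

lemma mms_space: "metric_measure_space M \<Longrightarrow> space M = UNIV"
  using sets_eq_imp_space_eq[of M borel] by (simp add: metric_measure_space_def)

text \<open>By the Lindeloef property, countably many of the open sets of finite measure cover the space.\<close>

lemma mms_sigma_finite:
  fixes M :: "'a::polish_space measure"
  assumes M: "metric_measure_space M"
  shows "sigma_finite_measure M"
proof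
  obtain F where F: "F \<subseteq> {U. open U \<and> emeasure M U < \<infinity>}" "countable F"
      "\<Union>F = \<Union>{U. open U \<and> emeasure M U < \<infinity>}"
    using Lindelof[of "{U. open U \<and> emeasure M U < \<infinity>}"] by auto
  have "x \<in> \<Union>{U. open U \<and> emeasure M U < \<infinity>}" for x
  proof -
    obtain r where "r > 0" "emeasure M (ball x r) < \<infinity>"
      using M by (auto simp: metric_measure_space_def)
    then show ?thesis by (intro UnionI[of "ball x r"]) auto
  qed
  then have "\<Union>F = space M" using F(3) mms_space[OF M] by auto
  then show "\<exists>A. countable A \<and> A \<subseteq> sets M \<and> \<Union> A = space M \<and> (\<forall>a\<in>A. emeasure M a \<noteq> \<infinity>)"
  proof (intro exI[of _ F] conjI ballI)
    show "F \<subseteq> sets M" using F(1) mms_sets[OF M] by fastforce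
    show "emeasure M a \<noteq> \<infinity>" if "a \<in> F" for a using that F(1) by fastforce
  qed (use F(2) in auto)
qed

text \<open>For an absolutely continuous measure the singular part of any Lebesgue decomposition vanishes, so
  the chosen density is a Radon-Nikodym derivative.\<close>

lemma ac_density_props:
  fixes M :: "'a::polish_space measure"
  assumes M: "metric_measure_space M" and \<nu>: "\<nu> \<in> P2_ac M"
  shows "ac_density M \<nu> \<in> borel_measurable M" and "density M (ac_density M \<nu>) = \<nu>"
proof -
  interpret sigma_finite_measure M by (rule mms_sigma_finite[OF M])
  have ac: "absolutely_continuous M \<nu>" and s: "sets \<nu> = sets M"
    using \<nu> mms_sets[OF M] by (auto simp: P2_ac_def P2_def)
  obtain f where f: "f \<in> borel_measurable M" "density M f = \<nu>"
    using Radon_Nikodym[OF ac s] by auto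
  have "lebesgue_decomposition M \<nu> f (null_measure M)"
    unfolding lebesgue_decomposition_def using f by (auto intro!: bexI[of _ "{}"])
  then have ex: "\<exists>\<rho> \<nu>s. lebesgue_decomposition M \<nu> \<rho> \<nu>s" by blast
  obtain \<nu>s where d: "lebesgue_decomposition M \<nu> (ac_density M \<nu>) \<nu>s"
    using someI_ex[OF ex] unfolding ac_density_def by blast
  then obtain A where A: "A \<in> sets M" "emeasure M A = 0" "emeasure \<nu>s (space M - A) = 0"
    by (auto simp: lebesgue_decomposition_def)
  show m: "ac_density M \<nu> \<in> borel_measurable M" using d by (simp add: lebesgue_decomposition_def)
  have d': "emeasure \<nu> B = emeasure (density M (ac_density M \<nu>)) B + emeasure \<nu>s B" if "B \<in> sets M" for B
    using d that by (simp add: lebesgue_decomposition_def)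
  have ss: "sets \<nu>s = sets M" using d by (simp add: lebesgue_decomposition_def)
  have "emeasure \<nu> A = 0" using absolutely_continuousD[OF ac A(1,2)] .
  then have "emeasure \<nu>s A = 0" using d'[OF A(1)] by (simp add: add_eq_0_iff_both_eq_0)
  then have n: "emeasure \<nu>s (space M) = 0"
    using emeasure_subadditive[of A \<nu>s "space M - A"] A ss sets.sets_into_space[OF A(1)]
    by (simp add: Un_absorb1)
  have n': "emeasure \<nu>s B = 0" if "B \<in> sets M" for B
    using emeasure_mono[of B "space M" \<nu>s] that ss n sets.sets_into_space[OF that] by simp
  show "density M (ac_density M \<nu>) = \<nu>"
    by (rule measure_eqI) (use s d' n' in auto)
qed

lemma uniform_measure_P2_ac:
  fixes M :: "'a::polish_space measure"
  assumes M: "metric_measure_space M" and A: "A \<in> sets M" "0 < emeasure M A" "emeasure M A < \<infinity>" "bounded A"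
  shows "uniform_measure M A \<in> P2_ac M"
    and "bounded (msupport (uniform_measure M A))"
    and "AE x in uniform_measure M A. x \<in> A \<and> ac_density M (uniform_measure M A) x = 1 / emeasure M A"
proof -
  interpret sigma_finite_measure M by (rule mms_sigma_finite[OF M])
  have s: "sets M = sets borel" by (rule mms_sets[OF M])
  note [measurable_cong] = s
  have [measurable]: "A \<in> sets M" by fact
  have den: "uniform_measure M A = density M (\<lambda>x. indicator A x / emeasure M A)" by (simp add: uniform_measure_def)
  have mden: "(\<lambda>x. indicator A x / emeasure M A) \<in> borel_measurable M" by measurable
  have ac: "absolutely_continuous M (uniform_measure M A)"
    unfolding den by (rule absolutely_continuousI_density[OF mden])
  have pr: "prob_space (uniform_measure M A)"
    using A by (intro prob_space_uniform_measure) auto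
  have inA: "AE x in uniform_measure M A. x \<in> A" by (rule AE_uniform_measureI) auto
  obtain x0 C where C: "\<And>x. x \<in> A \<Longrightarrow> dist x0 x \<le> C"
    using A(4) unfolding bounded_def by auto
  have "(\<integral>\<^sup>+ x. ennreal ((dist x0 x)\<^sup>2) \<partial>uniform_measure M A) \<le> (\<integral>\<^sup>+ x. ennreal (C\<^sup>2) \<partial>uniform_measure M A)"
    by (rule nn_integral_mono_AE, use inA in eventually_elim)
       (auto intro!: ennreal_leI power_mono C)
  also have "\<dots> = ennreal (C\<^sup>2)" using prob_space.emeasure_space_1[OF pr] by simp
  also have "\<dots> < \<infinity>" by simp
  finally show P: "uniform_measure M A \<in> P2_ac M"
    using s pr ac by (auto simp: P2_ac_def P2_def)
  have "msupport (uniform_measure M A) \<subseteq> closure A"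
  proof
    fix x assume x: "x \<in> msupport (uniform_measure M A)"
    show "x \<in> closure A"
    proof (rule ccontr)
      assume "x \<notin> closure A"
      then have "open (- closure A) \<and> x \<in> - closure A" by auto
      then have "0 < emeasure (uniform_measure M A) (- closure A)"
        using x unfolding msupport_def mem_Collect_eq by blast
      moreover have "A \<inter> - closure A = {}" using closure_subset by auto
      ultimately show False using A(1) s by simp
    qed
  qed
  then show "bounded (msupport (uniform_measure M A))"
    using A(4) bounded_closure bounded_subset by blast
  have "AE x in M. ac_density M (uniform_measure M A) x = indicator A x / emeasure M A"
    by (rule density_unique[OF ac_density_props(1)[OF M P] mden])
       (simp only: ac_density_props(2)[OF M P] den[symmetric])
  then have "AE x in uniform_measure M A. ac_density M (uniform_measure M A) x = 1 / emeasure M A"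
    by (intro AE_uniform_measureI A(1)) (auto elim!: eventually_mono)
  with inA show "AE x in uniform_measure M A. x \<in> A \<and> ac_density M (uniform_measure M A) x = 1 / emeasure M A"
    by eventually_elim simp
qed

text \<open>The concave function \<open>r powr \<alpha>\<close> lies below its tangent at \<open>r = 1 / m\<close>.\<close>

lemma ennpowr_tangent:
  assumes \<alpha>: "0 \<le> \<alpha>" "\<alpha> \<le> 1" and m: "0 < m" and x: "x < \<infinity>"
  shows "ennpowr x \<alpha> \<le> ennreal (\<alpha> * m powr (1 - \<alpha>)) * x + ennreal ((1 - \<alpha>) * m powr (- \<alpha>))"
proof (cases "x = 0")
  case False
  define y where "y = enn2real x"
  have y: "x = ennreal y" "0 < y" using x False by (auto simp: y_def enn2real_positive_iff less_top zero_less_iff_neq_zero)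
  have "(y * m) powr \<alpha> * 1 powr (1 - \<alpha>) \<le> \<alpha> * (y * m) + (1 - \<alpha>) * 1"
    using \<alpha> m y by (intro Youngs_inequality_0) auto
  then have "y powr \<alpha> * m powr \<alpha> * m powr (- \<alpha>) \<le> (\<alpha> * (y * m) + (1 - \<alpha>)) * m powr (- \<alpha>)"
    using y m by (simp add: powr_mult)
  moreover have "m powr \<alpha> * m powr (- \<alpha>) = 1" "m * m powr (- \<alpha>) = m powr (1 - \<alpha>)"
    using m by (simp_all add: powr_add[symmetric] powr_diff powr_minus field_simps)
  moreover have "(\<alpha> * (y * m) + (1 - \<alpha>)) * m powr (- \<alpha>)
      = \<alpha> * (m * m powr (- \<alpha>)) * y + (1 - \<alpha>) * m powr (- \<alpha>)"
    by (simp add: algebra_simps)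
  ultimately have "y powr \<alpha> \<le> \<alpha> * m powr (1 - \<alpha>) * y + (1 - \<alpha>) * m powr (- \<alpha>)"
    by (simp add: mult.assoc)
  then have "ennreal (y powr \<alpha>) \<le> ennreal (\<alpha> * m powr (1 - \<alpha>) * y + (1 - \<alpha>) * m powr (- \<alpha>))"
    by (rule ennreal_leI)
  also have "\<dots> = ennreal (\<alpha> * m powr (1 - \<alpha>)) * x + ennreal ((1 - \<alpha>) * m powr (- \<alpha>))"
    using \<alpha> y by (simp add: ennreal_mult)
  finally show ?thesis using y by (simp add: ennpowr_ennreal)
qed (use \<alpha> in \<open>simp add: ennpowr_def\<close>)

text \<open>Jensen's inequality. Integrating the tangent at the value \<open>1 / m(S)\<close> of the uniform density avoids
  Hoelder's inequality and covers the case \<open>N = 1\<close>, where the integrand is the indicator function of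
  the set on which the density is positive.\<close>

lemma entropy_integral_le:
  fixes M :: "'a::polish_space measure"
  assumes M: "metric_measure_space M" and \<nu>: "\<nu> \<in> P2_ac M" and N: "1 \<le> N"
    and S: "S \<in> sets M" "emeasure M S < \<infinity>" and ae: "AE y in \<nu>. y \<in> S"
  shows "(\<integral>\<^sup>+ x. ennpowr (ac_density M \<nu> x) (1 - 1 / N) \<partial>M) \<le> ennreal (measure M S powr (1 / N))"
proof -
  let ?\<rho> = "ac_density M \<nu>" and ?m = "measure M S" and ?\<alpha> = "1 - 1 / N"
  note \<rho> = ac_density_props[OF M \<nu>]
  note [measurable] = \<rho>(1) S(1)
  have s\<nu>: "sets \<nu> = sets M" using \<nu> mms_sets[OF M] by (auto simp: P2_ac_def P2_def)
  interpret \<nu>: prob_space \<nu> using \<nu> by (auto simp: P2_ac_def P2_def)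
  have ac: "absolutely_continuous M \<nu>" using \<nu> by (simp add: P2_ac_def)
  have em: "emeasure M S = ennreal ?m" using S(2) by (simp add: emeasure_eq_ennreal_measure less_top)
  have "?m \<noteq> 0"
  proof
    assume "?m = 0"
    then have "emeasure \<nu> S = 0" using absolutely_continuousD[OF ac S(1)] em by simp
    moreover have "emeasure \<nu> S = 1" using \<nu>.emeasure_eq_1_AE[of S] S(1) s\<nu> ae by simp
    ultimately show False by simp
  qed
  then have m: "0 < ?m" by (simp add: less_le)
  have one: "(\<integral>\<^sup>+ x. ?\<rho> x \<partial>M) = 1"
  proof -
    have "(\<integral>\<^sup>+ x. ?\<rho> x \<partial>M) = (\<integral>\<^sup>+ x. ?\<rho> x * indicator (space M) x \<partial>M)"
      by (intro nn_integral_cong) simp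
    also have "\<dots> = emeasure \<nu> (space M)"
      using emeasure_density[OF \<rho>(1), of "space M"] \<rho>(2) by simp
    also have "\<dots> = 1" using \<nu>.emeasure_space_1 sets_eq_imp_space_eq[OF s\<nu>] by simp
    finally show ?thesis .
  qed
  have "AE x in M. ?\<rho> x \<noteq> \<infinity>"
    by (rule nn_integral_noteq_infinite[OF \<rho>(1)]) (simp add: one)
  moreover have "AE x in M. 0 < ?\<rho> x \<longrightarrow> x \<in> S"
    using ae unfolding AE_density[OF \<rho>(1), symmetric] \<rho>(2) .
  ultimately have "AE x in M. ennpowr (?\<rho> x) ?\<alpha> \<le>
      ennreal (?\<alpha> * ?m powr (1 - ?\<alpha>)) * ?\<rho> x + ennreal ((1 - ?\<alpha>) * ?m powr (- ?\<alpha>)) * indicator S x"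
  proof eventually_elim
    fix x assume x: "?\<rho> x \<noteq> \<infinity>" "0 < ?\<rho> x \<longrightarrow> x \<in> S"
    show "ennpowr (?\<rho> x) ?\<alpha> \<le>
      ennreal (?\<alpha> * ?m powr (1 - ?\<alpha>)) * ?\<rho> x + ennreal ((1 - ?\<alpha>) * ?m powr (- ?\<alpha>)) * indicator S x"
    proof (cases "x \<in> S")
      case True
      then show ?thesis using ennpowr_tangent[of ?\<alpha> ?m "?\<rho> x"] N m x by (simp add: less_top)
    next
      case False
      then have "?\<rho> x = 0" using x by (simp add: zero_less_iff_neq_zero)
      then show ?thesis using N by (simp add: ennpowr_def)
    qed
  qed
  then have "(\<integral>\<^sup>+ x. ennpowr (?\<rho> x) ?\<alpha> \<partial>M) \<le>
    (\<integral>\<^sup>+ x. ennreal (?\<alpha> * ?m powr (1 - ?\<alpha>)) * ?\<rho> x + ennreal ((1 - ?\<alpha>) * ?m powr (- ?\<alpha>)) * indicator S x \<partial>M)"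
    by (rule nn_integral_mono_AE)
  also have "\<dots> = ennreal (?\<alpha> * ?m powr (1 - ?\<alpha>)) + ennreal ((1 - ?\<alpha>) * ?m powr (- ?\<alpha>)) * ennreal ?m"
    by (subst nn_integral_add) (auto simp: nn_integral_cmult one em)
  also have "\<dots> = ennreal (?\<alpha> * ?m powr (1 - ?\<alpha>) + (1 - ?\<alpha>) * (?m powr (- ?\<alpha>) * ?m))"
    using N m by (simp add: ennreal_mult[symmetric] ennreal_plus[symmetric] mult.assoc del: ennreal_plus)
  also have "?m powr (- ?\<alpha>) * ?m = ?m powr (1 - ?\<alpha>)"
    using m by (simp add: powr_diff powr_minus field_simps)
  also have "?\<alpha> * ?m powr (1 - ?\<alpha>) + (1 - ?\<alpha>) * ?m powr (1 - ?\<alpha>) = ?m powr (1 / N)"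
    by (simp add: algebra_simps)
  finally show ?thesis .
qed

lemma continuous_on_bcontfun_eval: "continuous_on A (\<lambda>\<gamma>. apply_bcontfun \<gamma> s)"
proof (rule continuous_onI)
  fix \<gamma> e assume "(0::real) < e"
  then show "\<exists>d>0. \<forall>\<gamma>'\<in>A. dist \<gamma>' \<gamma> < d \<longrightarrow> dist (apply_bcontfun \<gamma>' s) (apply_bcontfun \<gamma> s) \<le> e"
    by (intro exI[of _ e]) (auto intro: order_trans[OF dist_bounded])
qed

text \<open>The curvature-dimension condition for two uniform measures and a lower bound \<open>c\<close> of \<open>\<tau>\<close>. Only the term
  at the end points is kept, where the density is \<open>1 / m(A1)\<close>; the other one is nonnegative.\<close>

lemma CD_uniform:
  fixes M :: "'a::polish_space measure"
  assumes M: "metric_measure_space M" and CD: "CD M k N"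
    and A0: "A0 \<in> sets M" "0 < emeasure M A0" "emeasure M A0 < \<infinity>" "bounded A0"
    and A1: "A1 \<in> sets M" "0 < emeasure M A1" "emeasure M A1 < \<infinity>" "bounded A1"
  obtains P \<nu> where "prob_space P"
    "AE \<gamma> in P. \<gamma> \<in> geodesics \<and> apply_bcontfun \<gamma> 0 \<in> A0 \<and> apply_bcontfun \<gamma> 1 \<in> A1"
    "W2_geodesic_ac M (uniform_measure M A0) (uniform_measure M A1) \<nu>"
    "\<forall>t\<in>{0..1}. \<forall>N'\<ge>N. \<forall>c\<ge>0. (\<forall>\<gamma>\<in>geodesics. apply_bcontfun \<gamma> 0 \<in> A0 \<longrightarrow> apply_bcontfun \<gamma> 1 \<in> A1 \<longrightarrow>
         ennreal c \<le> tau N' (k_plus k \<gamma>) t (speed \<gamma>)) \<longrightarrow>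
       ennreal (c * measure M A1 powr (1 / N')) \<le> (\<integral>\<^sup>+ x. ennpowr (ac_density M (\<nu> t) x) (1 - 1 / N') \<partial>M)"
proof -
  let ?u0 = "uniform_measure M A0" and ?u1 = "uniform_measure M A1"
  note u0 = uniform_measure_P2_ac[OF M A0] and u1 = uniform_measure_P2_ac[OF M A1]
  obtain P \<nu> where P: "dyn_optimal_coupling ?u0 ?u1 P" "W2_geodesic_ac M ?u0 ?u1 \<nu>"
    and ent: "\<And>t N'. t \<in> {0..1} \<Longrightarrow> N \<le> N' \<Longrightarrow> renyi_entropy N' M (\<nu> t) \<le>
              - enn2ereal (\<integral>\<^sup>+ \<gamma>.
                  (tau N' (k_minus k \<gamma>) (1 - t) (speed \<gamma>)
                     * ennpowr (ac_density M ?u0 (apply_bcontfun \<gamma> 0)) (- 1 / N')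
                 + tau N' (k_plus k \<gamma>) t (speed \<gamma>)
                     * ennpowr (ac_density M ?u1 (apply_bcontfun \<gamma> 1)) (- 1 / N')) \<partial>P)"
    using CD u0(1,2) u1(1,2) unfolding CD_def by blast
  have pP: "prob_space P" and sP: "sets P = sets (restrict_space borel geodesics)"
    using P(1) by (auto simp: dyn_optimal_coupling_def)
  have geo: "AE \<gamma> in P. \<gamma> \<in> geodesics"
    using sets_eq_imp_space_eq[OF sP] by (auto simp: space_restrict_space)
  let ?e = "\<lambda>\<gamma>::real \<Rightarrow>\<^sub>C 'a. (apply_bcontfun \<gamma> 0, apply_bcontfun \<gamma> 1)"
  have e: "?e \<in> P \<rightarrow>\<^sub>M borel"
    by (subst measurable_cong_sets[OF sP refl])
       (intro measurable_restrict_space1 borel_measurable_continuous_onI continuous_intros continuous_on_bcontfun_eval)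
  have c: "distr P borel ?e \<in> couplings ?u0 ?u1"
    using P(1) by (simp add: dyn_optimal_coupling_def optimal_coupling_def)
  have m2: "fst \<in> (borel :: ('a \<times> 'a) measure) \<rightarrow>\<^sub>M borel" "snd \<in> (borel :: ('a \<times> 'a) measure) \<rightarrow>\<^sub>M borel"
    by (intro borel_measurable_continuous_onI continuous_intros)+
  have d0: "distr P borel (\<lambda>\<gamma>. apply_bcontfun \<gamma> 0) = ?u0"
    using c distr_distr[OF m2(1) e] by (simp add: couplings_def comp_def)
  have d1: "distr P borel (\<lambda>\<gamma>. apply_bcontfun \<gamma> 1) = ?u1"
    using c distr_distr[OF m2(2) e] by (simp add: couplings_def comp_def)
  have e0: "(\<lambda>\<gamma>. apply_bcontfun \<gamma> 0) \<in> P \<rightarrow>\<^sub>M borel" "(\<lambda>\<gamma>. apply_bcontfun \<gamma> 1) \<in> P \<rightarrow>\<^sub>M borel"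
    using measurable_comp[OF e m2(1)] measurable_comp[OF e m2(2)] by (simp_all add: comp_def)
  have sM: "sets M = sets borel" by (rule mms_sets[OF M])
  have a0: "AE \<gamma> in P. apply_bcontfun \<gamma> 0 \<in> A0"
  proof -
    have "AE x in ?u0. x \<in> A0" using u0(3) by eventually_elim simp
    then show ?thesis unfolding d0[symmetric] using A0(1) sM
      by (subst (asm) AE_distr_iff[OF e0(1)]) auto
  qed
  have a1: "AE \<gamma> in P. apply_bcontfun \<gamma> 1 \<in> A1 \<and>
       ac_density M ?u1 (apply_bcontfun \<gamma> 1) = 1 / emeasure M A1"
  proof -
    have "ac_density M ?u1 \<in> borel_measurable borel"
      using ac_density_props(1)[OF M u1(1)] by (simp add: measurable_cong_sets[OF sM refl])
    then have "{x \<in> space borel. x \<in> A1 \<and> ac_density M ?u1 x = 1 / emeasure M A1} \<in> sets borel"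
      using A1(1) sM by measurable
    then show ?thesis using u1(3) unfolding d1[symmetric]
      by (subst (asm) AE_distr_iff[OF e0(2)]) (auto simp: d1)
  qed
  have ae: "AE \<gamma> in P. \<gamma> \<in> geodesics \<and> apply_bcontfun \<gamma> 0 \<in> A0 \<and> apply_bcontfun \<gamma> 1 \<in> A1"
    using geo a0 a1 by eventually_elim simp
  let ?m1 = "measure M A1"
  have em1: "emeasure M A1 = ennreal ?m1" using A1(3) by (simp add: emeasure_eq_ennreal_measure less_top)
  then have m1: "0 < ?m1" using A1(2) by (simp add: less_le)
  \<comment> \<open>The lower bound is measurable in the geodesic, which the integrand of the condition need not be.\<close>
  show ?thesis
  proof (rule that[OF pP ae P(2)], intro ballI allI impI)
    fix t N' c assume t: "t \<in> {0..1::real}" "N \<le> N'" and c: "0 \<le> c"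
      and tau: "\<forall>\<gamma>\<in>geodesics. apply_bcontfun \<gamma> 0 \<in> A0 \<longrightarrow> apply_bcontfun \<gamma> 1 \<in> A1 \<longrightarrow>
         ennreal c \<le> tau N' (k_plus k \<gamma>) t (speed \<gamma>)"
    have "ennreal (c * ?m1 powr (1 / N')) = (\<integral>\<^sup>+ \<gamma>. ennreal c * ennreal (?m1 powr (1 / N')) \<partial>P)"
      using c by (simp add: ennreal_mult prob_space.emeasure_space_1[OF pP])
    also have "\<dots> \<le> (\<integral>\<^sup>+ \<gamma>.
                  (tau N' (k_minus k \<gamma>) (1 - t) (speed \<gamma>)
                     * ennpowr (ac_density M ?u0 (apply_bcontfun \<gamma> 0)) (- 1 / N')
                 + tau N' (k_plus k \<gamma>) t (speed \<gamma>)
                     * ennpowr (ac_density M ?u1 (apply_bcontfun \<gamma> 1)) (- 1 / N')) \<partial>P)"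
    proof (rule nn_integral_mono_AE, use ae a1 in eventually_elim)
      fix \<gamma> assume \<gamma>: "\<gamma> \<in> geodesics \<and> apply_bcontfun \<gamma> 0 \<in> A0 \<and> apply_bcontfun \<gamma> 1 \<in> A1"
        and d: "apply_bcontfun \<gamma> 1 \<in> A1 \<and> ac_density M ?u1 (apply_bcontfun \<gamma> 1) = 1 / emeasure M A1"
      have "1 / emeasure M A1 = ennreal (1 / ?m1)"
        unfolding em1 using m1 by (simp add: divide_ennreal[symmetric])
      then have "ennpowr (ac_density M ?u1 (apply_bcontfun \<gamma> 1)) (- 1 / N') = ennreal ((1 / ?m1) powr (- 1 / N'))"
        using d m1 by (simp add: ennpowr_ennreal)
      also have "(1 / ?m1) powr (- 1 / N') = ?m1 powr (1 / N')"
        using m1 by (simp add: powr_divide powr_minus_divide)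
      finally show "ennreal c * ennreal (?m1 powr (1 / N')) \<le>
          tau N' (k_minus k \<gamma>) (1 - t) (speed \<gamma>)
             * ennpowr (ac_density M ?u0 (apply_bcontfun \<gamma> 0)) (- 1 / N')
         + tau N' (k_plus k \<gamma>) t (speed \<gamma>)
             * ennpowr (ac_density M ?u1 (apply_bcontfun \<gamma> 1)) (- 1 / N')"
        using tau \<gamma> by (auto intro!: add_increasing mult_right_mono)
    qed
    also have "\<dots> \<le> (\<integral>\<^sup>+ x. ennpowr (ac_density M (\<nu> t) x) (1 - 1 / N') \<partial>M)"
      using ent[OF t] by (simp add: renyi_entropy_def ereal_minus_le_minus less_eq_ennreal.rep_eq)
    finally show "ennreal (c * ?m1 powr (1 / N')) \<le> (\<integral>\<^sup>+ x. ennpowr (ac_density M (\<nu> t) x) (1 - 1 / N') \<partial>M)" .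
  qed
qed

text \<open>A Brunn-Minkowski inequality towards a small ball. The entropy integral of \<open>\<nu>\<^sub>t\<close> lies between
  \<open>c m(A1) powr (1 / N')\<close>, by the curvature-dimension condition, and \<open>m(S) powr (1 / N')\<close> for the
  annulus \<open>S\<close> on which \<open>\<nu>\<^sub>t\<close> concentrates.\<close>

lemma CD_contraction:
  fixes M :: "'a::polish_space measure"
  assumes M: "metric_measure_space M" and CD: "CD M k N" and N: "1 \<le> N'" "N \<le> N'"
    and t: "0 < t" "t < 1" and \<epsilon>: "0 < \<epsilon>" and b: "0 \<le> b" and c: "0 \<le> c"
    and A0: "0 < emeasure M (ball x\<^sub>0 \<epsilon>)" "emeasure M (ball x\<^sub>0 \<epsilon>) < \<infinity>"
    and A1: "A1 \<in> sets M" "emeasure M A1 < \<infinity>" "\<And>y. y \<in> A1 \<Longrightarrow> a \<le> dist x\<^sub>0 y \<and> dist x\<^sub>0 y \<le> b"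
    and S: "emeasure M {y. t * a - 3 * \<epsilon> \<le> dist x\<^sub>0 y \<and> dist x\<^sub>0 y \<le> t * b + 3 * \<epsilon>} < \<infinity>"
    and tau: "\<And>\<gamma>. \<gamma> \<in> geodesics \<Longrightarrow> dist x\<^sub>0 (apply_bcontfun \<gamma> 0) < \<epsilon> \<Longrightarrow> apply_bcontfun \<gamma> 1 \<in> A1 \<Longrightarrow>
        ennreal c \<le> tau N' (k_plus k \<gamma>) t (speed \<gamma>)"
  shows "c powr N' * measure M A1 \<le> measure M {y. t * a - 3 * \<epsilon> \<le> dist x\<^sub>0 y \<and> dist x\<^sub>0 y \<le> t * b + 3 * \<epsilon>}"
proof (cases "emeasure M A1 = 0")
  case True
  then show ?thesis by (simp add: measure_def)
next
  case False
  let ?S = "{y. t * a - 3 * \<epsilon> \<le> dist x\<^sub>0 y \<and> dist x\<^sub>0 y \<le> t * b + 3 * \<epsilon>}"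
  have sM: "sets M = sets borel" by (rule mms_sets[OF M])
  have bA1: "bounded A1" using A1(3) unfolding bounded_def by blast
  have pos: "0 < emeasure M A1" using False by (simp add: zero_less_iff_neq_zero)
  have ball: "ball x\<^sub>0 \<epsilon> \<in> sets M" using sM by simp
  let ?u0 = "uniform_measure M (ball x\<^sub>0 \<epsilon>)" and ?u1 = "uniform_measure M A1"
  obtain P :: "(real \<Rightarrow>\<^sub>C 'a) measure" and \<nu> where P: "W2_geodesic_ac M ?u0 ?u1 \<nu>"
    "\<forall>t\<in>{0..1}. \<forall>N'\<ge>N. \<forall>c\<ge>0. (\<forall>\<gamma>\<in>geodesics. apply_bcontfun \<gamma> 0 \<in> ball x\<^sub>0 \<epsilon> \<longrightarrow> apply_bcontfun \<gamma> 1 \<in> A1 \<longrightarrow>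
         ennreal c \<le> tau N' (k_plus k \<gamma>) t (speed \<gamma>)) \<longrightarrow>
       ennreal (c * measure M A1 powr (1 / N')) \<le> (\<integral>\<^sup>+ x. ennpowr (ac_density M (\<nu> t) x) (1 - 1 / N') \<partial>M)"
    by (rule CD_uniform[OF M CD ball A0 bounded_ball A1(1) pos A1(2) bA1]) (rule that, assumption+)
  have \<nu>: "\<nu> 0 = ?u0" "\<nu> 1 = ?u1" "\<nu> s \<in> P2_ac M"
     "s' \<in> {0..1} \<Longrightarrow> W2 (\<nu> s) (\<nu> s') = \<bar>s - s'\<bar> * W2 ?u0 ?u1" if "s \<in> {0..1}" for s s'
    using P(1) that by (auto simp: W2_geodesic_ac_def)
  have z: "\<nu> 0 = ?u0" "\<nu> 1 = ?u1" using \<nu>(1,2)[of 0] by auto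
  have P2: "\<nu> s \<in> P2" if "s \<in> {0..1}" for s using \<nu>(3)[OF that] by (simp add: P2_ac_def)
  have "AE y in \<nu> t. t * a - 3 * \<epsilon> \<le> dist x\<^sub>0 y \<and> dist x\<^sub>0 y \<le> t * b + 3 * \<epsilon>"
  proof (rule W2_intermediate_concentration)
    show "\<nu> 0 \<in> P2" "\<nu> t \<in> P2" "\<nu> 1 \<in> P2" using P2 t by auto
    show "W2 (\<nu> 0) (\<nu> t) = t * W2 (\<nu> 0) (\<nu> 1)" "W2 (\<nu> t) (\<nu> 1) = (1 - t) * W2 (\<nu> 0) (\<nu> 1)"
      using \<nu>(4)[of 0 t] \<nu>(4)[of t 1] \<nu>(1,2)[of 0] t by auto
    have "AE x in ?u0. x \<in> ball x\<^sub>0 \<epsilon>" using sM by (intro AE_uniform_measureI) auto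
    then show "AE x in \<nu> 0. dist x\<^sub>0 x < \<epsilon>" unfolding z mem_ball .
    have "AE x in ?u1. a \<le> dist x\<^sub>0 x \<and> dist x\<^sub>0 x \<le> b" using A1 by (intro AE_uniform_measureI) auto
    then show "AE x in \<nu> 1. a \<le> dist x\<^sub>0 x \<and> dist x\<^sub>0 x \<le> b" unfolding z .
  qed fact+
  then have ae: "AE y in \<nu> t. y \<in> ?S" by simp
  have mS: "?S \<in> sets M" unfolding sM by measurable
  let ?m1 = "measure M A1"
  have "ennreal (c * ?m1 powr (1 / N')) \<le> (\<integral>\<^sup>+ x. ennpowr (ac_density M (\<nu> t) x) (1 - 1 / N') \<partial>M)"
    by (rule P(2)[rule_format]) (use t N c tau in auto)
  also have "\<dots> \<le> ennreal (measure M ?S powr (1 / N'))"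
    using t by (intro entropy_integral_le[OF M \<nu>(3) N(1) mS S ae]) auto
  finally have "c * ?m1 powr (1 / N') \<le> measure M ?S powr (1 / N')" by simp
  then have "(c * ?m1 powr (1 / N')) powr N' \<le> (measure M ?S powr (1 / N')) powr N'"
    using c N by (intro powr_mono2) auto
  then show ?thesis using c N by (simp add: powr_mult powr_powr)
qed

text \<open>Transport between two small balls: almost every geodesic of the dynamical coupling will do.\<close>

lemma CD_geodesic_near:
  fixes M :: "'a::polish_space measure" and x y :: 'a
  assumes M: "metric_measure_space M" and supp: "msupport M = UNIV" and CD: "CD M k N" and \<epsilon>: "0 < \<epsilon>"
  obtains \<gamma> where "\<gamma> \<in> geodesics" "dist x (apply_bcontfun \<gamma> 0) < \<epsilon>" "dist y (apply_bcontfun \<gamma> 1) < \<epsilon>"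
proof -
  have small: "\<exists>r>0. r \<le> \<epsilon> \<and> 0 < emeasure M (ball x r) \<and> emeasure M (ball x r) < \<infinity>" for x
  proof -
    obtain r where r: "0 < r" "emeasure M (ball x r) < \<infinity>" using M by (auto simp: metric_measure_space_def)
    have "emeasure M (ball x (min r \<epsilon>)) \<le> emeasure M (ball x r)"
      using mms_sets[OF M] by (intro emeasure_mono) auto
    moreover have "0 < emeasure M (ball x (min r \<epsilon>))"
    proof -
      have "x \<in> msupport M" using supp by simp
      then show ?thesis using r(1) \<epsilon> by (auto simp: msupport_def)
    qed
    ultimately show ?thesis using r \<epsilon> by (intro exI[of _ "min r \<epsilon>"]) auto
  qed
  obtain r0 r1 where r: "r0 \<le> \<epsilon>" "0 < emeasure M (ball x r0)" "emeasure M (ball x r0) < \<infinity>"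
     "r1 \<le> \<epsilon>" "0 < emeasure M (ball y r1)" "emeasure M (ball y r1) < \<infinity>"
    using small[of x] small[of y] by blast
  have b: "ball x r0 \<in> sets M" "ball y r1 \<in> sets M" using mms_sets[OF M] by auto
  obtain P :: "(real \<Rightarrow>\<^sub>C 'a) measure" where P: "prob_space P"
    "AE \<gamma> in P. \<gamma> \<in> geodesics \<and> apply_bcontfun \<gamma> 0 \<in> ball x r0 \<and> apply_bcontfun \<gamma> 1 \<in> ball y r1"
    by (rule CD_uniform[OF M CD b(1) r(2,3) bounded_ball b(2) r(5,6) bounded_ball])
  interpret prob_space P by fact
  obtain \<gamma> where "\<gamma> \<in> geodesics" "apply_bcontfun \<gamma> 0 \<in> ball x r0" "apply_bcontfun \<gamma> 1 \<in> ball y r1"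
    using eventually_happens[OF P(2)] AE_False by (auto simp: trivial_limit_def)
  then show ?thesis using r by (intro that[of \<gamma>]) auto
qed

section \<open>Local compactness, properness and doubling\<close>

definition annulus :: "'a::metric_space \<Rightarrow> real \<Rightarrow> real \<Rightarrow> 'a set" where
  "annulus x a b = {y. a \<le> dist x y \<and> dist x y \<le> b}"

lemma closed_annulus: "closed (annulus x a b)"
proof -
  have "annulus x a b = cball x b - ball x a" by (auto simp: annulus_def)
  then show ?thesis by (simp add: closed_Diff)
qed

lemma annulus_subset_cball: "annulus x a b \<subseteq> cball x b"
  by (auto simp: annulus_def)

lemma mms_finite_mono:
  assumes "metric_measure_space M" "B \<in> sets M" "A \<subseteq> B" "emeasure M B < \<infinity>"
  shows "emeasure M A < \<infinity>"
  using assms emeasure_mono[of A B M] by (meson le_less_trans)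

lemma mms_ball_pos:
  assumes "msupport M = UNIV" "0 < r"
  shows "0 < emeasure M (ball x r)"
proof -
  have "x \<in> msupport M" using assms by simp
  then show ?thesis using assms(2) by (auto simp: msupport_def)
qed

text \<open>Continuity from above of the measure removes the margins that come from the radius of the small ball.\<close>

lemma annulus_outer_limit:
  fixes M :: "'a::polish_space measure"
  assumes M: "metric_measure_space M" and fin: "emeasure M (cball x (b + \<delta>)) < \<infinity>" and \<delta>: "0 < \<delta>"
    and le: "\<And>\<epsilon>. 0 < \<epsilon> \<Longrightarrow> \<epsilon> < \<epsilon>0 \<Longrightarrow> v \<le> measure M (annulus x (a - 3 * \<epsilon>) (b + 3 * \<epsilon>))" and \<epsilon>0: "0 < \<epsilon>0"
  shows "v \<le> measure M (annulus x a b)"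
proof -
  define e where "e n = min \<epsilon>0 \<delta> / (4 * real (Suc n))" for n
  have e: "0 < e n" "e n < \<epsilon>0" "3 * e n \<le> \<delta>" for n
  proof -
    have "e n \<le> min \<epsilon>0 \<delta> / 4" unfolding e_def using \<epsilon>0 \<delta> by (intro divide_left_mono) auto
    then show "e n < \<epsilon>0" "3 * e n \<le> \<delta>" using \<epsilon>0 \<delta> by linarith+
    show "0 < e n" using \<epsilon>0 \<delta> unfolding e_def by auto
  qed
  have e_dec: "e n \<le> e m" if "m \<le> n" for m n
    unfolding e_def using that \<epsilon>0 \<delta> by (intro divide_left_mono) auto
  have e_lim: "e \<longlonglongrightarrow> 0"
  proof -
    have "(\<lambda>n. (min \<epsilon>0 \<delta> / 4) * inverse (real (Suc n))) \<longlonglongrightarrow> (min \<epsilon>0 \<delta> / 4) * 0"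
      by (intro tendsto_intros LIMSEQ_inverse_real_of_nat)
    moreover have "e = (\<lambda>n. (min \<epsilon>0 \<delta> / 4) * inverse (real (Suc n)))" by (auto simp: e_def field_simps)
    ultimately show ?thesis by simp
  qed
  let ?A = "\<lambda>n. annulus x (a - 3 * e n) (b + 3 * e n)"
  have s: "sets M = sets borel" by (rule mms_sets[OF M])
  have "(\<lambda>n. measure M (?A n)) \<longlonglongrightarrow> measure M (\<Inter>n. ?A n)"
  proof (rule Lim_measure_decseq)
    show "range ?A \<subseteq> sets M" using s borel_closed[OF closed_annulus] by auto
    show "decseq ?A" unfolding decseq_def annulus_def using e_dec by (auto, smt+)
    show "emeasure M (?A i) \<noteq> \<infinity>" for i
    proof -
      have "?A i \<subseteq> cball x (b + \<delta>)" using e(3)[of i] by (auto simp: annulus_def)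
      then show ?thesis using mms_finite_mono[OF M _ _ fin, of "?A i"] s by (simp add: less_top)
    qed
  qed
  moreover have "(\<Inter>n. ?A n) = annulus x a b"
  proof (intro equalityI subsetI)
    fix y assume y: "y \<in> (\<Inter>n. ?A n)"
    then have 1: "a - 3 * e n \<le> dist x y" "dist x y \<le> b + 3 * e n" for n by (auto simp: annulus_def)
    have "(\<lambda>n. a - 3 * e n) \<longlonglongrightarrow> a - 3 * 0" "(\<lambda>n. b + 3 * e n) \<longlonglongrightarrow> b + 3 * 0"
      by (intro tendsto_intros e_lim)+
    then have "a \<le> dist x y" "dist x y \<le> b"
      using LIMSEQ_le_const2[of "\<lambda>n. a - 3 * e n" a "dist x y"] LIMSEQ_le_const[of "\<lambda>n. b + 3 * e n" b "dist x y"] 1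
      by auto
    then show "y \<in> annulus x a b" by (simp add: annulus_def)
  next
    fix y assume "y \<in> annulus x a b"
    then show "y \<in> (\<Inter>n. ?A n)" using e(1) unfolding annulus_def by (auto, smt+)
  qed
  ultimately show ?thesis
    using le e by (intro LIMSEQ_le_const[of "\<lambda>n. measure M (?A n)"]) auto
qed

lemma CD_annulus:
  fixes M :: "'a::polish_space measure"
  assumes M: "metric_measure_space M" "msupport M = UNIV" and CD: "CD M k N" and N: "1 \<le> N'" "N \<le> N'"
    and t: "0 < t" "t < 1" and \<epsilon>0: "0 < \<epsilon>0" and b: "0 \<le> b" and c: "0 \<le> c" and \<delta>: "0 < \<delta>"
    and fin: "emeasure M (cball x (t * b + \<delta>)) < \<infinity>"
    and A1: "A1 \<in> sets M" "emeasure M A1 < \<infinity>" "A1 \<subseteq> annulus x a b"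
    and tau: "\<And>\<gamma>. \<gamma> \<in> geodesics \<Longrightarrow> dist x (apply_bcontfun \<gamma> 0) < \<epsilon>0 \<Longrightarrow> apply_bcontfun \<gamma> 1 \<in> A1 \<Longrightarrow>
        ennreal c \<le> tau N' (k_plus k \<gamma>) t (speed \<gamma>)"
  shows "c powr N' * measure M A1 \<le> measure M (annulus x (t * a) (t * b))"
proof (rule annulus_outer_limit[OF M(1) fin \<delta>])
  show "0 < min \<epsilon>0 (\<delta> / 3)" using \<epsilon>0 \<delta> by simp
  fix \<epsilon> assume \<epsilon>: "0 < \<epsilon>" "\<epsilon> < min \<epsilon>0 (\<delta> / 3)"
  have s: "sets M = sets borel" by (rule mms_sets[OF M(1)])
  have "0 \<le> t * b" using t b by simp
  have "ball x \<epsilon> \<subseteq> cball x (t * b + \<delta>)" using \<epsilon> \<open>0 \<le> t * b\<close> by auto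
  then have f1: "emeasure M (ball x \<epsilon>) < \<infinity>" using mms_finite_mono[OF M(1) _ _ fin] s by auto
  have "annulus x (t * a - 3 * \<epsilon>) (t * b + 3 * \<epsilon>) \<subseteq> cball x (t * b + \<delta>)" using \<epsilon> by (auto simp: annulus_def)
  then have f2: "emeasure M (annulus x (t * a - 3 * \<epsilon>) (t * b + 3 * \<epsilon>)) < \<infinity>" using mms_finite_mono[OF M(1) _ _ fin] s by auto
  show "c powr N' * measure M A1 \<le> measure M (annulus x (t * a - 3 * \<epsilon>) (t * b + 3 * \<epsilon>))"
    unfolding annulus_def
  proof (rule CD_contraction[OF M(1) CD N t \<epsilon>(1) b c mms_ball_pos[OF M(2) \<epsilon>(1)] f1 A1(1,2)])
    show "a \<le> dist x y \<and> dist x y \<le> b" if "y \<in> A1" for y using that A1(3) by (auto simp: annulus_def)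
    show "ennreal c \<le> tau N' (k_plus k \<gamma>) t (speed \<gamma>)"
      if "\<gamma> \<in> geodesics" "dist x (apply_bcontfun \<gamma> 0) < \<epsilon>" "apply_bcontfun \<gamma> 1 \<in> A1" for \<gamma>
      using tau that \<epsilon> by auto
  qed (use f2[unfolded annulus_def] in assumption)
qed

lemma geodesic_dist:
  assumes "\<gamma> \<in> geodesics" "s \<in> {0..1}" "t \<in> {0..1}"
  shows "dist (apply_bcontfun \<gamma> s) (apply_bcontfun \<gamma> t) = \<bar>s - t\<bar> * speed \<gamma>"
  using assms unfolding geodesics_def speed_def mem_Collect_eq by blast

text \<open>A geodesic from a point near the centre to a point of the ball of radius \<open>b\<close> stays in the ball of
  radius \<open>b + \<epsilon>\<close>. Thus only the curvature in that ball matters.\<close>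

lemma geodesic_bounds:
  assumes \<gamma>: "\<gamma> \<in> geodesics" and 0: "dist x (apply_bcontfun \<gamma> 0) < \<epsilon>"
    and 1: "a \<le> dist x (apply_bcontfun \<gamma> 1)" "dist x (apply_bcontfun \<gamma> 1) \<le> b"
  shows "a - \<epsilon> < speed \<gamma>" "speed \<gamma> < b + \<epsilon>" "0 \<le> speed \<gamma>"
    and "\<And>s. s \<in> {0..speed \<gamma>} \<Longrightarrow> dist x (unit_speed \<gamma> s) < b + \<epsilon>"
proof -
  let ?g = "apply_bcontfun \<gamma>"
  show L: "a - \<epsilon> < speed \<gamma>" "speed \<gamma> < b + \<epsilon>" "0 \<le> speed \<gamma>"
    using 0 1 dist_triangle[of x "?g 1" "?g 0"] dist_triangle3[of "?g 0" "?g 1" x]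
    unfolding speed_def by auto
  fix s assume s: "s \<in> {0..speed \<gamma>}"
  define p where "p = s / speed \<gamma>"
  have p: "p \<in> {0..1}" using s unfolding p_def by (auto simp: divide_le_eq_1)
  have "dist (?g 0) (?g p) = p * speed \<gamma>" "dist (?g p) (?g 1) = (1 - p) * speed \<gamma>"
    using geodesic_dist[OF \<gamma>, of 0 p] geodesic_dist[OF \<gamma>, of p 1] p by auto
  then have "dist x (?g p) < \<epsilon> + p * speed \<gamma>" "dist x (?g p) \<le> b + (1 - p) * speed \<gamma>"
    using 0 1 dist_triangle[of x "?g p" "?g 0"] dist_triangle[of x "?g p" "?g 1"] by (auto simp: dist_commute)
  \<comment> \<open>Averaging the bounds obtained from the two end points.\<close>
  then have "2 * dist x (?g p) < \<epsilon> + b + speed \<gamma>" by (simp add: algebra_simps)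
  then show "dist x (unit_speed \<gamma> s) < b + \<epsilon>" using L unfolding unit_speed_def p_def by linarith
qed

text \<open>By the mean value theorem \<open>s \<le> sn K s \<le> s cs K \<Theta>\<close> for negative \<open>K\<close> and \<open>s\<close> up to \<open>\<Theta>\<close>.\<close>

lemma sn_ratio_ge:
  assumes K: "K < 0" and t: "0 < t" "t \<le> 1" and \<theta>: "0 < \<theta>" "\<theta> \<le> \<Theta>"
  shows "t / cs K \<Theta> \<le> sn K (t * \<theta>) / sn K \<theta>"
proof -
  have c1: "1 \<le> cs K s" for s using K by (simp add: cs_def cosh_real_ge_1)
  have "\<exists>z>0. z < s \<and> sn K s - sn K 0 = (s - 0) * cs K z" if "0 < s" for s
    using MVT2[OF that, of "sn K" "cs K"] DERIV_sn by auto
  then have mv: "\<exists>z>0. z < s \<and> sn K s = s * cs K z" if "0 < s" for s using that by simp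
  have t\<theta>: "0 < t * \<theta>" using t \<theta> by simp
  obtain z where "sn K (t * \<theta>) = t * \<theta> * cs K z" using mv[OF t\<theta>] by blast
  then have 1: "t * \<theta> \<le> sn K (t * \<theta>)" using c1[of z] t\<theta> by (simp add: mult_le_cancel_left1)
  obtain z where z: "0 < z" "z < \<theta>" "sn K \<theta> = \<theta> * cs K z" using mv[OF \<theta>(1)] by blast
  have "cs K z \<le> cs K \<Theta>" using z \<theta> K by (simp add: cs_def cosh_real_nonneg_le_iff)
  then have 2: "sn K \<theta> \<le> \<theta> * cs K \<Theta>" using z \<theta> by simp
  have 3: "0 < sn K \<theta>" using z \<theta> c1[of z] by simp
  have "t / cs K \<Theta> = (t * \<theta>) / (\<theta> * cs K \<Theta>)" using \<theta> by simp
  also have "\<dots> \<le> sn K (t * \<theta>) / sn K \<theta>"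
    using 1 2 3 t\<theta> by (intro frac_le) auto
  finally show ?thesis .
qed

text \<open>With a lower curvature bound, \<open>\<tau>\<close> stays away from zero on bounded lengths, including length zero.\<close>

lemma tau_uniform_lower_bound:
  assumes N: "1 < N" and t: "0 < t" "t \<le> 1" and C: "0 < C"
  shows "\<exists>c>0. \<forall>\<kappa> \<theta>. 0 \<le> \<theta> \<longrightarrow> \<theta> \<le> \<Theta> \<longrightarrow> (\<forall>s\<in>{0..\<theta>}. - C \<le> \<kappa> s) \<longrightarrow> ennreal c \<le> tau N \<kappa> t \<theta>"
proof -
  define K where "K = - C / (N - 1)"
  have K: "K < 0" "K * (N - 1) = - C" using C N by (auto simp: K_def)
  define q where "q = t / cs K \<Theta>"
  have c1: "1 \<le> cs K \<Theta>" using K by (simp add: cs_def cosh_real_ge_1)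
  have q: "0 < q" "q \<le> t" using t c1 unfolding q_def by (auto simp: divide_le_eq mult_le_cancel_left1)
  define c where "c = (t * q powr (N - 1)) powr (1 / N)"
  show ?thesis
  proof (intro exI[of _ c] conjI allI impI)
    show "0 < c" using t q by (simp add: c_def)
    fix \<kappa> :: "real \<Rightarrow> real" and \<theta> :: real assume \<theta>: "0 \<le> \<theta>" "\<theta> \<le> \<Theta>" and \<kappa>: "\<forall>s\<in>{0..\<theta>}. - C \<le> \<kappa> s"
    show "ennreal c \<le> tau N \<kappa> t \<theta>"
    proof (cases "\<theta> = 0")
      case True
      have "c \<le> (t * t powr (N - 1)) powr (1 / N)"
        unfolding c_def using t q N by (intro powr_mono2 mult_left_mono) auto
      also have "\<dots> = t powr (1 / N) * t powr ((N - 1) / N)"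
        using t by (simp add: powr_mult powr_powr)
      finally show ?thesis using True N t
        by (auto simp: tau_def sigma_def ennpowr_ennreal ennreal_mult[symmetric] intro!: ennreal_leI)
    next
      case False
      then have \<theta>0: "0 < \<theta>" using \<theta> by simp
      then have p: "0 < sn K (t * \<theta>)" "0 < sn K \<theta>" using K t by (auto intro!: sn_pos)
      have "q powr (N - 1) \<le> (sn K (t * \<theta>) / sn K \<theta>) powr (N - 1)"
        unfolding q_def using sn_ratio_ge[OF K(1) t \<theta>0 \<theta>(2)] q N by (intro powr_mono2) (auto simp: q_def)
      also have "\<dots> = sn K (t * \<theta>) powr (N - 1) / sn K \<theta> powr (N - 1)"
        using p by (simp add: powr_divide)
      finally have "c \<le> (t * (sn K (t * \<theta>) powr (N - 1) / sn K \<theta> powr (N - 1))) powr (1 / N)"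
        unfolding c_def using t q N by (intro powr_mono2 mult_left_mono) auto
      then have "ennreal c \<le> ennreal ((t * (sn K (t * \<theta>) powr (N - 1) / sn K \<theta> powr (N - 1))) powr (1 / N))"
        by (rule ennreal_leI)
      also have "\<dots> \<le> tau N \<kappa> t \<theta>"
        using \<kappa> by (intro tau_ge N t \<theta>0 p) (auto simp: K)
      finally show ?thesis .
    qed
  qed
qed

text \<open>The case of a full ball, \<open>a = 0\<close>. The constant depends only on the curvature bound and on the range of
  radii, and serves both for total boundedness and for doubling. Passing to a dimension bound of at
  least \<open>2\<close> removes the special role of \<open>N = 1\<close>.\<close>

lemma ball_shrink_comparison:
  fixes M :: "'a::polish_space measure"
  assumes M: "metric_measure_space M" "msupport M = UNIV" and CD: "CD M k N" and N: "1 \<le> N"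
    and t: "0 < t" "t < 1" and C: "0 < C"
  shows "\<exists>c>0. \<forall>x R. 0 < R \<longrightarrow> 2 * R \<le> \<Theta> \<longrightarrow> (\<forall>y\<in>ball x (2 * R). - C \<le> k y) \<longrightarrow>
       emeasure M (ball x (2 * R)) < \<infinity> \<longrightarrow> c * measure M (ball x R) \<le> measure M (cball x (t * R))"
proof -
  define N' where "N' = max N 2"
  have N': "1 < N'" "1 \<le> N'" "N \<le> N'" by (auto simp: N'_def)
  obtain c where c: "0 < c"
    "\<forall>\<kappa> \<theta>. 0 \<le> \<theta> \<longrightarrow> \<theta> \<le> \<Theta> \<longrightarrow> (\<forall>s\<in>{0..\<theta>}. - C \<le> \<kappa> s) \<longrightarrow> ennreal c \<le> tau N' \<kappa> t \<theta>"
    using tau_uniform_lower_bound[OF N'(1) t(1) less_imp_le[OF t(2)] C, of \<Theta>] by (elim exE conjE)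
  show ?thesis
  proof (intro exI[of _ "c powr N'"] conjI allI impI)
    show "0 < c powr N'" using c by simp
    fix x R assume R: "0 < R" "2 * R \<le> \<Theta>" and k: "\<forall>y\<in>ball x (2 * R). - C \<le> k y"
      and fin: "emeasure M (ball x (2 * R)) < \<infinity>"
    have s: "sets M = sets borel" by (rule mms_sets[OF M(1)])
    have "t * R < R" using t R by simp
    define \<delta> where "\<delta> = R / 2"
    have "c powr N' * measure M (ball x R) \<le> measure M (annulus x (t * 0) (t * R))"
    proof (rule CD_annulus[OF M CD N'(2,3) t])
      show "0 < R" "0 \<le> R" "0 \<le> c" "0 < \<delta>" using R c by (auto simp: \<delta>_def)
      show "emeasure M (cball x (t * R + \<delta>)) < \<infinity>"
      proof (rule mms_finite_mono[OF M(1) _ _ fin])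
        have "t * R + \<delta> < 2 * R" using \<open>t * R < R\<close> R unfolding \<delta>_def by linarith
        then show "cball x (t * R + \<delta>) \<subseteq> ball x (2 * R)" by force
      qed (use s in simp)
      show "ball x R \<in> sets M" using s by simp
      show "emeasure M (ball x R) < \<infinity>"
        by (rule mms_finite_mono[OF M(1) _ _ fin]) (use s R in auto)
      show "ball x R \<subseteq> annulus x 0 R" by (auto simp: annulus_def)
      fix \<gamma> assume \<gamma>: "\<gamma> \<in> geodesics" "dist x (apply_bcontfun \<gamma> 0) < R" "apply_bcontfun \<gamma> 1 \<in> ball x R"
      then have 1: "0 \<le> dist x (apply_bcontfun \<gamma> 1)" "dist x (apply_bcontfun \<gamma> 1) \<le> R" by auto
      note g = geodesic_bounds[OF \<gamma>(1,2) 1]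
      show "ennreal c \<le> tau N' (k_plus k \<gamma>) t (speed \<gamma>)"
      proof (rule c(2)[rule_format])
        show "0 \<le> speed \<gamma>" "speed \<gamma> \<le> \<Theta>" using g(2,3) R by auto
        show "- C \<le> k_plus k \<gamma> s" if "s \<in> {0..speed \<gamma>}" for s
          unfolding k_plus_def using g(4)[OF that] by (intro bspec[OF k]) simp
      qed
    qed
    moreover have "annulus x (t * 0) (t * R) = cball x (t * R)" by (auto simp: annulus_def)
    ultimately show "c powr N' * measure M (ball x R) \<le> measure M (cball x (t * R))" by simp
  qed
qed

text \<open>A separated set with the largest number of elements is a net.\<close>

lemma separated_card_bound_cover:
  fixes S :: "'a::metric_space set"
  assumes B: "\<And>T. finite T \<Longrightarrow> T \<subseteq> S \<Longrightarrow> (\<And>x y. x \<in> T \<Longrightarrow> y \<in> T \<Longrightarrow> x \<noteq> y \<Longrightarrow> \<delta> \<le> dist x y) \<Longrightarrow> card T \<le> B"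
    and \<delta>: "0 < \<delta>"
  obtains T where "finite T" "S \<subseteq> (\<Union>x\<in>T. ball x \<delta>)"
proof -
  let ?P = "\<lambda>T. finite T \<and> T \<subseteq> S \<and> (\<forall>x\<in>T. \<forall>y\<in>T. x \<noteq> y \<longrightarrow> \<delta> \<le> dist x y)"
  have "\<exists>T. ?P T \<and> (\<forall>T'. ?P T' \<longrightarrow> card T' \<le> card T)"
    by (rule ex_has_greatest_nat[of ?P "{}" card "Suc B"]) (use B in \<open>auto simp: less_Suc_eq_le\<close>)
  then obtain T where T0: "?P T \<and> (\<forall>T'. ?P T' \<longrightarrow> card T' \<le> card T)" ..
  have T: "?P T" by (rule conjunct1[OF T0])
  have Tmax: "card T' \<le> card T" if "?P T'" for T'
    by (rule mp[OF spec[OF conjunct2[OF T0]] that])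
  have "\<exists>x\<in>T. y \<in> ball x \<delta>" if y: "y \<in> S" for y
  proof (rule ccontr)
    assume n: "\<not> (\<exists>x\<in>T. y \<in> ball x \<delta>)"
    then have "y \<notin> T" using \<delta> by auto
    have "?P (insert y T)" using T n y by (auto simp: not_less dist_commute)
    then have "card (insert y T) \<le> card T" by (rule Tmax)
    then show False using \<open>y \<notin> T\<close> T by simp
  qed
  then show ?thesis using T by (intro that[of T]) auto
qed

text \<open>Packing: balls about the points of a separated set are disjoint, lie in a fixed ball of finite
  measure, and have measure bounded below by \<open>ball_shrink_comparison\<close>.\<close>

lemma CD_locally_compact:
  fixes M :: "'a::polish_space measure" and x0 :: 'a
  assumes M: "metric_measure_space M" "msupport M = UNIV" and CD: "CD M k N" and N: "1 \<le> N"
    and k: "admissible_curv k"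
  shows "\<exists>\<rho>>0. compact (cball x0 \<rho>)"
proof -
  have s: "sets M = sets borel" by (rule mms_sets[OF M(1)])
  obtain r1 c1 where r1: "0 < r1" "\<And>y. y \<in> ball x0 r1 \<Longrightarrow> c1 \<le> k y"
    using k unfolding admissible_curv_def by blast
  obtain r2 where r2: "0 < r2" "emeasure M (ball x0 r2) < \<infinity>" using M(1) by (auto simp: metric_measure_space_def)
  \<comment> \<open>For \<open>x\<close> within \<open>\<rho>\<close> of \<open>x0\<close>, the ball of radius \<open>2\<rho>\<close> about \<open>x\<close> contains the one of radius \<open>\<rho>\<close> about
    \<open>x0\<close>, and the ball of radius \<open>4\<rho>\<close>, on which curvature is to be controlled, lies within \<open>8\<rho>\<close>.\<close>
  define \<rho> where "\<rho> = min r1 r2 / 8"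
  have \<rho>: "0 < \<rho>" "8 * \<rho> \<le> r1" "8 * \<rho> \<le> r2" using r1 r2 by (auto simp: \<rho>_def)
  define C where "C = max 1 (- c1)"
  have C: "0 < C" "- C \<le> c1" by (auto simp: C_def)
  have fin: "emeasure M (ball x0 (8 * \<rho>)) < \<infinity>"
    by (rule mms_finite_mono[OF M(1) _ _ r2(2)]) (use s \<rho> in auto)
  have "\<exists>T. finite T \<and> cball x0 \<rho> \<subseteq> (\<Union>x\<in>T. ball x \<delta>)" if \<delta>: "0 < \<delta>" for \<delta>
  proof -
    define t where "t = min (1/2) (\<delta> / (8 * \<rho>))"
    have t: "0 < t" "t < 1" "t * (2 * \<rho>) \<le> \<delta> / 4" "t * (2 * \<rho>) \<le> \<rho>"
    proof -
      have "t \<le> \<delta> / (8 * \<rho>)" by (simp add: t_def)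
      then show "t * (2 * \<rho>) \<le> \<delta> / 4" using \<rho> by (simp add: field_simps)
      have "t \<le> 1/2" by (simp add: t_def)
      then show "t * (2 * \<rho>) \<le> \<rho>" using \<rho> by (simp add: field_simps)
    qed (use \<rho> \<delta> in \<open>auto simp: t_def\<close>)
    obtain c where c: "0 < c" "\<forall>x R. 0 < R \<longrightarrow> 2 * R \<le> 4 * \<rho> \<longrightarrow> (\<forall>y\<in>ball x (2 * R). - C \<le> k y) \<longrightarrow>
       emeasure M (ball x (2 * R)) < \<infinity> \<longrightarrow> c * measure M (ball x R) \<le> measure M (cball x (t * R))"
      using ball_shrink_comparison[OF M CD N t(1,2) C(1), of "4 * \<rho>"] by (elim exE conjE)
    define m0 where "m0 = c * measure M (ball x0 \<rho>)"
    have fin1: "emeasure M A < \<infinity>" if "A \<subseteq> ball x0 (8 * \<rho>)" for A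
      by (rule mms_finite_mono[OF M(1) _ that fin]) (use s in auto)
    have "emeasure M (ball x0 \<rho>) = ennreal (measure M (ball x0 \<rho>))"
      using fin1[of "ball x0 \<rho>", OF subset_ball] \<rho> by (intro emeasure_eq_ennreal_measure) auto
    then have m0: "0 < m0" using mms_ball_pos[OF M(2) \<rho>(1), of x0] c by (simp add: m0_def)
    have meas: "m0 \<le> measure M (cball x (t * (2 * \<rho>)))" and sub: "cball x (t * (2 * \<rho>)) \<subseteq> ball x0 (8 * \<rho>)"
      if x: "x \<in> cball x0 \<rho>" for x
    proof -
      have b: "ball x (2 * (2 * \<rho>)) \<subseteq> ball x0 (8 * \<rho>)"
      proof
        fix y assume "y \<in> ball x (2 * (2 * \<rho>))"
        then show "y \<in> ball x0 (8 * \<rho>)" using x \<rho> dist_triangle[of x0 y x] by auto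
      qed
      show "cball x (t * (2 * \<rho>)) \<subseteq> ball x0 (8 * \<rho>)"
      proof
        fix y assume "y \<in> cball x (t * (2 * \<rho>))"
        then have "dist x y \<le> t * (2 * \<rho>)" by simp
        then show "y \<in> ball x0 (8 * \<rho>)" using x \<rho> t(4) dist_triangle[of x0 y x] unfolding mem_ball mem_cball by linarith
      qed
      have "c * measure M (ball x (2 * \<rho>)) \<le> measure M (cball x (t * (2 * \<rho>)))"
      proof (rule c(2)[rule_format])
        fix y assume "y \<in> ball x (2 * (2 * \<rho>))"
        then have "y \<in> ball x0 r1" using b \<rho> by auto
        then show "- C \<le> k y" using r1(2)[of y] C by linarith
      qed (use \<rho> fin1[OF b] in auto)
      moreover have "measure M (ball x0 \<rho>) \<le> measure M (ball x (2 * \<rho>))"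
      proof (rule measure_mono_fmeasurable)
        show "ball x0 \<rho> \<subseteq> ball x (2 * \<rho>)"
        proof
          fix y assume "y \<in> ball x0 \<rho>"
          then show "y \<in> ball x (2 * \<rho>)" using x dist_triangle[of x y x0] by (auto simp: dist_commute)
        qed
        have "ball x (2 * \<rho>) \<subseteq> ball x (2 * (2 * \<rho>))" using \<rho> by auto
        then show "ball x (2 * \<rho>) \<in> fmeasurable M" using fin1 b s by (intro fmeasurableI) auto
      qed (use s in auto)
      ultimately show "m0 \<le> measure M (cball x (t * (2 * \<rho>)))"
        unfolding m0_def using c(1) by (meson mult_le_cancel_left_pos order_trans)
    qed
    define V where "V = measure M (ball x0 (8 * \<rho>))"
    define B where "B = nat \<lfloor>V / m0\<rfloor>"
    have "card T \<le> B"
      if T: "finite T" "T \<subseteq> cball x0 \<rho>" "\<And>x y. x \<in> T \<Longrightarrow> y \<in> T \<Longrightarrow> x \<noteq> y \<Longrightarrow> \<delta> \<le> dist x y" for T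
    proof -
      have "real (card T) * m0 = (\<Sum>x\<in>T. m0)" by simp
      also have "\<dots> \<le> (\<Sum>x\<in>T. measure M (cball x (t * (2 * \<rho>))))"
        using T(2) meas by (intro sum_mono) auto
      also have "\<dots> = measure M (\<Union>x\<in>T. cball x (t * (2 * \<rho>)))"
      proof (rule measure_finite_Union[symmetric, OF T(1)])
        show "disjoint_family_on (\<lambda>x. cball x (t * (2 * \<rho>))) T"
          unfolding disjoint_family_on_def
        proof (intro ballI impI, rule ccontr)
          fix x y assume xy: "x \<in> T" "y \<in> T" "x \<noteq> y" "cball x (t * (2 * \<rho>)) \<inter> cball y (t * (2 * \<rho>)) \<noteq> {}"
          then obtain z where "dist x z \<le> t * (2 * \<rho>)" "dist y z \<le> t * (2 * \<rho>)" by auto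
          then have "dist x z \<le> \<delta> / 4" "dist y z \<le> \<delta> / 4" using t(3) by linarith+
          then show False using T(3)[OF xy(1-3)] \<delta> dist_triangle2[of x y z] by linarith
        qed
        show "emeasure M (cball x (t * (2 * \<rho>))) \<noteq> \<infinity>" if "x \<in> T" for x
          using fin1[OF sub] that T(2) by (auto simp: less_top)
      qed (simp add: s image_subset_iff)
      also have "\<dots> \<le> V"
        unfolding V_def
      proof (rule measure_mono_fmeasurable)
        show "(\<Union>x\<in>T. cball x (t * (2 * \<rho>))) \<subseteq> ball x0 (8 * \<rho>)" using sub T(2) by blast
        show "(\<Union>x\<in>T. cball x (t * (2 * \<rho>))) \<in> sets M"
          by (rule sets.finite_UN[OF T(1)]) (simp add: s)
        show "ball x0 (8 * \<rho>) \<in> fmeasurable M" by (rule fmeasurableI[OF _ fin]) (simp add: s)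
      qed
      finally have "real (card T) \<le> V / m0" using m0 by (simp add: field_simps)
      then show ?thesis unfolding B_def by (simp add: le_nat_floor)
    qed
    then show ?thesis using separated_card_bound_cover[of "cball x0 \<rho>" \<delta> B] \<delta> by metis
  qed
  then have "compact (cball x0 \<rho>)"
    unfolding compact_eq_totally_bounded by (auto simp: complete_eq_closed)
  then show ?thesis using \<rho>(1) by blast
qed

text \<open>Geodesics between points near to given ones suffice for the Hopf-Rinow-Cohn-Vossen theorem. At the
  supremum \<open>\<rho>\<close> of the radii of compact balls about \<open>x\<close>, the closed ball is still totally bounded,
  since its points are near a smaller compact ball; being compact, it has a compact neighbourhood
  that contains a larger ball.\<close>

lemma Hopf_Rinow:
  fixes x :: "'a::complete_space"
  assumes lc: "\<And>x::'a. \<exists>\<rho>>0. compact (cball x \<rho>)"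
    and geo: "\<And>(x::'a) y \<epsilon>. 0 < \<epsilon> \<Longrightarrow> \<exists>\<gamma>\<in>geodesics. dist x (apply_bcontfun \<gamma> 0) < \<epsilon> \<and> dist y (apply_bcontfun \<gamma> 1) < \<epsilon>"
  shows "compact (cball x r)"
proof (rule ccontr)
  assume nc: "\<not> compact (cball x r)"
  \<comment> \<open>The length structure is used only in this form: a point of a ball is near a smaller ball.\<close>
  have L: "\<exists>z. dist x z \<le> R - \<eta> \<and> dist z y \<le> 2 * \<eta>" if R: "dist x y \<le> R" "0 < \<eta>" "2 * \<eta> \<le> R" for y R \<eta>
  proof -
    obtain \<gamma> where \<gamma>: "\<gamma> \<in> geodesics" "dist x (apply_bcontfun \<gamma> 0) < \<eta> / 4" "dist y (apply_bcontfun \<gamma> 1) < \<eta> / 4"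
      using geo[of "\<eta> / 4" x y] R by auto
    let ?g = "apply_bcontfun \<gamma>"
    define l where "l = speed \<gamma>"
    have l: "l \<le> R + \<eta> / 2" "0 \<le> l"
    proof -
      have "dist (?g 0) (?g 1) \<le> dist (?g 0) x + dist x y + dist y (?g 1)"
        using dist_triangle[of "?g 0" "?g 1" x] dist_triangle[of x "?g 1" y] by linarith
      then show "l \<le> R + \<eta> / 2" unfolding l_def speed_def using \<gamma> R by (simp add: dist_commute)
    qed (simp add: l_def speed_def)
    define p where "p = (if l \<le> R - \<eta> - \<eta> / 4 then 1 else (R - \<eta> - \<eta> / 4) / l)"
    have p: "p \<in> {0..1}" "p * l \<le> R - \<eta> - \<eta> / 4" "(1 - p) * l \<le> \<eta> + 3 * \<eta> / 4"
    proof -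
      consider "l \<le> R - \<eta> - \<eta> / 4" "p = 1" | "0 < l" "R - \<eta> - \<eta> / 4 < l" "p * l = R - \<eta> - \<eta> / 4"
        using R unfolding p_def by (cases "l \<le> R - \<eta> - \<eta> / 4") auto
      then have "p \<in> {0..1} \<and> p * l \<le> R - \<eta> - \<eta> / 4 \<and> l - p * l \<le> \<eta> + 3 * \<eta> / 4"
      proof cases
        case 1 then show ?thesis using R by auto
      next
        case 2
        have "p = (R - \<eta> - \<eta> / 4) / l" using 2 by (simp add: eq_divide_eq)
        then show ?thesis using 2 l R by (auto simp: divide_le_eq)
      qed
      then show "p \<in> {0..1}" "p * l \<le> R - \<eta> - \<eta> / 4" "(1 - p) * l \<le> \<eta> + 3 * \<eta> / 4"
        by (auto simp: left_diff_distrib)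
    qed
    have "dist (?g 0) (?g p) = p * l" "dist (?g p) (?g 1) = (1 - p) * l"
      using geodesic_dist[OF \<gamma>(1), of 0 p] geodesic_dist[OF \<gamma>(1), of p 1] p(1) by (auto simp: l_def)
    then have "dist x (?g p) \<le> R - \<eta>" "dist (?g p) y \<le> 2 * \<eta>"
      using p \<gamma> dist_triangle[of x "?g p" "?g 0"] dist_triangle[of "?g p" y "?g 1"] by (auto simp: dist_commute)
    then show ?thesis by blast
  qed
  define S where "S = {r. \<not> compact (cball x r)}"
  obtain \<rho>0 where \<rho>0: "0 < \<rho>0" "compact (cball x \<rho>0)" using lc by blast
  have mono: "compact (cball x r')" if "compact (cball x r)" "r' \<le> r" for r r'
    using compact_Int_closed[OF that(1) closed_cball[of x r']] that(2)
    by (metis inf.absorb_iff2 subset_cball)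
  have S0: "\<rho>0 \<le> r" if "r \<in> S" for r
    using that mono[OF \<rho>0(2), of r] unfolding S_def by (metis linear mem_Collect_eq)
  have Sne: "S \<noteq> {}" using nc by (auto simp: S_def)
  have bdd: "bdd_below S" using S0 by (auto simp: bdd_below_def)
  define \<rho> where "\<rho> = Inf S"
  have \<rho>: "0 < \<rho>" using \<rho>0(1) cInf_greatest[OF Sne S0] by (simp add: \<rho>_def)
  have below: "compact (cball x r)" if "r < \<rho>" for r
    using that cInf_lower[OF _ bdd, of r] by (force simp: S_def \<rho>_def)
  have tb: "\<exists>T. finite T \<and> cball x \<rho> \<subseteq> (\<Union>x\<in>T. ball x e)" if e: "0 < e" for e
  proof -
    define \<eta> where "\<eta> = min (e / 4) (\<rho> / 2)"
    have \<eta>: "0 < \<eta>" "2 * \<eta> \<le> e / 2" "2 * \<eta> \<le> \<rho>" using e \<rho> by (auto simp: \<eta>_def)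
    have "compact (cball x (\<rho> - \<eta>))" using \<eta> by (intro below) simp
    then obtain T where T: "finite T" "cball x (\<rho> - \<eta>) \<subseteq> (\<Union>x\<in>T. ball x (e / 2))"
      unfolding compact_eq_totally_bounded using e half_gt_zero by blast
    have "cball x \<rho> \<subseteq> (\<Union>x\<in>T. ball x e)"
    proof
      fix y assume "y \<in> cball x \<rho>"
      then obtain z where z: "dist x z \<le> \<rho> - \<eta>" "dist z y \<le> 2 * \<eta>" using L[of y \<rho> \<eta>] \<eta> by auto
      then obtain w where w: "w \<in> T" "dist w z < e / 2" using T(2) by force
      then have "dist w y < e" using z \<eta> dist_triangle[of w y z] by linarith
      then show "y \<in> (\<Union>x\<in>T. ball x e)" using w by auto
    qed
    then show ?thesis using T(1) by blast
  qed
  have c\<rho>: "compact (cball x \<rho>)"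
    unfolding compact_eq_totally_bounded using tb by (auto simp: complete_eq_closed)
  obtain d where d: "\<And>z::'a. 0 < d z" "\<And>z. compact (cball z (d z))" using lc by metis
  obtain T where T: "T \<subseteq> cball x \<rho>" "finite T" "cball x \<rho> \<subseteq> (\<Union>z\<in>T. ball z (d z))"
    by (rule compactE_image[OF c\<rho>, of "cball x \<rho>" "\<lambda>z. ball z (d z)"]) (use d(1) in auto)
  let ?U = "\<Union>z\<in>T. ball z (d z)"
  obtain e where e: "0 < e" "\<And>z. z \<in> cball x \<rho> \<Longrightarrow> \<exists>G\<in>{?U}. ball z e \<subseteq> G"
    by (rule Heine_Borel_lemma[OF c\<rho>, of "{?U}"]) (use T(3) in auto)
  define \<eta> where "\<eta> = min (e / 4) \<rho>"
  have \<eta>: "0 < \<eta>" "2 * \<eta> < e" "\<eta> \<le> \<rho>" using e(1) \<rho> by (auto simp: \<eta>_def)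
  have sub: "cball x (\<rho> + \<eta>) \<subseteq> (\<Union>z\<in>T. cball z (d z))"
  proof
    fix y assume "y \<in> cball x (\<rho> + \<eta>)"
    then obtain z where z: "dist x z \<le> \<rho>" "dist z y \<le> 2 * \<eta>" using L[of y "\<rho> + \<eta>" \<eta>] \<eta> by auto
    then have "y \<in> ball z e" using \<eta> by auto
    moreover have "ball z e \<subseteq> ?U" using e(2)[of z] z(1) by auto
    ultimately show "y \<in> (\<Union>z\<in>T. cball z (d z))" using ball_subset_cball by blast
  qed
  have "compact (\<Union>z\<in>T. cball z (d z))" using T(2) d(2) by (intro compact_UN) auto
  then have c2: "compact (cball x (\<rho> + \<eta>))"
    using compact_Int_closed[OF _ closed_cball[of x "\<rho> + \<eta>"]] sub by (metis inf.absorb_iff2)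
  have "\<rho> + \<eta> \<le> Inf S"
  proof (rule cInf_greatest[OF Sne])
    fix r assume "r \<in> S"
    then show "\<rho> + \<eta> \<le> r" using mono[OF c2, of r] unfolding S_def by (metis linear mem_Collect_eq)
  qed
  then show False using \<eta> by (simp add: \<rho>_def)
qed

lemma CD_proper:
  fixes M :: "'a::polish_space measure" and x :: 'a
  assumes M: "metric_measure_space M" "msupport M = UNIV" and CD: "CD M k N" and N: "1 \<le> N"
    and k: "admissible_curv k"
  shows "compact (cball x r)"
proof (rule Hopf_Rinow)
  show "\<exists>\<rho>>0. compact (cball x \<rho>)" for x :: 'a by (rule CD_locally_compact[OF M CD N k])
  show "\<exists>\<gamma>\<in>geodesics. dist x (apply_bcontfun \<gamma> 0) < \<epsilon> \<and> dist y (apply_bcontfun \<gamma> 1) < \<epsilon>"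
    if \<epsilon>: "0 < \<epsilon>" for x y :: 'a and \<epsilon>
    by (rule CD_geodesic_near[OF M CD \<epsilon>, of x y]) blast
qed

lemma compact_finite_measure:
  fixes M :: "'a::polish_space measure"
  assumes M: "metric_measure_space M" and S: "compact S"
  shows "emeasure M S < \<infinity>"
proof -
  have s: "sets M = sets borel" by (rule mms_sets[OF M])
  obtain d where d: "\<And>z. 0 < d z" "\<And>z. emeasure M (ball z (d z)) < \<infinity>"
    using M unfolding metric_measure_space_def by metis
  obtain T where T: "T \<subseteq> S" "finite T" "S \<subseteq> (\<Union>z\<in>T. ball z (d z))"
    by (rule compactE_image[OF S, of S "\<lambda>z. ball z (d z)"]) (use d(1) in auto)
  have "emeasure M (\<Union>z\<in>T. ball z (d z)) \<le> (\<Sum>z\<in>T. emeasure M (ball z (d z)))"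
    by (rule emeasure_subadditive_finite[OF T(2)]) (simp add: s image_subset_iff)
  also have "\<dots> < \<infinity>" using d(2) by (simp add: ennreal_sum_less_top T(2))
  finally have *: "emeasure M (\<Union>z\<in>T. ball z (d z)) < \<infinity>" .
  show ?thesis
    by (rule mms_finite_mono[OF M _ T(3) *]) (simp only: s, intro borel_open open_UN ballI open_ball)
qed

lemma compact_lower_bound:
  fixes k :: "'a::metric_space \<Rightarrow> real"
  assumes k: "admissible_curv k" and S: "compact S"
  shows "\<exists>C>0. \<forall>y\<in>S. - C \<le> k y"
proof -
  obtain d c where d: "\<And>z. 0 < d z" "\<And>z y. y \<in> ball z (d z) \<Longrightarrow> c z \<le> k y"
    using k unfolding admissible_curv_def by metis
  obtain T where T: "T \<subseteq> S" "finite T" "S \<subseteq> (\<Union>z\<in>T. ball z (d z))"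
    by (rule compactE_image[OF S, of S "\<lambda>z. ball z (d z)"]) (use d(1) in auto)
  define C where "C = 1 + (\<Sum>z\<in>T. \<bar>c z\<bar>)"
  show ?thesis
  proof (intro exI[of _ C] conjI ballI)
    show "0 < C" unfolding C_def by (simp add: add_pos_nonneg sum_nonneg)
    fix y assume "y \<in> S"
    then obtain z where z: "z \<in> T" "y \<in> ball z (d z)" using T(3) by blast
    have "\<bar>c z\<bar> \<le> (\<Sum>z\<in>T. \<bar>c z\<bar>)" using z T(2) by (intro member_le_sum) auto
    then show "- C \<le> k y" using d(2)[OF z(2)] unfolding C_def by linarith
  qed
qed

text \<open>For radii larger than the diameter of \<open>B\<close> the two balls coincide; smaller radii are covered by
  \<open>ball_shrink_comparison\<close>, as \<open>k\<close> is bounded below on a large ball.\<close>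

lemma CD_doubling:
  fixes M :: "'a::polish_space measure"
  assumes M: "metric_measure_space M" "msupport M = UNIV" and CD: "CD M k N" and N: "1 \<le> N"
    and k: "admissible_curv k" and B: "bounded B"
  shows "doubling_on M B"
proof -
  have s: "sets M = sets borel" by (rule mms_sets[OF M(1)])
  obtain x0 D0 where D0: "\<And>y. y \<in> B \<Longrightarrow> dist x0 y \<le> D0" using B unfolding bounded_def by blast
  define D where "D = max 1 (2 * D0)"
  have D: "1 \<le> D" by (simp add: D_def)
  have BD: "dist x y \<le> D" if "x \<in> B" "y \<in> B" for x y
    using D0[OF that(1)] D0[OF that(2)] dist_triangle3[of x y x0] by (simp add: D_def)
  have fin: "emeasure M (cball x r) < \<infinity>" for x r
    by (rule compact_finite_measure[OF M(1) CD_proper[OF M CD N k]])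
  obtain C where C: "0 < C" "\<forall>y\<in>cball x0 (D + 4 * D). - C \<le> k y"
    using compact_lower_bound[OF k CD_proper[OF M CD N k, of x0 "D + 4 * D"]] by (elim exE conjE)
  have third: "0 < (1/3::real)" "1/3 < (1::real)" by simp_all
  obtain c where c: "0 < c" "\<forall>x R. 0 < R \<longrightarrow> 2 * R \<le> 4 * D \<longrightarrow> (\<forall>y\<in>ball x (2 * R). - C \<le> k y) \<longrightarrow>
       emeasure M (ball x (2 * R)) < \<infinity> \<longrightarrow> c * measure M (ball x R) \<le> measure M (cball x (1/3 * R))"
    using ball_shrink_comparison[OF M CD N third C(1), of "4 * D"] by (elim exE conjE)
  have finb: "emeasure M (ball x r) < \<infinity>" for x r
    by (rule mms_finite_mono[OF M(1) _ ball_subset_cball fin]) (simp add: s)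
  have em: "emeasure M (ball x r) = ennreal (measure M (ball x r))" for x r
    using finb[of x r] by (intro emeasure_eq_ennreal_measure) auto
  show ?thesis
    unfolding doubling_on_def
  proof (intro exI[of _ "max 1 (1 / c)"] ballI allI impI)
    fix x r assume x: "x \<in> B" and r: "0 < (r::real)" and sub: "ball x (2 * r) \<subseteq> B"
    have "measure M (ball x (2 * r)) \<le> max 1 (1 / c) * measure M (ball x r)"
    proof (cases "D < r")
      case True
      have "ball x (2 * r) \<subseteq> ball x r" using sub BD[OF x] True by fastforce
      then have "measure M (ball x (2 * r)) \<le> measure M (ball x r)"
        using s finb by (intro measure_mono_fmeasurable fmeasurableI) auto
      also have "\<dots> \<le> max 1 (1 / c) * measure M (ball x r)"
        using mult_right_mono[of 1 "max 1 (1/c)" "measure M (ball x r)"] by simp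
      finally show ?thesis .
    next
      case False
      have "c * measure M (ball x (2 * r)) \<le> measure M (cball x (1/3 * (2 * r)))"
      proof (rule c(2)[rule_format])
        fix y assume "y \<in> ball x (2 * (2 * r))"
        then have "dist x0 y \<le> D + 4 * D"
          using False D0[OF x] D dist_triangle[of x0 y x] unfolding D_def by auto
        then show "- C \<le> k y" using C(2) by simp
      qed (use r False finb in auto)
      also have "\<dots> \<le> measure M (ball x r)"
        using s finb r by (intro measure_mono_fmeasurable fmeasurableI) auto
      finally have "measure M (ball x (2 * r)) \<le> 1 / c * measure M (ball x r)"
        using c(1) by (simp add: field_simps)
      also have "\<dots> \<le> max 1 (1 / c) * measure M (ball x r)"
        by (intro mult_right_mono) auto
      finally show ?thesis .
    qed
    then show "emeasure M (ball x (2 * r)) \<le> ennreal (max 1 (1 / c)) * emeasure M (ball x r)"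
      unfolding em by (simp add: ennreal_mult[symmetric] ennreal_leI)
  qed
qed

section \<open>Monotonicity from comparison of annuli\<close>

text \<open>A continuous function with nonnegative upper right Dini derivative is nondecreasing. For each slope
  \<open>-e\<close>, consider the last point at which the graph lies above the line of that slope through its initial
  point.\<close>

lemma Dini_nondecreasing:
  fixes f :: "real \<Rightarrow> real"
  assumes f: "continuous_on {a..b} f" and ab: "a \<le> b"
    and D: "\<And>x e. a \<le> x \<Longrightarrow> x < b \<Longrightarrow> 0 < e \<Longrightarrow> \<exists>y. x < y \<and> y \<le> b \<and> - e * (y - x) \<le> f y - f x"
  shows "f a \<le> f b"
proof (rule field_le_epsilon)
  fix \<epsilon> :: real assume \<epsilon>: "0 < \<epsilon>"
  define e where "e = \<epsilon> / (b - a + 1)"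
  have e: "0 < e" "e * (b - a) \<le> \<epsilon>"
  proof -
    show "0 < e" using \<epsilon> ab by (simp add: e_def)
    have "e * (b - a) \<le> e * (b - a + 1)" using \<open>0 < e\<close> by simp
    also have "\<dots> = \<epsilon>" using ab by (simp add: e_def)
    finally show "e * (b - a) \<le> \<epsilon>" .
  qed
  define S where "S = {a..b} \<inter> (\<lambda>x. f x + e * (x - a)) -` {f a..}"
  have "closed S" unfolding S_def
    by (rule continuous_closed_preimage) (intro continuous_intros f, auto)
  then have "compact S" unfolding S_def by (metis Int_absorb1 Int_lower1 compact_Icc compact_Int_closed)
  moreover have "a \<in> S" using ab by (simp add: S_def)
  ultimately obtain z where z: "z \<in> S" "\<And>y. y \<in> S \<Longrightarrow> y \<le> z"
    using compact_attains_sup[of S] by auto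
  have "z = b"
  proof (rule ccontr)
    assume "z \<noteq> b"
    then have "a \<le> z" "z < b" using z(1) by (auto simp: S_def)
    then obtain y where y: "z < y" "y \<le> b" "- e * (y - z) \<le> f y - f z" using D e by blast
    have "f a \<le> f z + e * (z - a)" using z(1) by (simp add: S_def)
    then have "f a \<le> f y + e * (y - a)" using y(3) by (simp add: algebra_simps)
    then have "y \<in> S" using y \<open>a \<le> z\<close> by (simp add: S_def)
    then show False using z(2)[of y] y(1) by simp
  qed
  then show "f a \<le> f b + \<epsilon>" using z(1) e(2) by (simp add: S_def)
qed

text \<open>The annulus inequality with a comparison function \<open>g\<close> of the radius, stated apart from its origin:
  \<open>g = sin_K powr (N - 1)\<close>, once for the sharp value of \<open>K\<close> and once for a crude one on a larger ball,
  or \<open>g = 1\<close> in dimension one.\<close>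

locale radial_comparison =
  fixes M :: "'a::polish_space measure" and x :: 'a and Rm :: real and g :: "real \<Rightarrow> real"
  assumes sM: "sets M = sets borel"
    and fin: "\<And>r. emeasure M (cball x r) < \<infinity>"
    and g_cont: "continuous_on {0..<Rm} g"
    and g_pos: "\<And>r. 0 < r \<Longrightarrow> r < Rm \<Longrightarrow> 0 < g r"
    and annulus_comparison: "\<And>t a b c. 0 < t \<Longrightarrow> t < 1 \<Longrightarrow> 0 < a \<Longrightarrow> a \<le> b \<Longrightarrow> b < Rm \<Longrightarrow> 0 \<le> c \<Longrightarrow>
        (\<And>\<theta>. a \<le> \<theta> \<Longrightarrow> \<theta> \<le> b \<Longrightarrow> c \<le> t * (g (t * \<theta>) / g \<theta>)) \<Longrightarrow>
        c * measure M (annulus x a b) \<le> measure M (annulus x (t * a) (t * b))"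
begin

definition vol_real :: "real \<Rightarrow> real" where "vol_real r = measure M (cball x r)"

lemma annulus_sets: "annulus x a b \<in> sets M"
  using sM borel_closed[OF closed_annulus] by auto

lemma annulus_fm: "annulus x a b \<in> fmeasurable M"
proof (rule fmeasurableI[OF annulus_sets])
  have "emeasure M (annulus x a b) \<le> emeasure M (cball x b)"
    using sM by (intro emeasure_mono annulus_subset_cball) auto
  then show "emeasure M (annulus x a b) < \<infinity>" using fin[of b] by (rule le_less_trans)
qed

lemma cball_fm: "cball x b \<in> fmeasurable M"
  using sM fin by (intro fmeasurableI) auto

lemma sphere_sets: "sphere x r \<in> sets M"
proof -
  have "sphere x r = annulus x r r" by (auto simp: annulus_def)
  then show ?thesis using annulus_sets by simp
qed

text \<open>Scaling the annulus by \<open>t_j = 1 - 2 j h / r\<close> for \<open>j \<le> r / (4 h)\<close> gives disjoint annuli in a fixed ball.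
  Each has measure at least a constant times that of the original one, and there are at least
  \<open>r / (4 h)\<close> of them.\<close>

lemma annulus_linear_bound:
  assumes p: "0 < p" "p < q" "q < Rm"
  shows "\<exists>C\<ge>0. \<forall>r h. p \<le> r \<longrightarrow> 0 < h \<longrightarrow> r + h \<le> q \<longrightarrow> measure M (annulus x r (r + h)) \<le> C * h"
proof -
  have gc: "continuous_on {p/2..q} g" using p by (intro continuous_on_subset[OF g_cont]) auto
  have ne: "{p/2..q} \<noteq> {}" using p by auto
  obtain y where y: "y \<in> {p/2..q}" "\<And>z. z \<in> {p/2..q} \<Longrightarrow> g y \<le> g z"
    using continuous_attains_inf[OF compact_Icc ne gc] by auto
  obtain w where w: "w \<in> {p/2..q}" "\<And>z. z \<in> {p/2..q} \<Longrightarrow> g z \<le> g w"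
    using continuous_attains_sup[OF compact_Icc ne gc] by auto
  have pos: "0 < g z" if "z \<in> {p/2..q}" for z using that p by (intro g_pos) auto
  define c0 where "c0 = 1/2 * (g y / g w)"
  have c0: "0 < c0" "c0 \<le> 1"
    using pos[OF y(1)] pos[OF w(1)] y(2)[OF w(1)] by (auto simp: c0_def divide_simps)
  show ?thesis
  proof (intro exI[of _ "4 * vol_real q / (p * c0)"] conjI allI impI)
    show "0 \<le> 4 * vol_real q / (p * c0)" using p c0 by (simp add: vol_real_def)
    fix r h assume r: "p \<le> r" and h: "0 < h" and rh: "r + h \<le> q"
    have r0: "0 < r" using r p by simp
    let ?A = "annulus x r (r + h)"
    define n where "n = nat \<lfloor>r / (4 * h)\<rfloor>"
    have n: "real n \<le> r / (4 * h)" "r / (4 * h) \<le> real (Suc n)"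
    proof -
      have "0 \<le> r / (4 * h)" using r0 h by simp
      then show "real n \<le> r / (4 * h)" "r / (4 * h) \<le> real (Suc n)" unfolding n_def by linarith+
    qed
    define t where "t j = 1 - 2 * real j * h / r" for j
    have t: "1/2 \<le> t j" "t j \<le> 1" if "j \<le> n" for j
    proof -
      have "real j \<le> r / (4 * h)" using n(1) that by linarith
      then show "1/2 \<le> t j" using r0 h unfolding t_def by (simp add: field_simps)
      show "t j \<le> 1" using r0 h unfolding t_def by simp
    qed
    \<comment> \<open>Consecutive factors differ by \<open>2 h / r\<close>, twice the relative thickness: enough for disjointness.\<close>
    have gap: "t j * (r + h) < t i * r" if "i < j" "j \<le> n" for i j
    proof -
      have "t i - t j = 2 * (real j - real i) * h / r" by (simp add: t_def diff_divide_distrib algebra_simps)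
      moreover have "2 * 1 * h / r \<le> 2 * (real j - real i) * h / r"
        using that r0 h by (intro divide_right_mono mult_right_mono) auto
      ultimately have "2 * h / r \<le> t i - t j" by simp
      then have "2 * h / r * r \<le> (t i - t j) * r" using r0 by (intro mult_right_mono) auto
      then have "2 * h \<le> (t i - t j) * r" using r0 by simp
      moreover have "t j * h \<le> 1 * h" using t(2)[of j] that h by (intro mult_right_mono) auto
      moreover have "t j * (r + h) = t j * r + t j * h" "(t i - t j) * r = t i * r - t j * r"
        by (simp_all add: distrib_left left_diff_distrib)
      ultimately show ?thesis using h by (smt (verit))
    qed
    have each: "c0 * measure M ?A \<le> measure M (annulus x (t j * r) (t j * (r + h)))" if j: "j \<le> n" for j
    proof (cases "t j = 1")
      case True
      then show ?thesis using c0 by (simp add: mult_left_le_one_le)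
    next
      case False
      then have tj: "1/2 \<le> t j" "t j < 1" using t[OF j] by auto
      show ?thesis
      proof (rule annulus_comparison)
        fix \<theta> assume \<theta>: "r \<le> \<theta>" "\<theta> \<le> r + h"
        have "p * (1/2) \<le> \<theta> * t j" using \<theta> r p tj by (intro mult_mono) auto
        moreover have "t j * \<theta> \<le> 1 * \<theta>" using tj \<theta> r0 by (intro mult_right_mono) auto
        ultimately have "p / 2 \<le> t j * \<theta>" "t j * \<theta> \<le> \<theta>" by (simp_all only: mult.commute[of \<theta>])
        then have i: "t j * \<theta> \<in> {p/2..q}" "\<theta> \<in> {p/2..q}"
          unfolding atLeastAtMost_iff using \<theta> rh r p by linarith+
        have "g y / g w \<le> g (t j * \<theta>) / g \<theta>"
          using y(2)[OF i(1)] w(2)[OF i(2)] pos[OF i(2)] pos[OF y(1)] by (intro frac_le) auto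
        then show "c0 \<le> t j * (g (t j * \<theta>) / g \<theta>)"
          unfolding c0_def using tj pos[OF y(1)] pos[OF w(1)] by (intro mult_mono) auto
      qed (use tj r0 h rh p c0 in auto)
    qed
    have "real (Suc n) * (c0 * measure M ?A) = (\<Sum>j\<le>n. c0 * measure M ?A)" by simp
    also have "\<dots> \<le> (\<Sum>j\<le>n. measure M (annulus x (t j * r) (t j * (r + h))))"
      using each by (intro sum_mono) auto
    also have "\<dots> = measure M (\<Union>j\<le>n. annulus x (t j * r) (t j * (r + h)))"
    proof (rule measure_finite_Union[symmetric])
      show "disjoint_family_on (\<lambda>j. annulus x (t j * r) (t j * (r + h))) {..n}"
        unfolding disjoint_family_on_def
      proof (intro ballI impI, rule ccontr)
        fix i j assume ij: "i \<in> {..n}" "j \<in> {..n}" "i \<noteq> j"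
          "annulus x (t i * r) (t i * (r + h)) \<inter> annulus x (t j * r) (t j * (r + h)) \<noteq> {}"
        then obtain z where z: "t i * r \<le> dist x z" "dist x z \<le> t i * (r + h)"
           "t j * r \<le> dist x z" "dist x z \<le> t j * (r + h)" by (auto simp: annulus_def)
        show False
        proof (cases "i < j")
          case True then show False using gap[of i j] ij z by auto
        next
          case False then show False using gap[of j i] ij z by auto
        qed
      qed
      show "emeasure M (annulus x (t j * r) (t j * (r + h))) \<noteq> \<infinity>" for j
        using annulus_fm[of "t j * r" "t j * (r + h)"] by (simp add: fmeasurable_def less_top)
    qed (auto simp: annulus_sets)
    also have "\<dots> \<le> vol_real q"
      unfolding vol_real_def
    proof (rule measure_mono_fmeasurable[OF _ _ cball_fm])
      show "(\<Union>j\<le>n. annulus x (t j * r) (t j * (r + h))) \<subseteq> cball x q"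
      proof
        fix z assume "z \<in> (\<Union>j\<le>n. annulus x (t j * r) (t j * (r + h)))"
        then obtain j where j: "j \<le> n" "dist x z \<le> t j * (r + h)" by (auto simp: annulus_def)
        have "t j * (r + h) \<le> 1 * (r + h)" using t(2)[OF j(1)] r0 h by (intro mult_right_mono) auto
        then show "z \<in> cball x q" using j rh by simp
      qed
      show "(\<Union>j\<le>n. annulus x (t j * r) (t j * (r + h))) \<in> sets M"
        by (rule sets.finite_UN) (auto simp: annulus_sets)
    qed
    finally have 1: "real (Suc n) * (c0 * measure M ?A) \<le> vol_real q" .
    have "r / (4 * h) * (c0 * measure M ?A) \<le> real (Suc n) * (c0 * measure M ?A)"
      using n(2) c0 by (intro mult_right_mono) auto
    then have "r / (4 * h) * (c0 * measure M ?A) \<le> vol_real q" using 1 by simp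
    moreover have "p / (4 * h) * (c0 * measure M ?A) \<le> r / (4 * h) * (c0 * measure M ?A)"
      using r h c0 by (intro mult_right_mono divide_right_mono) auto
    ultimately have "p / (4 * h) * (c0 * measure M ?A) \<le> vol_real q" by simp
    then show "measure M ?A \<le> 4 * vol_real q / (p * c0) * h"
      using p h c0 by (simp add: field_simps)
  qed
qed

lemma sphere_null:
  assumes r: "0 < r" "r < Rm"
  shows "emeasure M (sphere x r) = 0"
proof -
  define q where "q = (r + Rm) / 2"
  have q: "r < q" "q < Rm" using r by (auto simp: q_def)
  obtain C where C: "0 \<le> C" "\<forall>r' h. r \<le> r' \<longrightarrow> 0 < h \<longrightarrow> r' + h \<le> q \<longrightarrow> measure M (annulus x r' (r' + h)) \<le> C * h"
    using annulus_linear_bound[OF r(1) q] by (elim exE conjE)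
  have le: "measure M (sphere x r) \<le> C * h" if h: "0 < h" "h \<le> q - r" for h
  proof -
    have "measure M (sphere x r) \<le> measure M (annulus x r (r + h))"
    proof (rule measure_mono_fmeasurable[OF _ sphere_sets annulus_fm])
      show "sphere x r \<subseteq> annulus x r (r + h)" using h by (auto simp: annulus_def)
    qed
    then show ?thesis using C(2)[rule_format, of r h] h by simp
  qed
  have "measure M (sphere x r) \<le> 0"
  proof (rule field_le_epsilon)
    fix e :: real assume e: "0 < e"
    define h where "h = min (e / (C + 1)) (q - r)"
    have h: "0 < h" "h \<le> q - r" "h \<le> e / (C + 1)" using e C q by (auto simp: h_def)
    have "C * h \<le> (C + 1) * h" using h by (simp add: algebra_simps)
    also have "\<dots> \<le> (C + 1) * (e / (C + 1))" using h C by (intro mult_left_mono) auto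
    also have "\<dots> = e" using C by simp
    finally show "measure M (sphere x r) \<le> 0 + e" using le[OF h(1,2)] by simp
  qed
  moreover have "sphere x r \<in> fmeasurable M"
    by (rule fmeasurableI2[OF cball_fm[of r] sphere_cball sphere_sets])
  ultimately show ?thesis by (simp add: emeasure_eq_measure2 measure_le_0_iff)
qed

lemma vol_real_diff:
  assumes r: "0 < r" "r < Rm" and R: "r \<le> R"
  shows "vol_real R - vol_real r = measure M (annulus x r R)"
proof -
  have s: "sphere x r \<in> null_sets M" by (rule null_setsI[OF sphere_null[OF r] sphere_sets])
  have "measure M (annulus x r R) = measure M ((cball x R - cball x r) \<union> sphere x r)"
    using R by (intro arg_cong2[where f=measure]) (auto simp: annulus_def sphere_def)
  also have "\<dots> = measure M (cball x R - cball x r)"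
    using sM s by (intro measure_Un_null_set) auto
  also have "\<dots> = vol_real R - vol_real r" unfolding vol_real_def
    using R by (intro measurable_measure_Diff cball_fm) (auto simp: sM)
  finally show ?thesis by simp
qed

lemma vol_real_continuous:
  assumes p: "0 < p" "q < Rm"
  shows "continuous_on {p..q} vol_real"
proof (cases "p < q")
  case True
  obtain C where C: "0 \<le> C" "\<forall>r h. p \<le> r \<longrightarrow> 0 < h \<longrightarrow> r + h \<le> q \<longrightarrow> measure M (annulus x r (r + h)) \<le> C * h"
    using annulus_linear_bound[OF p(1) True p(2)] by (elim exE conjE)
  have le: "\<bar>vol_real b - vol_real a\<bar> \<le> C * (b - a)" if ab: "a \<in> {p..q}" "b \<in> {p..q}" "a < b" for a b
    using vol_real_diff[of a b] C(2)[rule_format, of a "b - a"] ab p by auto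
  have "C-lipschitz_on {p..q} vol_real"
  proof (rule lipschitz_onI[OF _ C(1)])
    fix a b assume "a \<in> {p..q}" "b \<in> {p..q}"
    then show "dist (vol_real a) (vol_real b) \<le> C * dist a b"
      using le[of a b] le[of b a] by (cases a b rule: linorder_cases) (auto simp: dist_real_def abs_minus_commute)
  qed
  then show ?thesis by (rule lipschitz_on_continuous_on)
next
  case False
  then have "{p..q} = {} \<or> {p..q} = {p}" by auto
  then show ?thesis by auto
qed

definition shell_density :: "real \<Rightarrow> real \<Rightarrow> real" where
  "shell_density r h = measure M (annulus x r (r + h)) / h"

lemma shell_density_nonneg: "0 < h \<Longrightarrow> 0 \<le> shell_density r h"
  by (simp add: shell_density_def)

lemma sph_Limsup: "sph M x r = Limsup (at_right 0) (\<lambda>h. ennreal (shell_density r h))"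
  unfolding sph_def
proof (rule Limsup_eq, rule eventually_at_rightI[of 0 1])
  fix h :: real assume h: "h \<in> {0<..<1}"
  have "cball x (r + h) - ball x r = annulus x r (r + h)" by (auto simp: annulus_def)
  moreover have "emeasure M (annulus x r (r + h)) = ennreal (measure M (annulus x r (r + h)))"
    using annulus_fm by (simp add: emeasure_eq_measure2)
  ultimately show "ennreal (1 / h) * emeasure M (cball x (r + h) - ball x r) = ennreal (shell_density r h)"
    using h by (simp add: shell_density_def ennreal_mult[symmetric])
qed simp

definition sph_real :: "real \<Rightarrow> real" where "sph_real r = enn2real (sph M x r)"

lemma sph_eq_sph_real:
  assumes r: "0 < r" "r < Rm"
  shows "sph M x r = ennreal (sph_real r)"
proof -
  define q where "q = (r + Rm) / 2"
  have q: "r < q" "q < Rm" using r by (auto simp: q_def)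
  obtain C where C: "0 \<le> C" "\<forall>r' h. r \<le> r' \<longrightarrow> 0 < h \<longrightarrow> r' + h \<le> q \<longrightarrow> measure M (annulus x r' (r' + h)) \<le> C * h"
    using annulus_linear_bound[OF r(1) q] by (elim exE conjE)
  have "eventually (\<lambda>h. ennreal (shell_density r h) \<le> ennreal C) (at_right 0)"
  proof (rule eventually_at_rightI[of 0 "q - r"])
    fix h assume h: "h \<in> {0<..<q - r}"
    then have "measure M (annulus x r (r + h)) \<le> C * h" using C(2) by simp
    then have "shell_density r h \<le> C" using h by (simp add: shell_density_def divide_le_eq)
    then show "ennreal (shell_density r h) \<le> ennreal C" by (rule ennreal_leI)
  qed (use q in simp)
  then have "sph M x r \<le> ennreal C" unfolding sph_Limsup by (rule Limsup_bounded)
  then have "sph M x r < \<infinity>" using le_less_trans by fastforce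
  then show ?thesis by (simp add: sph_real_def)
qed

lemma sph_real_nonneg: "0 \<le> sph_real r"
  by (simp add: sph_real_def)

lemma shell_density_eventually_less:
  assumes r: "0 < r" "r < Rm" and y: "sph_real r < y"
  shows "eventually (\<lambda>h. shell_density r h < y) (at_right 0)"
proof -
  have y0: "0 < y" using y sph_real_nonneg[of r] by simp
  have "Limsup (at_right 0) (\<lambda>h. ennreal (shell_density r h)) < ennreal y"
    unfolding sph_Limsup[symmetric] sph_eq_sph_real[OF r] using y sph_real_nonneg by (simp add: ennreal_lessI y0)
  then have "eventually (\<lambda>h. ennreal (shell_density r h) < ennreal y) (at_right 0)"
    by (rule Limsup_lessD)
  then show ?thesis
    by (rule eventually_mono) (use y0 in \<open>auto simp: ennreal_less_iff intro: ccontr dest: ennreal_leI\<close>)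
qed

lemma sph_real_le:
  assumes "eventually (\<lambda>h. shell_density r h \<le> y) (at_right 0)" "0 \<le> y"
  shows "sph_real r \<le> y"
proof -
  have "eventually (\<lambda>h. ennreal (shell_density r h) \<le> ennreal y) (at_right 0)"
    using assms(1) by (rule eventually_mono) (rule ennreal_leI)
  then have "sph M x r \<le> ennreal y" unfolding sph_Limsup by (rule Limsup_bounded)
  then have "enn2real (sph M x r) \<le> enn2real (ennreal y)" by (intro enn2real_mono) auto
  then show ?thesis using assms(2) by (simp add: sph_real_def)
qed

text \<open>The annulus inequality for the annuli from \<open>R\<close> to \<open>R + h\<close> and its multiple by \<open>t = r / R\<close>, divided by
  \<open>t h\<close>; the quotient \<open>g(t \<theta>) / g(\<theta>)\<close> tends to \<open>g r / g R\<close> by continuity.\<close>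

lemma sph_real_comparison:
  assumes r: "0 < r" "r \<le> R" "R < Rm"
  shows "g r * sph_real R \<le> g R * sph_real r"
proof (cases "r = R")
  case False
  then have rR: "r < R" using r by simp
  define t where "t = r / R"
  have t: "0 < t" "t < 1" "t * R = r" using r rR by (auto simp: t_def)
  have gR: "0 < g R" "0 < g r" using r by (auto intro!: g_pos)
  have key: "c * sph_real R \<le> sph_real r" if c: "0 < c" "c < g r / g R" for c
  proof (rule field_le_epsilon)
    fix e :: real assume e: "0 < e"
    define y where "y = sph_real r + e"
    have y: "sph_real r < y" "0 \<le> y" using e sph_real_nonneg[of r] by (auto simp: y_def)
    have ev1: "eventually (\<lambda>h. shell_density r (t * h) < y) (at_right 0)"
    proof -
      have "filterlim (\<lambda>h. t * h) (at_right 0) (at_right 0)"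
        unfolding filterlim_at
        using t by (auto intro!: tendsto_eq_intros simp: eventually_at_filter)
      then show ?thesis using shell_density_eventually_less[OF r(1) _ y(1)] r
        by (auto simp: filterlim_iff)
    qed
    have cont: "isCont (\<lambda>\<theta>. g (t * \<theta>) / g \<theta>) R"
    proof -
      have gc: "isCont g z" if "0 < z" "z < Rm" for z
        using continuous_on_interior[OF g_cont, of z] that by (simp add: interior_atLeastLessThan)
      have "isCont (\<lambda>\<theta>. g (t * \<theta>)) R"
        using gc[of "t * R"] r t by (intro isCont_o2[of _ "\<lambda>\<theta>. t * \<theta>" g]) auto
      then show ?thesis using gc[of R] r gR by (intro continuous_divide) auto
    qed
    have "c < g (t * R) / g R" using c t by simp
    moreover have "((\<lambda>\<theta>. g (t * \<theta>) / g \<theta>) \<longlongrightarrow> g (t * R) / g R) (nhds R)"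
      using cont tendsto_at_iff_tendsto_nhds[of "\<lambda>\<theta>. g (t * \<theta>) / g \<theta>" R] by (simp add: isCont_def)
    ultimately have "eventually (\<lambda>\<theta>. c < g (t * \<theta>) / g \<theta>) (nhds R)"
      by (metis order_tendstoD(1))
    then obtain d where d: "0 < d" "\<And>\<theta>. dist \<theta> R < d \<Longrightarrow> c < g (t * \<theta>) / g \<theta>"
      unfolding eventually_nhds_metric by auto
    have ev2: "eventually (\<lambda>h. 0 < h \<and> h < d \<and> R + h < Rm) (at_right 0)"
      by (rule eventually_at_rightI[of 0 "min d (Rm - R)"]) (use d r in auto)
    have "eventually (\<lambda>h. shell_density R h \<le> y / c) (at_right 0)"
      using ev1 ev2
    proof eventually_elim
      fix h assume shell_density: "shell_density r (t * h) < y" and h: "0 < h \<and> h < d \<and> R + h < Rm"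
      have "(t * c) * measure M (annulus x R (R + h)) \<le> measure M (annulus x (t * R) (t * (R + h)))"
      proof (rule annulus_comparison)
        fix \<theta> assume \<theta>: "R \<le> \<theta>" "\<theta> \<le> R + h"
        then have "c < g (t * \<theta>) / g \<theta>" using h by (intro d(2)) (auto simp: dist_real_def)
        then show "t * c \<le> t * (g (t * \<theta>) / g \<theta>)" using t(1) by (intro mult_left_mono) auto
      qed (use t h r c in auto)
      also have "annulus x (t * R) (t * (R + h)) = annulus x r (r + t * h)" using t by (simp add: algebra_simps)
      also have "measure M (annulus x r (r + t * h)) = (t * h) * shell_density r (t * h)" using t h by (simp add: shell_density_def)
      also have "\<dots> \<le> (t * h) * y" using shell_density t h by (intro mult_left_mono) auto
      finally have "c * measure M (annulus x R (R + h)) \<le> h * y" using t by (simp add: mult.assoc)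
      then show "shell_density R h \<le> y / c" using h c by (simp add: shell_density_def field_simps)
    qed
    then have "sph_real R \<le> y / c" using y c by (intro sph_real_le) auto
    then show "c * sph_real R \<le> sph_real r + e" using c by (simp add: y_def field_simps)
  qed
  show ?thesis
  proof (cases "sph_real R = 0")
    case True
    then show ?thesis using gR sph_real_nonneg by simp
  next
    case False
    then have SR: "0 < sph_real R" using sph_real_nonneg[of R] by simp
    have "g r / g R \<le> sph_real r / sph_real R"
    proof (rule dense_le_bounded[of 0])
      show "0 < g r / g R" using gR by simp
      fix c assume "0 < c" "c < g r / g R"
      then show "c \<le> sph_real r / sph_real R" using key[of c] SR by (simp add: field_simps)
    qed
    then show ?thesis using gR SR by (simp add: field_simps)
  qed
qed simp

definition g_integral :: "real \<Rightarrow> real" where "g_integral r = integral {0..r} g"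

lemma g_integral_quotient:
  assumes r: "0 < r" "r < Rm"
  shows "((\<lambda>h. (g_integral (r + h) - g_integral r) / h) \<longlongrightarrow> g r) (at_right 0)"
proof -
  define q where "q = (r + Rm) / 2"
  have q: "r < q" "q < Rm" using r by (auto simp: q_def)
  have "(g_integral has_real_derivative g r) (at r within {0..q})"
    unfolding g_integral_def
    by (rule integral_has_real_derivative) (use q r in \<open>auto intro!: continuous_on_subset[OF g_cont]\<close>)
  moreover have "at r within {0..q} = at r" using r q by (intro at_within_Icc_at) auto
  ultimately have "((\<lambda>h. (g_integral (r + h) - g_integral r) / h) \<longlongrightarrow> g r) (at 0)"
    by (simp add: DERIV_def)
  then show ?thesis by (rule tendsto_mono[OF at_le, rotated]) simp
qed

lemma g_integral_continuous:
  assumes "q < Rm" shows "continuous_on {0..q} g_integral"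
  unfolding g_integral_def
  by (intro indefinite_integral_continuous_1 integrable_continuous_real continuous_on_subset[OF g_cont])
     (use assms in auto)

text \<open>Gromov's monotonicity lemma for a derivative that exists only as an upper limit. With
  \<open>c = s(r) / g(r)\<close>, the quotient \<open>s / g\<close> is at least \<open>c\<close> before \<open>r\<close> and at most \<open>c\<close> after it, so
  \<open>v - c \<integral> g\<close> increases up to \<open>r\<close> and decreases from \<open>r\<close> on. Hence \<open>c \<integral> g\<close> is at most \<open>v\<close> at \<open>r\<close>,
  and \<open>v(R) - v(r)\<close> is at most \<open>c\<close> times the integral of \<open>g\<close> from \<open>r\<close> to \<open>R\<close>.\<close>

lemma vol_real_comparison:
  assumes r: "0 < r" "r \<le> R" "R < Rm"
  shows "g_integral r * vol_real R \<le> g_integral R * vol_real r"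
proof -
  define c where "c = sph_real r / g r"
  have gr: "0 < g r" using r by (intro g_pos) auto
  have c0: "0 \<le> c" using gr sph_real_nonneg by (simp add: c_def)
  define D where "D z h = (g_integral (z + h) - g_integral z) / h" for z h
  have D: "(D z \<longlongrightarrow> g z) (at_right 0)" if "0 < z" "z < Rm" for z
    unfolding D_def[abs_def] by (rule g_integral_quotient[OF that])
  have VQ: "vol_real (z + h) - vol_real z = h * shell_density z h" if "0 < z" "z < Rm" "0 < h" for z h
    using vol_real_diff[of z "z + h"] that by (simp add: shell_density_def)
  have GD: "g_integral (z + h) - g_integral z = h * D z h" if "0 < h" for z h
    using that by (simp add: D_def)
  have up: "vol_real a - c * g_integral a \<le> vol_real r - c * g_integral r" if a: "0 < a" "a \<le> r" for a
  proof (rule Dini_nondecreasing[of a r "\<lambda>z. vol_real z - c * g_integral z"])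
    show "continuous_on {a..r} (\<lambda>z. vol_real z - c * g_integral z)"
      using a r by (intro continuous_intros vol_real_continuous continuous_on_subset[OF g_integral_continuous[of r]]) auto
    fix z e assume z: "a \<le> z" "z < r" and e: "0 < (e::real)"
    then have z': "0 < z" "z < Rm" using a r by auto
    have "g z * sph_real r \<le> g r * sph_real z" using z a r by (intro sph_real_comparison) auto
    then have cz: "c * g z \<le> sph_real z" using gr by (simp add: c_def field_simps)
    have "((\<lambda>h. c * D z h) \<longlongrightarrow> c * g z) (at_right 0)" by (intro tendsto_intros D z')
    then have ev1: "eventually (\<lambda>h. c * D z h < c * g z + e / 2) (at_right 0)"
      using e by (intro order_tendstoD(2)) auto
    have ev2: "eventually (\<lambda>h. 0 < h \<and> h < r - z) (at_right 0)"
      by (rule eventually_at_rightI[of 0 "r - z"]) (use z in auto)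
    have "\<exists>h. 0 < h \<and> h < r - z \<and> c * D z h < c * g z + e / 2 \<and> sph_real z - e / 2 < shell_density z h"
    proof (rule ccontr)
      assume no: "\<not> ?thesis"
      have ev: "eventually (\<lambda>h. shell_density z h \<le> sph_real z - e / 2) (at_right 0)"
        using ev1 ev2 by eventually_elim (use no in force)
      moreover have "0 \<le> sph_real z - e / 2"
      proof -
        have "eventually (\<lambda>h. 0 \<le> sph_real z - e / 2) (at_right (0::real))"
          using ev ev2 by eventually_elim (use shell_density_nonneg[of _ z] in force)
        then show ?thesis by simp
      qed
      ultimately have "sph_real z \<le> sph_real z - e / 2" by (rule sph_real_le)
      then show False using e by simp
    qed
    then obtain h where h: "0 < h" "h < r - z" "c * D z h < c * g z + e / 2" "sph_real z - e / 2 < shell_density z h" by blast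
    have "- e \<le> shell_density z h - c * D z h" using h cz by linarith
    then have "- e * h \<le> (shell_density z h - c * D z h) * h" using h(1) by (intro mult_right_mono) auto
    also have "\<dots> = (vol_real (z + h) - c * g_integral (z + h)) - (vol_real z - c * g_integral z)"
      using VQ[OF z' h(1)] GD[OF h(1), of z] by (simp add: algebra_simps)
    finally show "\<exists>y>z. y \<le> r \<and> - e * (y - z) \<le> (vol_real y - c * g_integral y) - (vol_real z - c * g_integral z)"
      using h by (intro exI[of _ "z + h"]) auto
  qed (use a in auto)
  have down: "c * g_integral r - vol_real r \<le> c * g_integral R - vol_real R"
  proof (rule Dini_nondecreasing[of r R "\<lambda>z. c * g_integral z - vol_real z"])
    show "continuous_on {r..R} (\<lambda>z. c * g_integral z - vol_real z)"
      using r by (intro continuous_intros vol_real_continuous continuous_on_subset[OF g_integral_continuous[of R]]) auto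
    fix z e assume z: "r \<le> z" "z < R" and e: "0 < (e::real)"
    then have z': "0 < z" "z < Rm" using r by auto
    have "g r * sph_real z \<le> g z * sph_real r" using z r by (intro sph_real_comparison) auto
    then have cz: "sph_real z \<le> c * g z" using gr by (simp add: c_def field_simps)
    have "((\<lambda>h. c * D z h) \<longlongrightarrow> c * g z) (at_right 0)" by (intro tendsto_intros D z')
    then have ev1: "eventually (\<lambda>h. c * g z - e / 2 < c * D z h) (at_right 0)"
      using e by (intro order_tendstoD(1)) auto
    have ev2: "eventually (\<lambda>h. 0 < h \<and> h < R - z) (at_right 0)"
      by (rule eventually_at_rightI[of 0 "R - z"]) (use z in auto)
    have ev3: "eventually (\<lambda>h. shell_density z h < sph_real z + e / 2) (at_right 0)"
      using e by (intro shell_density_eventually_less z') auto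
    have "eventually (\<lambda>h. 0 < h \<and> h < R - z \<and> - e \<le> c * D z h - shell_density z h) (at_right 0)"
      using ev1 ev2 ev3 by eventually_elim (use cz in auto)
    then obtain h where h: "0 < h" "h < R - z" "- e \<le> c * D z h - shell_density z h"
      using eventually_happens[of _ "at_right (0::real)"] by (auto simp: trivial_limit_at_right_real)
    then have "- e * h \<le> (c * D z h - shell_density z h) * h" by (intro mult_right_mono) auto
    also have "\<dots> = (c * g_integral (z + h) - vol_real (z + h)) - (c * g_integral z - vol_real z)"
      using VQ[OF z' h(1)] GD[OF h(1), of z] by (simp add: algebra_simps)
    finally show "\<exists>y>z. y \<le> R \<and> - e * (y - z) \<le> (c * g_integral y - vol_real y) - (c * g_integral z - vol_real z)"
      using h by (intro exI[of _ "z + h"]) auto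
  qed (use r in auto)
  have cG: "c * g_integral r \<le> vol_real r"
  proof -
    have "(g_integral \<longlongrightarrow> g_integral 0) (at 0 within {0..r})"
      using g_integral_continuous[of r] r unfolding continuous_on_def by auto
    moreover have "g_integral 0 = 0" by (simp add: g_integral_def)
    moreover have "at 0 within {0..r} = at_right (0::real)" using r by (intro at_within_Icc_at_right) auto
    ultimately have "((\<lambda>a. c * g_integral r - c * g_integral a) \<longlongrightarrow> c * g_integral r - c * 0) (at_right 0)"
      by (intro tendsto_intros) auto
    moreover have "eventually (\<lambda>a. c * g_integral r - c * g_integral a \<le> vol_real r) (at_right 0)"
    proof (rule eventually_at_rightI[of 0 r])
      fix a assume "a \<in> {0<..<r}"
      then have "vol_real a - c * g_integral a \<le> vol_real r - c * g_integral r" by (intro up) auto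
      moreover have "0 \<le> vol_real a" by (simp add: vol_real_def)
      ultimately show "c * g_integral r - c * g_integral a \<le> vol_real r" by simp
    qed (use r in simp)
    ultimately have "c * g_integral r - c * 0 \<le> vol_real r"
      by (intro tendsto_upperbound) (auto simp: trivial_limit_at_right_real)
    then show ?thesis by simp
  qed
  have gnn: "0 \<le> g z" if "z \<in> {0..R}" for z
  proof (cases "z = 0")
    case True
    have "{0..R} \<subseteq> {0..<Rm}" using r by auto
    then have "continuous (at 0 within {0..R}) g"
      using continuous_on_subset[OF g_cont, of "{0..R}"] r by (auto simp: continuous_on_eq_continuous_within)
    moreover have "at 0 within {0..R} = at_right (0::real)" using r by (intro at_within_Icc_at_right) auto
    ultimately have "(g \<longlongrightarrow> g 0) (at_right 0)" by (simp add: continuous_within)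
    moreover have "eventually (\<lambda>z. 0 \<le> g z) (at_right 0)"
      by (rule eventually_at_rightI[of 0 R]) (use r g_pos in \<open>auto intro!: less_imp_le\<close>)
    ultimately have "0 \<le> g 0" by (rule tendsto_lowerbound) (simp add: trivial_limit_at_right_real)
    then show ?thesis using True by simp
  next
    case False
    then show ?thesis using that r g_pos[of z] by auto
  qed
  have int: "g integrable_on {0..R}"
    using r by (intro integrable_continuous_real continuous_on_subset[OF g_cont]) auto
  have Gr: "0 \<le> g_integral r" unfolding g_integral_def
    using gnn r by (intro integral_nonneg integrable_on_subinterval[OF int]) auto
  have GrR: "g_integral r \<le> g_integral R" unfolding g_integral_def
    using gnn r by (intro integral_subset_le integrable_on_subinterval[OF int]) auto
  have "g_integral r * vol_real R \<le> g_integral r * (vol_real r + c * (g_integral R - g_integral r))"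
    using down Gr by (intro mult_left_mono) (auto simp: algebra_simps)
  also have "\<dots> = g_integral r * vol_real r + (c * g_integral r) * (g_integral R - g_integral r)" by (simp add: algebra_simps)
  also have "\<dots> \<le> g_integral r * vol_real r + vol_real r * (g_integral R - g_integral r)"
    using cG GrR by (intro add_left_mono mult_right_mono) auto
  also have "\<dots> = g_integral R * vol_real r" by (simp add: algebra_simps)
  finally show ?thesis .
qed

end

section \<open>Bishop-Gromov comparison\<close>

lemma CD_mono: "CD M k N \<Longrightarrow> N \<le> N' \<Longrightarrow> CD M k N'"
  unfolding CD_def by (meson order_trans)

text \<open>The constant \<open>c\<close> of the annulus inequality has to bound \<open>\<tau>\<close> for the lengths of all geodesics that start
  in a small ball and end in the annulus, and these may lie slightly outside \<open>[a,b]\<close>. By compactness, a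
  strict bound on \<open>[a,b]\<close> persists on a neighbourhood, so \<open>c\<close> is replaced by \<open>z c\<close> with \<open>z < 1\<close>.\<close>

lemma CD_radial_comparison:
  fixes M :: "'a::polish_space measure" and x :: 'a
  assumes M: "metric_measure_space M" "msupport M = UNIV" and CD: "CD M k N" and N: "1 \<le> N"
    and k: "admissible_curv k"
    and g_cont: "continuous_on {0..<Rm} g"
    and g_pos: "\<And>r. 0 < r \<Longrightarrow> r < Rm \<Longrightarrow> 0 < g r"
    and tau: "\<And>t \<gamma>. 0 < t \<Longrightarrow> t < 1 \<Longrightarrow> (\<And>s. s \<in> {0..speed \<gamma>} \<Longrightarrow> dist x (unit_speed \<gamma> s) < Rm) \<Longrightarrow>
       0 < speed \<gamma> \<Longrightarrow> speed \<gamma> < Rm \<Longrightarrow>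
       ennreal ((t * (g (t * speed \<gamma>) / g (speed \<gamma>))) powr (1 / N)) \<le> tau N (k_plus k \<gamma>) t (speed \<gamma>)"
  shows "radial_comparison M x Rm g"
proof
  show sM: "sets M = sets borel" by (rule mms_sets[OF M(1)])
  show fin: "emeasure M (cball x r) < \<infinity>" for r
    by (rule compact_finite_measure[OF M(1) CD_proper[OF M CD N k]])
  show "continuous_on {0..<Rm} g" by fact
  show "0 < g r" if "0 < r" "r < Rm" for r using that by (rule g_pos)
  fix t a b c assume t: "0 < t" "t < (1::real)" and ab: "0 < a" "a \<le> b" "b < Rm" and c: "0 \<le> c"
    and le: "\<And>\<theta>. a \<le> \<theta> \<Longrightarrow> \<theta> \<le> b \<Longrightarrow> c \<le> t * (g (t * \<theta>) / g \<theta>)"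
  show "c * measure M (annulus x a b) \<le> measure M (annulus x (t * a) (t * b))"
  proof (cases "c = 0")
    case False
    then have c0: "0 < c" using c by simp
    define h where "h \<theta> = t * (g (t * \<theta>) / g \<theta>)" for \<theta>
    have gc: "continuous_on {0<..<Rm} g" by (rule continuous_on_subset[OF g_cont]) auto
    have gt: "continuous_on {0<..<Rm} (\<lambda>\<theta>. g (t * \<theta>))"
    proof (rule continuous_on_compose2[OF gc])
      show "(\<lambda>\<theta>. t * \<theta>) ` {0<..<Rm} \<subseteq> {0<..<Rm}"
      proof (clarsimp simp: t)
        fix \<theta> :: real assume \<theta>: "0 < \<theta>" "\<theta> < Rm"
        have "t * \<theta> \<le> 1 * \<theta>" using t \<theta> by (intro mult_right_mono) auto
        then show "t * \<theta> < Rm" using \<theta> by linarith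
      qed
    qed (intro continuous_intros)
    have hc: "continuous_on {0<..<Rm} h"
      unfolding h_def using g_pos by (intro continuous_intros gt gc) force
    have "z * (c * measure M (annulus x a b)) \<le> measure M (annulus x (t * a) (t * b))"
      if z: "0 < z" "z < 1" for z
    proof -
      have zc: "z * c < c" "0 < z * c" using z c0 by auto
      define U where "U = {0<..<Rm} \<inter> h -` {z * c<..}"
      have U: "open U" unfolding U_def
        by (rule continuous_open_preimage[OF hc]) auto
      have sub: "{a..b} \<subseteq> \<Union>{U}"
        using ab le zc unfolding U_def h_def by (force intro: less_le_trans)
      obtain e where e: "0 < e" "\<And>\<theta>. \<theta> \<in> {a..b} \<Longrightarrow> \<exists>G\<in>{U}. ball \<theta> e \<subseteq> G"
        by (rule Heine_Borel_lemma[OF compact_Icc sub]) (use U in auto)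
      have inU: "\<theta> \<in> U" if \<theta>: "a - e < \<theta>" "\<theta> < b + e" for \<theta>
      proof -
        define \<theta>0 where "\<theta>0 = max a (min b \<theta>)"
        have "\<theta>0 \<in> {a..b}" "\<theta> \<in> ball \<theta>0 e" using \<theta> ab e(1) by (auto simp: \<theta>0_def dist_real_def)
        then show ?thesis using e(2)[of \<theta>0] by auto
      qed
      have "b + e / 2 \<in> U" using ab e(1) by (intro inU) auto
      then have be: "b + e / 2 < Rm" by (simp add: U_def)
      have finA: "emeasure M A < \<infinity>" if "A \<subseteq> cball x r" for A r
        by (rule mms_finite_mono[OF M(1) _ that fin]) (simp add: sM)
      have "((z * c) powr (1 / N)) powr N * measure M (annulus x a b) \<le> measure M (annulus x (t * a) (t * b))"
      proof (rule CD_annulus[OF M CD N order_refl t])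
        show "0 < e / 2" "0 \<le> b" "0 \<le> (z * c) powr (1 / N)" "(0::real) < 1" using e ab by auto
        show "emeasure M (cball x (t * b + 1)) < \<infinity>" by (rule fin)
        show "annulus x a b \<in> sets M" unfolding sM by (rule borel_closed[OF closed_annulus])
        show "emeasure M (annulus x a b) < \<infinity>" by (rule finA[OF annulus_subset_cball])
        fix \<gamma> assume \<gamma>: "\<gamma> \<in> geodesics" "dist x (apply_bcontfun \<gamma> 0) < e / 2" "apply_bcontfun \<gamma> 1 \<in> annulus x a b"
        have 1: "a \<le> dist x (apply_bcontfun \<gamma> 1)" "dist x (apply_bcontfun \<gamma> 1) \<le> b" using \<gamma>(3) by (auto simp: annulus_def)
        note gb = geodesic_bounds[OF \<gamma>(1,2) 1]
        have "speed \<gamma> \<in> U" using gb e(1) by (intro inU) auto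
        then have sp: "0 < speed \<gamma>" "speed \<gamma> < Rm" "z * c < t * (g (t * speed \<gamma>) / g (speed \<gamma>))"
          by (auto simp: U_def h_def)
        have "(z * c) powr (1 / N) \<le> (t * (g (t * speed \<gamma>) / g (speed \<gamma>))) powr (1 / N)"
          using sp(3) zc N by (intro powr_mono2) auto
        then have "ennreal ((z * c) powr (1 / N)) \<le> ennreal ((t * (g (t * speed \<gamma>) / g (speed \<gamma>))) powr (1 / N))"
          by (rule ennreal_leI)
        also have "\<dots> \<le> tau N (k_plus k \<gamma>) t (speed \<gamma>)"
        proof (rule tau[OF t _ sp(1,2)])
          fix s assume "s \<in> {0..speed \<gamma>}"
          then have "dist x (unit_speed \<gamma> s) < b + e / 2" by (rule gb(4))
          then show "dist x (unit_speed \<gamma> s) < Rm" using be by simp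
        qed
        finally show "ennreal ((z * c) powr (1 / N)) \<le> tau N (k_plus k \<gamma>) t (speed \<gamma>)" .
      qed simp
      then show ?thesis using N zc by (simp add: powr_powr mult.assoc)
    qed
    then show ?thesis by (rule field_le_mult_one_interval)
  qed simp
qed

lemma sn_pos_below_diameter:
  assumes N: "1 < N" and R: "klow > 0 \<Longrightarrow> R \<le> pi * sqrt ((N - 1) / klow)" and s: "0 < s" "s < R"
  shows "0 < sn (klow / (N - 1)) s"
proof (rule sn_pos[OF s(1)])
  assume "klow / (N - 1) > 0"
  then have kl: "0 < klow" using N by (simp add: zero_less_divide_iff)
  have "pi * sqrt ((N - 1) / klow) = pi / sqrt (klow / (N - 1))"
    using kl N by (simp add: real_sqrt_divide)
  then show "s < pi / sqrt (klow / (N - 1))" using R[OF kl] s by simp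
qed

lemma sn_nonneg_up_to_diameter:
  assumes N: "1 < N" and R: "klow > 0 \<Longrightarrow> R \<le> pi * sqrt ((N - 1) / klow)" and s: "0 \<le> s" "s \<le> R"
  shows "0 \<le> sn (klow / (N - 1)) s"
proof (cases "s = 0")
  case False
  let ?sn = "sn (klow / (N - 1))"
  show ?thesis
  proof (rule tendsto_lowerbound)
    have "(?sn \<longlongrightarrow> ?sn s) (at s)" using DERIV_isCont[OF DERIV_sn] by (simp add: isCont_def)
    then show "(?sn \<longlongrightarrow> ?sn s) (at_left s)" by (rule tendsto_mono[OF at_le, rotated]) simp
    show "eventually (\<lambda>s'. 0 \<le> ?sn s') (at_left s)"
    proof (rule eventually_at_leftI[of 0])
      fix s' assume "s' \<in> {0<..<s}"
      then have "0 < s'" "s' < R" using s by auto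
      then show "0 \<le> ?sn s'" by (intro less_imp_le sn_pos_below_diameter[OF N R])
    qed (use False s in simp)
  qed (simp add: trivial_limit_at_left_real)
qed simp

lemma CD_radial_comparison_sn:
  fixes M :: "'a::polish_space measure" and x :: 'a
  assumes M: "metric_measure_space M" "msupport M = UNIV" and CD: "CD M k N" and N: "1 < N"
    and k: "admissible_curv k"
    and low: "\<And>y. y \<in> ball x R \<Longrightarrow> klow \<le> k y"
    and R: "klow > 0 \<Longrightarrow> R \<le> pi * sqrt ((N - 1) / klow)"
  shows "radial_comparison M x R (\<lambda>s. sn (klow / (N - 1)) s powr (N - 1))"
proof -
  let ?K = "klow / (N - 1)"
  have pos: "0 < sn ?K s" if "0 < s" "s < R" for s
    by (rule sn_pos_below_diameter[OF N R that])
  have N1: "1 \<le> N" using N by simp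
  show ?thesis
  proof (rule CD_radial_comparison[OF M CD N1 k])
    have "0 \<le> sn ?K s" if "s \<in> {0..<R}" for s
      using that pos[of s] by (cases "s = 0") (auto intro: less_imp_le)
    then show "continuous_on {0..<R} (\<lambda>s. sn ?K s powr (N - 1))"
      using N by (intro continuous_on_powr' continuous_on_sn continuous_intros) auto
    show "0 < sn ?K r powr (N - 1)" if "0 < r" "r < R" for r using pos[OF that] by simp
    fix t \<gamma> assume t: "0 < t" "t < (1::real)" and d: "\<And>s. s \<in> {0..speed \<gamma>} \<Longrightarrow> dist x (unit_speed \<gamma> s) < R"
      and sp: "0 < speed \<gamma>" "speed \<gamma> < R"
    have "t * speed \<gamma> \<le> 1 * speed \<gamma>" using t sp by (intro mult_right_mono) auto
    then have ts: "0 < t * speed \<gamma>" "t * speed \<gamma> < R" using t sp by (simp, linarith)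
    show "ennreal ((t * (sn ?K (t * speed \<gamma>) powr (N - 1) / sn ?K (speed \<gamma>) powr (N - 1))) powr (1 / N))
       \<le> tau N (k_plus k \<gamma>) t (speed \<gamma>)"
    proof (rule tau_ge[OF N t(1) less_imp_le[OF t(2)] sp(1) _ pos[OF ts] pos[OF sp]])
      fix s assume "s \<in> {0..speed \<gamma>}"
      then have "klow \<le> k (unit_speed \<gamma> s)" using d by (intro low) simp
      then show "?K * (N - 1) \<le> k_plus k \<gamma> s" using N by (simp add: k_plus_def)
    qed
  qed
qed

text \<open>A crude comparison, from any lower bound of \<open>k\<close> on a closed ball. It reaches beyond the balls on which
  the sharp bound is assumed.\<close>

lemma CD_radial_comparison_ex:
  fixes M :: "'a::polish_space measure" and x :: 'a
  assumes M: "metric_measure_space M" "msupport M = UNIV" and CD: "CD M k N" and N: "1 < N"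
    and k: "admissible_curv k"
  shows "\<exists>g. radial_comparison M x R g"
proof -
  obtain C where C: "0 < C" "\<forall>y\<in>cball x R. - C \<le> k y"
    using compact_lower_bound[OF k CD_proper[OF M CD _ k, of x R]] N by auto
  show ?thesis
    by (rule exI[of _ "\<lambda>s. sn (- C / (N - 1)) s powr (N - 1)"], rule CD_radial_comparison_sn[OF M CD N k])
       (use C in auto)
qed

text \<open>In dimension one, nonpositive curvature leaves \<open>\<tau> = t\<close>.\<close>

lemma CD_radial_comparison_const:
  fixes M :: "'a::polish_space measure" and x :: 'a
  assumes M: "metric_measure_space M" "msupport M = UNIV" and CD: "CD M k 1"
    and k: "admissible_curv k" and k0: "\<And>y. k y \<le> 0"
  shows "radial_comparison M x R (\<lambda>_. 1)"
proof (rule CD_radial_comparison[OF M CD _ k])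
  fix t and \<gamma> :: "real \<Rightarrow>\<^sub>C 'a" assume t: "0 < t" "t < (1::real)" and sp: "0 < speed \<gamma>"
  have "\<not> (\<forall>s\<in>{0..speed \<gamma>}. 0 < k_plus k \<gamma> s)"
    using k0 sp by (auto simp: k_plus_def not_less intro!: bexI[of _ 0])
  then show "ennreal ((t * (1 / 1)) powr (1 / 1)) \<le> tau 1 (k_plus k \<gamma>) t (speed \<gamma>)"
    using t by (auto simp: tau_def)
qed (auto intro!: continuous_intros)

lemma tendsto_at_left_of_continuous_on:
  fixes f :: "real \<Rightarrow> 'b::topological_space"
  assumes "continuous_on {a..b} f" "a < b"
  shows "(f \<longlongrightarrow> f b) (at_left b)"
proof -
  have "(f \<longlongrightarrow> f b) (at b within {a..b})" using assms unfolding continuous_on_def by auto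
  then show ?thesis using assms(2) by (simp add: at_within_Icc_at_left)
qed

text \<open>The comparison by \<open>g\<close> is known only for radii \<open>R' < R\<close>. The second comparison function bounds \<open>s(R)\<close>
  by \<open>s(R') g2(R) / g2(R')\<close>, where the factor tends to \<open>1\<close> as \<open>R'\<close> tends to \<open>R\<close>. In the product form
  of the inequality \<open>g R\<close> may vanish; then \<open>s(R) = 0\<close>.\<close>

lemma radial_comparison_endpoint:
  assumes A: "radial_comparison M x R g" and B: "radial_comparison M x R2 g2"
    and r: "0 < r" "r < R" "R < R2" and gc: "continuous_on {0..R} g"
  shows "sph M x r = ennreal (radial_comparison.sph_real M x r)"
    and "sph M x R = ennreal (radial_comparison.sph_real M x R)"
    and "g r * radial_comparison.sph_real M x R \<le> g R * radial_comparison.sph_real M x r"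
    and "integral {0..r} g * radial_comparison.vol_real M x R \<le> integral {0..R} g * radial_comparison.vol_real M x r"
proof -
  interpret A: radial_comparison M x R g by fact
  interpret B: radial_comparison M x R2 g2 by fact
  show "sph M x r = ennreal (A.sph_real r)" using r by (intro A.sph_eq_sph_real) auto
  show "sph M x R = ennreal (A.sph_real R)" using r by (intro B.sph_eq_sph_real) auto
  have r0: "0 < R" using r by simp
  have lim_g: "(g \<longlongrightarrow> g R) (at_left R)" by (rule tendsto_at_left_of_continuous_on[OF gc r0])
  have "continuous_on {0..R} g2" using r by (intro continuous_on_subset[OF B.g_cont]) auto
  note lim_g2 = tendsto_at_left_of_continuous_on[OF this r0]
  have g2R: "0 < g2 R" using r by (intro B.g_pos) auto
  have "g r * g2 R * A.sph_real R \<le> g2 R * g R * A.sph_real r"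
  proof (rule tendsto_le)
    show "((\<lambda>R'. g2 R * g R' * A.sph_real r) \<longlongrightarrow> g2 R * g R * A.sph_real r) (at_left R)"
      by (intro tendsto_intros lim_g)
    show "((\<lambda>R'. g r * g2 R' * A.sph_real R) \<longlongrightarrow> g r * g2 R * A.sph_real R) (at_left R)"
      by (intro tendsto_intros lim_g2)
    show "eventually (\<lambda>R'. g r * g2 R' * A.sph_real R \<le> g2 R * g R' * A.sph_real r) (at_left R)"
    proof (rule eventually_at_leftI[of r])
      fix R' assume R': "R' \<in> {r<..<R}"
      have gr: "0 < g r" using r by (intro A.g_pos) auto
      have 1: "g r * A.sph_real R' \<le> g R' * A.sph_real r" using R' r by (intro A.sph_real_comparison) auto
      have 2: "g2 R' * A.sph_real R \<le> g2 R * A.sph_real R'" using R' r by (intro B.sph_real_comparison) auto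
      have "g r * g2 R' * A.sph_real R \<le> g2 R * (g r * A.sph_real R')"
        using mult_left_mono[OF 2 less_imp_le[OF gr]] by (simp add: mult_ac)
      also have "\<dots> \<le> g2 R * (g R' * A.sph_real r)" using 1 g2R by (intro mult_left_mono) auto
      finally show "g r * g2 R' * A.sph_real R \<le> g2 R * g R' * A.sph_real r" by (simp add: mult_ac)
    qed (use r in simp)
  qed (simp add: trivial_limit_at_left_real)
  then have "g2 R * (g r * A.sph_real R) \<le> g2 R * (g R * A.sph_real r)" by (simp add: mult_ac)
  then show "g r * A.sph_real R \<le> g R * A.sph_real r" using g2R by (simp add: mult_le_cancel_left_pos)
  have "continuous_on {r..R} A.vol_real" using r by (intro B.vol_real_continuous) auto
  note lim_V = tendsto_at_left_of_continuous_on[OF this r(2)]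
  have "continuous_on {0..R} (\<lambda>R'. integral {0..R'} g)"
    by (intro indefinite_integral_continuous_1 integrable_continuous_real gc)
  note lim_G = tendsto_at_left_of_continuous_on[OF this r0]
  show "integral {0..r} g * A.vol_real R \<le> integral {0..R} g * A.vol_real r"
  proof (rule tendsto_le)
    show "((\<lambda>R'. integral {0..R'} g * A.vol_real r) \<longlongrightarrow> integral {0..R} g * A.vol_real r) (at_left R)"
      by (intro tendsto_intros lim_G)
    show "((\<lambda>R'. integral {0..r} g * A.vol_real R') \<longlongrightarrow> integral {0..r} g * A.vol_real R) (at_left R)"
      by (intro tendsto_intros lim_V)
    show "eventually (\<lambda>R'. integral {0..r} g * A.vol_real R' \<le> integral {0..R'} g * A.vol_real r) (at_left R)"
    proof (rule eventually_at_leftI[of r])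
      fix R' assume R': "R' \<in> {r<..<R}"
      then show "integral {0..r} g * A.vol_real R' \<le> integral {0..R'} g * A.vol_real r"
        using A.vol_real_comparison[of r R'] r by (simp add: A.g_integral_def)
    qed (use r in simp)
  qed (simp add: trivial_limit_at_left_real)
qed

text \<open>For \<open>b = 0\<close> the hypothesis forces \<open>a = 0\<close>, and \<open>0 / 0 = 0\<close> in the extended nonnegative reals.\<close>

lemma ennreal_ratio_le:
  assumes "a * d \<le> b * c" "0 \<le> a" "0 \<le> b" "0 \<le> c" "0 < d"
  shows "ennreal a / ennreal b \<le> ennreal c / ennreal d"
proof (cases "b = 0")
  case True
  then have "a = 0" using assms by (simp add: mult_le_0_iff)
  then show ?thesis by simp
next
  case False
  then have "a / b \<le> c / d" using assms by (simp add: field_simps)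
  then show ?thesis using assms False by (simp add: divide_ennreal ennreal_leI)
qed

lemma radial_ratios:
  assumes supp: "msupport M = UNIV"
    and A: "radial_comparison M x R g" and B: "radial_comparison M x R2 g2"
    and r: "0 < r" "r < R" "R < R2" and gc: "continuous_on {0..R} g" and gnn: "\<And>s. 0 \<le> s \<Longrightarrow> s \<le> R \<Longrightarrow> 0 \<le> g s"
  shows "sph M x R \<noteq> 0 \<Longrightarrow> ennreal (g r) / ennreal (g R) \<le> sph M x r / sph M x R"
    and "ennreal (integral {0..r} g) / ennreal (integral {0..R} g) \<le> vol M x r / vol M x R"
proof -
  interpret A: radial_comparison M x R g by fact
  note E = radial_comparison_endpoint[OF A B r gc]
  show "ennreal (g r) / ennreal (g R) \<le> sph M x r / sph M x R" if "sph M x R \<noteq> 0"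
    unfolding E(1,2)
  proof (rule ennreal_ratio_le[OF E(3)])
    show "0 < A.sph_real R" using that A.sph_real_nonneg[of R] unfolding E(2) by (auto simp: less_le)
  qed (use r gnn A.sph_real_nonneg in auto)
  have vol: "vol M x s = ennreal (A.vol_real s)" for s
    using A.cball_fm[of s] by (simp add: vol_def A.vol_real_def emeasure_eq_measure2)
  show "ennreal (integral {0..r} g) / ennreal (integral {0..R} g) \<le> vol M x r / vol M x R"
    unfolding vol
  proof (rule ennreal_ratio_le[OF E(4)])
    show "0 \<le> integral {0..r} g" "0 \<le> integral {0..R} g"
      using r gnn by (auto intro!: integral_nonneg integrable_continuous_real continuous_on_subset[OF gc])
    show "0 \<le> A.vol_real r" by (simp add: A.vol_real_def)
    have "0 < emeasure M (ball x R)" using r by (intro mms_ball_pos[OF supp]) auto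
    also have "\<dots> \<le> emeasure M (cball x R)" by (rule emeasure_mono[OF ball_subset_cball]) (simp add: A.sM)
    also have "\<dots> = ennreal (A.vol_real R)" using vol[of R] by (simp add: vol_def)
    finally show "0 < A.vol_real R" by simp
  qed
qed

lemma Bishop_Gromov:
  fixes M :: "'a::polish_space measure" and x :: 'a
  assumes M: "metric_measure_space M" "msupport M = UNIV" and CD: "CD M k N" and N: "1 < N"
    and k: "admissible_curv k" and r: "0 < r" "r < R"
    and low: "\<forall>y\<in>ball x R. klow \<le> k y" and R: "klow > 0 \<longrightarrow> R \<le> pi * sqrt ((N - 1) / klow)"
  defines "g \<equiv> \<lambda>t. sin_curv (klow / (N - 1)) t powr (N - 1)"
  shows "(sph M x R \<noteq> 0 \<longrightarrow> sph M x r / sph M x R \<ge> ennreal (g r) / ennreal (g R)) \<and>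
    vol M x r / vol M x R \<ge> ennreal (integral {0..r} g) / ennreal (integral {0..R} g)"
proof -
  have A: "radial_comparison M x R g"
    unfolding g_def sin_curv_eq_sn using low R by (intro CD_radial_comparison_sn[OF M CD N k]) auto
  obtain g2 where B: "radial_comparison M x (R + 1) g2"
    using CD_radial_comparison_ex[OF M CD N k, of x "R + 1"] by blast
  have "0 \<le> sn (klow / (N - 1)) s" if "0 \<le> s" "s \<le> R" for s
    using R by (intro sn_nonneg_up_to_diameter[OF N _ that]) auto
  then have gc: "continuous_on {0..R} g"
    unfolding g_def sin_curv_eq_sn using N by (intro continuous_on_powr' continuous_on_sn continuous_intros) auto
  have "0 \<le> g s" for s by (simp add: g_def)
  then show ?thesis using radial_ratios[OF M(2) A B r _ gc] by simp
qed

lemma Bishop_Gromov_dim1: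
  fixes M :: "'a::polish_space measure" and x :: 'a
  assumes M: "metric_measure_space M" "msupport M = UNIV" and CD: "CD M k 1" and k: "admissible_curv k"
    and k0: "\<forall>y. k y \<le> 0" and r: "0 < r" "r < R"
  shows "(sph M x R \<noteq> 0 \<longrightarrow> sph M x r / sph M x R \<ge> 1) \<and> vol M x r / vol M x R \<ge> ennreal (r / R)"
proof -
  have rc: "radial_comparison M x R' (\<lambda>_. 1)" for R'
    using k0 by (intro CD_radial_comparison_const[OF M CD k]) auto
  have R: "R < R + 1" by simp
  show ?thesis using radial_ratios[OF M(2) rc rc r R continuous_on_const] r by (simp add: divide_ennreal)
qed

theorem theorem5p3:
  fixes M :: "'a::polish_space measure" and k :: "'a \<Rightarrow> real" and N :: real
  assumes "metric_measure_space M"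
    and "msupport M = UNIV"
    and "admissible_curv k"
    and "1 \<le> N"
    and "CD M k N"
  shows "(\<forall>(x::'a) r. compact (cball x r)) \<and>
    (\<forall>B\<in>sets M. bounded B \<longrightarrow> emeasure M B < \<infinity>) \<and>
    (\<forall>B. bounded B \<longrightarrow> doubling_on M B) \<and>
    ((\<exists>x. msupport M = {x}) \<or>
     ((\<forall>x. emeasure M {x} = 0) \<and> (\<forall>x. \<forall>r>0. emeasure M (sphere x r) = 0))) \<and>
    (1 < N \<longrightarrow>
      (\<forall>x\<^sub>0 r R klow. 0 < r \<longrightarrow> r < R \<longrightarrow> (\<forall>x\<in>ball x\<^sub>0 R. klow \<le> k x) \<longrightarrow>
        (klow > 0 \<longrightarrow> R \<le> pi * sqrt ((N - 1) / klow)) \<longrightarrow>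
        (sph M x\<^sub>0 R \<noteq> 0 \<longrightarrow>
           sph M x\<^sub>0 r / sph M x\<^sub>0 R \<ge>
             ennreal (sin_curv (klow / (N - 1)) r powr (N - 1)) /
             ennreal (sin_curv (klow / (N - 1)) R powr (N - 1))) \<and>
        vol M x\<^sub>0 r / vol M x\<^sub>0 R \<ge>
          ennreal (integral {0..r} (\<lambda>t. sin_curv (klow / (N - 1)) t powr (N - 1))) /
          ennreal (integral {0..R} (\<lambda>t. sin_curv (klow / (N - 1)) t powr (N - 1))))) \<and>
    (N = 1 \<longrightarrow> (\<forall>x. k x \<le> 0) \<longrightarrow>
      (\<forall>x\<^sub>0 r R. 0 < r \<longrightarrow> r < R \<longrightarrow>
        (sph M x\<^sub>0 R \<noteq> 0 \<longrightarrow> sph M x\<^sub>0 r / sph M x\<^sub>0 R \<ge> 1) \<and>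
        vol M x\<^sub>0 r / vol M x\<^sub>0 R \<ge> ennreal (r / R)))"
proof (intro conjI)
  note M = assms(1,2) and k = assms(3) and N = assms(4) and CD = assms(5)
  have sM: "sets M = sets borel" by (rule mms_sets[OF M(1)])
  show proper: "\<forall>(x::'a) r. compact (cball x r)"
    using CD_proper[OF M CD N k] by blast
  show "\<forall>B\<in>sets M. bounded B \<longrightarrow> emeasure M B < \<infinity>"
  proof (intro ballI impI)
    fix B :: "'a set" assume "bounded B"
    then obtain x r where "B \<subseteq> cball x r" using bounded_subset_cball by blast
    then show "emeasure M B < \<infinity>"
      by (rule mms_finite_mono[OF M(1), rotated])
         (use proper compact_finite_measure[OF M(1)] sM in auto)
  qed
  show "\<forall>B. bounded B \<longrightarrow> doubling_on M B"
    using CD_doubling[OF M CD N k] by blast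
  show "(\<exists>x. msupport M = {x}) \<or>
     ((\<forall>x. emeasure M {x} = 0) \<and> (\<forall>x. \<forall>r>0. emeasure M (sphere x r) = 0))"
  proof -
    have sph: "emeasure M (sphere x r) = 0" if r: "0 < r" for x r
    proof -
      have "1 < max N 2" by simp
      from CD_radial_comparison_ex[OF M CD_mono[OF CD max.cobounded1] this k, of x "r + 1"]
      obtain g where g: "radial_comparison M x (r + 1) g" by (elim exE)
      show ?thesis by (rule radial_comparison.sphere_null[OF g r]) simp
    qed
    have "emeasure M {x} = 0" if no: "\<nexists>x. msupport M = {x}" for x
    proof -
      \<comment> \<open>A point lies on a sphere about any other point.\<close>
      obtain y where y: "y \<noteq> x" using no M(2) by (metis UNIV_eq_I singletonI)
      have "sphere y (dist y x) = annulus y (dist y x) (dist y x)" by (auto simp: annulus_def)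
      then have "closed (sphere y (dist y x))" using closed_annulus[of y "dist y x" "dist y x"] by simp
      then have "emeasure M {x} \<le> emeasure M (sphere y (dist y x))"
        by (intro emeasure_mono) (auto simp: sM)
      then show ?thesis using sph[of "dist y x" y] y by simp
    qed
    then show ?thesis using sph by blast
  qed
qed (use Bishop_Gromov[OF assms(1,2,5) _ assms(3)] Bishop_Gromov_dim1[OF assms(1,2) _ assms(3)] assms(5) in auto)

end
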